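(* Let $\alpha$ be an irrational number of bounded type. Then there exist sequences of real numbers $A_n=O(\log n)$ and $B_n\asymp\sqrt{\log n}$ (with $B_n>0$) such that for all $a<b$, $$\frac1n\#\left\{1\le N\le n:\frac{D_N(\alpha)-A_n}{B_n}\in[a,b]\right\}\xrightarrow[n\to\infty]{}\frac1{\sqrt{2\pi}}\int_a^be^{-t^2/2}\,dt .$$
   Context: $\{x\}\in[0,1)$ denotes the fractional part of $x$. For irrational $\alpha$, $D_N(\alpha):=\#\{0\le j\le N-1:\{j\alpha\}\in[0,\tfrac12)\}-\tfrac12N$. An irrational number is of bounded type if the partial quotients of its regular continued fraction expansion are bounded. $a_n\asymp b_n$ means that there are $C,N>1$ such that $C^{-1}\le a_n/b_n\le C$ for all $n>N$. *)

theory Defs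
  imports "HOL-Analysis.Analysis" "HOL-Library.Landau_Symbols"
begin

(* Complete quotients of the regular continued fraction [a_0; a_1, a_2, ...] of an irrational
   number; for irrational alpha no denominator below vanishes. *)
primrec complete_quotient :: "real \<Rightarrow> nat \<Rightarrow> real" where
  "complete_quotient \<alpha> 0 = \<alpha>"
| "complete_quotient \<alpha> (Suc k) = 1 / frac (complete_quotient \<alpha> k)"

definition partial_quotient :: "real \<Rightarrow> nat \<Rightarrow> int" where
  "partial_quotient \<alpha> k = \<lfloor>complete_quotient \<alpha> k\<rfloor>"

(* The absolute value only matters for a_0, which may be negative. *)
definition bounded_type :: "real \<Rightarrow> bool" where
  "bounded_type \<alpha> \<longleftrightarrow> \<alpha> \<notin> \<rat> \<and> (\<exists>K. \<forall>k. \<bar>partial_quotient \<alpha> k\<bar> \<le> K)"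

definition discrepancy :: "real \<Rightarrow> nat \<Rightarrow> real" where
  "discrepancy \<alpha> N =
     real (card {j. j < N \<and> frac (real j * \<alpha>) \<in> {0..<1/2}}) - real N / 2"

definition same_order :: "(nat \<Rightarrow> real) \<Rightarrow> (nat \<Rightarrow> real) \<Rightarrow> bool" where
  "same_order a b \<longleftrightarrow>
     (\<exists>C::real. \<exists>N::nat. C > 1 \<and> N > 1 \<and> (\<forall>n>N. 1 / C \<le> a n / b n \<and> a n / b n \<le> C))"

end

theory Submission
  imports Defs "HOL-Probability.Probability" "HOL-Real_Asymp.Real_Asymp"
begin

text \<open>
  With \<open>\<theta> = 2 * \<alpha>\<close> the discrepancy is, up to an affine change, the sum \<open>T N\<close> of the signs
  \<open>(-1) ^ floor (j * \<theta>)\<close> for \<open>1 \<le> j \<le> N\<close>. Consider Farey neighbours \<open>p/q < \<theta> < p'/q'\<close> whose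
  numerators are both odd. For such denominators \<open>T\<close> satisfies a reflection symmetry on \<open>{0..<q}\<close>,
  so that the exponential sums of \<open>T\<close> over \<open>{0..<q}\<close> are, after centring, real cosine sums
  \<open>R q z\<close>. The continued fraction algorithm that stays with odd numerators replaces
  \<open>(R, R')\<close> by combinations \<open>R * K (j + 1) + R' * K j\<close> with Dirichlet kernels \<open>K\<close>, that is, the
  normalised sums are weighted means of the previous ones, damped by factors
  \<open>1 - \<nu> * z^2 + O(z^4)\<close>. By bounded type the weight of \<open>R\<close> is bounded below, which makes the
  difference of the logarithms of the two normalised sums contract, so that it stays \<open>O(z^2)\<close>, and
  by induction each logarithm equals \<open>- s * z^2 + O(ln q * z^4)\<close> with \<open>s\<close> of exact order \<open>ln q\<close>.

  Finally \<open>{0..<n}\<close> is cut into blocks of lengths \<open>q\<close> and \<open>q'\<close> of size about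
  \<open>n / (ln n) powr (1/4)\<close>. Because \<open>p\<close> and \<open>p'\<close> are odd, the signs of consecutive blocks
  alternate and all blocks see the same centred distribution up to a negligible shift; Levy's
  continuity theorem concludes.
\<close>

section \<open>Badly approximable numbers\<close>

text \<open>With odd numerators every quantity in the recursion is real and, for small
  \<open>z\<close>, positive, so real logarithms exist and no cancellation between complex terms has
  to be controlled. The obstacle is that the recursion forms means and not products: the logarithm
  of a weighted mean is the mean of the logarithms only up to the square of their difference. As
  long as the two logarithms stay within \<open>O(z^2)\<close> of each other, this error is
  \<open>O(z^4)\<close> per step, and with \<open>z\<close> of order \<open>1 / sqrt (ln n)\<close>
  about \<open>ln n\<close> such errors are harmless. Bounded type enters as a lower bound for
  \<open>\<bar>q * \<theta> - p\<bar>\<close>, which bounds both the ratio of neighbouring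
  denominators and the length of a step. The exponent \<open>1/4\<close> is a compromise:
  \<open>k\<close> blocks displace the centre by \<open>O(k)\<close>, which must be small against
  the standard deviation, of order \<open>sqrt (ln n)\<close>, while the incomplete last block is a
  fraction of order \<open>1 / k\<close> of the orbit and must be negligible too.\<close>

definition badly_approximable :: "real \<Rightarrow> real \<Rightarrow> bool" where
  "badly_approximable c \<theta> \<longleftrightarrow> 0 < c \<and> (\<forall>q>0. \<forall>p::int. c / real q \<le> \<bar>real q * \<theta> - p\<bar>)"

text \<open>Take the largest value of \<open>g\<close> not exceeding \<open>n\<close>: its successor
  overshoots \<open>n\<close> but is at most \<open>C\<close> times as large. This serves both the
  convergents of \<alpha> and the pairs of the odd algorithm, since every scale has to be met up to
  a constant factor.\<close>

lemma geometric_window: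
  fixes g :: "'a \<Rightarrow> nat"
  assumes start: "P a0" "g a0 \<le> n"
    and step: "\<And>a. P a \<Longrightarrow> \<exists>b. P b \<and> g a < g b \<and> g b \<le> C * g a"
  shows "\<exists>a. P a \<and> g a \<le> n \<and> n < C * g a"
proof -
  define S where "S = {g a | a. P a \<and> g a \<le> n}"
  have "finite S" "S \<noteq> {}"
    using start unfolding S_def by (auto intro: finite_subset[of _ "{..n}"])
  then have "Max S \<in> S" by simp
  then obtain a where a: "P a" "g a \<le> n" "g a = Max S" unfolding S_def by auto
  obtain b where b: "P b" "g a < g b" "g b \<le> C * g a" using step[OF a(1)] by auto
  have "n < g b"
  proof (rule ccontr)
    assume "\<not> n < g b"
    then have "g b \<in> S" using b(1) unfolding S_def by auto
    then show False using b(2) a(3) \<open>finite S\<close> Max_ge leD by metis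
  qed
  then show ?thesis using a b by (intro exI[of _ a]) auto
qed

section \<open>Bounded partial quotients give a Diophantine lower bound\<close>

lemma complete_quotient_irrational: "\<alpha> \<notin> \<rat> \<Longrightarrow> complete_quotient \<alpha> k \<notin> \<rat>"
proof (induction k)
  case (Suc k)
  have "frac (complete_quotient \<alpha> k) \<notin> \<rat>"
    using Suc Rats_add[OF _ Rats_of_int] unfolding frac_def by (metis diff_add_cancel)
  then show ?case using Rats_inverse by (fastforce simp: divide_inverse)
qed simp

lemma complete_quotient_Suc:
  assumes "\<alpha> \<notin> \<rat>"
  shows "complete_quotient \<alpha> (Suc k) > 1"
    and "complete_quotient \<alpha> k = partial_quotient \<alpha> k + 1 / complete_quotient \<alpha> (Suc k)"
proof -
  have "frac (complete_quotient \<alpha> k) \<noteq> 0"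
    using complete_quotient_irrational[OF assms, of k] by (metis Ints_subset_Rats frac_eq_0_iff subsetD)
  then have "0 < frac (complete_quotient \<alpha> k)" "frac (complete_quotient \<alpha> k) < 1"
    using frac_lt_1 frac_ge_0 by (auto simp: order_less_le)
  then show "complete_quotient \<alpha> (Suc k) > 1"
    by (simp add: divide_simps)
  show "complete_quotient \<alpha> k = partial_quotient \<alpha> k + 1 / complete_quotient \<alpha> (Suc k)"
    by (simp add: partial_quotient_def frac_def)
qed

definition convergent_at :: "real \<Rightarrow> nat \<times> nat \<times> int \<times> nat \<times> int \<Rightarrow> bool" where
  "convergent_at \<alpha> = (\<lambda>(k, q, p, q', p').
     \<alpha> * (q' * complete_quotient \<alpha> (Suc k) + q) = p' * complete_quotient \<alpha> (Suc k) + p \<and>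
     \<bar>p * int q' - p' * int q\<bar> = 1 \<and> q \<le> q' \<and> 0 < q')"

text \<open>For a convergent with \<open>q' > 2 * Q\<close> the fractions \<open>P/Q\<close> and
  \<open>p'/q'\<close> differ, so \<open>1 \<le> \<bar>P * q' - Q * p'\<bar>\<close>. At most half
  of this is due to the error of the convergent; the rest bounds
  \<open>\<bar>Q * \<alpha> - P\<bar>\<close> from below by \<open>1 / (2 * q')\<close>. Bounded
  partial quotients allow \<open>q'\<close> to be of order \<open>Q\<close>.\<close>

lemma bounded_type_badly_approximable:
  assumes "bounded_type \<alpha>"
  shows "\<exists>c. badly_approximable c \<alpha>"
proof -
  have irr: "\<alpha> \<notin> \<rat>" using assms unfolding bounded_type_def by auto
  obtain K0 where K0: "\<And>k. \<bar>partial_quotient \<alpha> k\<bar> \<le> K0" using assms unfolding bounded_type_def by auto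
  \<comment> \<open>One step replaces \<open>q + q'\<close> by \<open>q' + (m * q' + q)\<close> with
    \<open>m \<le> nat K0\<close>, hence multiplies it by at most \<open>K\<close>.\<close>
  define K where "K = nat K0 + 2"
  have K: "partial_quotient \<alpha> k \<le> int (nat K0)" for k using K0[of k] by linarith
  define g where "g = (\<lambda>(k::nat, q::nat, p::int, q'::nat, p'::int). q + q')"
  have start: "convergent_at \<alpha> (0, 0, 1, 1, \<lfloor>\<alpha>\<rfloor>)"
  proof -
    define x where "x = complete_quotient \<alpha> (Suc 0)"
    have "x > 1" "\<alpha> = partial_quotient \<alpha> 0 + 1 / x"
      using complete_quotient_Suc[OF irr, of 0] unfolding x_def by simp_all
    then have "\<alpha> * x = partial_quotient \<alpha> 0 * x + 1" by (simp add: field_simps)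
    then show ?thesis unfolding convergent_at_def by (simp add: x_def partial_quotient_def)
  qed
  have step: "\<exists>b. convergent_at \<alpha> b \<and> g a < g b \<and> g b \<le> K * g a" if "convergent_at \<alpha> a" for a
  proof -
    obtain k q p q' p' where a: "a = (k, q, p, q', p')" by (cases a)
    define x where "x = complete_quotient \<alpha> (Suc k)"
    define x' where "x' = complete_quotient \<alpha> (Suc (Suc k))"
    define m where "m = nat (partial_quotient \<alpha> (Suc k))"
    have x: "x > 1" "x' > 1" "x = partial_quotient \<alpha> (Suc k) + 1 / x'"
      using complete_quotient_Suc[OF irr] unfolding x_def x'_def by blast+
    have "partial_quotient \<alpha> (Suc k) \<ge> 1"
      using x(1) unfolding partial_quotient_def x_def by (simp add: le_floor_iff)
    then have m: "int m = partial_quotient \<alpha> (Suc k)" "m \<ge> 1" "m \<le> nat K0"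
      using K[of "Suc k"] unfolding m_def by linarith+
    have c: "\<alpha> * (q' * x + q) = p' * x + p" "\<bar>p * int q' - p' * int q\<bar> = 1" "q \<le> q'" "0 < q'"
      using that unfolding a convergent_at_def x_def by auto
    have xm: "x * x' = m * x' + 1" using x m(1)[symmetric] by (simp add: field_simps)
    have "\<alpha> * (real (m * q' + q) * x' + q') = \<alpha> * (q' * (m * x' + 1) + q * x')"
      by (simp add: algebra_simps)
    also have "\<dots> = \<alpha> * (q' * x + q) * x'" unfolding xm[symmetric] by (simp add: algebra_simps)
    also have "\<dots> = p' * (x * x') + p * x'" unfolding c(1) by (simp add: algebra_simps)
    also have "\<dots> = real_of_int (int m * p' + p) * x' + p'" unfolding xm by (simp add: algebra_simps)
    finally have e: "\<alpha> * (real (m * q' + q) * x' + q') = real_of_int (int m * p' + p) * x' + p'" .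
    have "p' * int (m * q' + q) - (int m * p' + p) * int q' = - (p * int q' - p' * int q)"
      by (simp add: algebra_simps)
    then have d: "\<bar>p' * int (m * q' + q) - (int m * p' + p) * int q'\<bar> = 1" using c(2) by linarith
    have "q' \<le> m * q'" using m(2) by simp
    then have "convergent_at \<alpha> (Suc k, q', p', m * q' + q, int m * p' + p)"
      unfolding convergent_at_def prod.case x'_def[symmetric]
      using c(4) by (intro conjI e d trans_le_add1) linarith+
    moreover have "q' + (m * q' + q) \<le> K * (q + q')"
    proof -
      have "m * q' \<le> nat K0 * q'" using m(3) by (rule mult_le_mono1)
      then have "q' + (m * q' + q) \<le> q' + (nat K0 * q' + q)" by linarith
      also have "\<dots> \<le> K * (q + q')" by (simp add: K_def algebra_simps)
      finally show ?thesis .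
    qed
    ultimately show ?thesis
      using \<open>q' \<le> m * q'\<close> c(4)
      by (intro exI[of _ "(Suc k, q', p', m * q' + q, int m * p' + p)"]) (auto simp: a g_def)
  qed
  define c where "c = 1 / real (8 * K)"
  have "c / real Q \<le> \<bar>real Q * \<alpha> - P\<bar>" if Q: "Q > 0" for Q and P :: int
  proof -
    have "4 * K * Q \<ge> 1 * 1" using Q by (intro mult_le_mono) (auto simp: K_def)
    then have "g (0, 0, 1, 1, \<lfloor>\<alpha>\<rfloor>) \<le> 4 * K * Q" by (simp add: g_def)
    \<comment> \<open>The window at \<open>4 * K * Q\<close> yields \<open>4 * Q < q + q'\<close>,
      hence \<open>2 * Q < q'\<close>.\<close>
    from geometric_window[of "convergent_at \<alpha>", OF start this step]
    obtain a where a0: "convergent_at \<alpha> a" "g a \<le> 4 * K * Q" "4 * K * Q < K * g a" by blast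
    obtain k q p q' p' where a: "a = (k, q, p, q', p')" by (cases a)
    define x where "x = complete_quotient \<alpha> (Suc k)"
    have x: "x > 1" using complete_quotient_Suc[OF irr] unfolding x_def by blast
    have c: "\<alpha> * (q' * x + q) = p' * x + p" "\<bar>p * int q' - p' * int q\<bar> = 1" "q \<le> q'" "0 < q'"
      using a0(1) unfolding a convergent_at_def x_def by auto
    have g: "q + q' \<le> 4 * K * Q" "K * (4 * Q) < K * (q + q')" using a0 by (auto simp: a g_def)
    from g(2) have "4 * Q < q + q'" by (simp only: mult_less_cancel1)
    then have q'2: "2 * Q < q'" using c(3) by linarith
    have "(\<alpha> * q' - p') * (q' * x + q) = q' * (\<alpha> * (q' * x + q)) - p' * (q' * x + q)"
      by (simp add: algebra_simps)
    also have "\<dots> = of_int (p * int q' - p' * int q)" unfolding c(1) by (simp add: algebra_simps)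
    finally have "\<bar>(\<alpha> * q' - p') * (q' * x + q)\<bar> = of_int \<bar>p * int q' - p' * int q\<bar>"
      by (simp only: of_int_abs)
    then have "\<bar>\<alpha> * q' - p'\<bar> * \<bar>q' * x + q\<bar> = 1" unfolding c(2) abs_mult by simp
    moreover have "real q' * 1 \<le> q' * x" using x by (intro mult_left_mono) auto
    then have qx: "real q' \<le> q' * x + q" by simp
    then have "\<bar>\<alpha> * q' - p'\<bar> * q' \<le> \<bar>\<alpha> * q' - p'\<bar> * \<bar>q' * x + q\<bar>"
      by (intro mult_left_mono) auto
    ultimately have "\<bar>\<alpha> * q' - p'\<bar> * q' \<le> 1" by simp
    then have ap: "\<bar>\<alpha> * q' - p'\<bar> \<le> 1 / q'" using c(4) by (simp add: field_simps)
    have cop: "coprime p' (int q')"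
    proof (rule coprimeI)
      fix d assume "d dvd p'" "d dvd int q'"
      then have "d dvd \<bar>p * int q' - p' * int q\<bar>" by (simp add: dvd_diff dvd_mult)
      then show "is_unit d" using c(2) by simp
    qed
    have "P * int q' - int Q * p' \<noteq> 0"
    proof
      assume "P * int q' - int Q * p' = 0"
      then have "int q' dvd int Q * p'" by (metis dvd_triv_right eq_iff_diff_eq_0)
      then have "int q' dvd int Q" using cop by (metis coprime_commute coprime_dvd_mult_left_iff)
      then show False using q'2 Q by (auto dest: dvd_imp_le)
    qed
    then have "1 \<le> \<bar>P * int q' - int Q * p'\<bar>" by linarith
    then have "1 \<le> real_of_int \<bar>P * int q' - int Q * p'\<bar>" by linarith
    also have "real_of_int \<bar>P * int q' - int Q * p'\<bar> = \<bar>- q' * (real Q * \<alpha> - P) + Q * (\<alpha> * q' - p')\<bar>"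
      by (simp add: algebra_simps)
    also have "\<dots> \<le> q' * \<bar>real Q * \<alpha> - P\<bar> + Q * \<bar>\<alpha> * q' - p'\<bar>"
      by (rule order_trans[OF abs_triangle_ineq]) (simp add: abs_mult)
    also have "Q * \<bar>\<alpha> * q' - p'\<bar> \<le> Q * (1 / q')" using ap by (intro mult_left_mono) auto
    also have "\<dots> \<le> 1 / 2" using q'2 by (simp add: field_simps)
    finally have 1: "1 / 2 \<le> q' * \<bar>real Q * \<alpha> - P\<bar>" by simp
    have "real q' \<le> real (4 * K * Q)" using g(1) by linarith
    then have "q' * \<bar>real Q * \<alpha> - P\<bar> \<le> real (4 * K * Q) * \<bar>real Q * \<alpha> - P\<bar>"
      by (intro mult_right_mono) auto
    with 1 have "1 / 2 \<le> real (4 * K * Q) * \<bar>real Q * \<alpha> - P\<bar>" by linarith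
    moreover have "0 < K" by (simp add: K_def)
    ultimately show ?thesis using Q unfolding c_def by (simp add: field_simps)
  qed
  moreover have "c > 0" by (simp add: c_def K_def)
  ultimately show ?thesis unfolding badly_approximable_def by blast
qed

lemma badly_approximable_double:
  assumes "badly_approximable c \<alpha>"
  shows "badly_approximable (c / 2) (2 * \<alpha>)"
  unfolding badly_approximable_def
proof (intro conjI allI impI)
  fix q :: nat and p :: int assume "0 < q"
  then have "c / real (2 * q) \<le> \<bar>real (2 * q) * \<alpha> - p\<bar>"
    using assms unfolding badly_approximable_def by (metis mult_pos_pos zero_less_numeral)
  then show "c / 2 / real q \<le> \<bar>real q * (2 * \<alpha>) - p\<bar>" by (simp add: algebra_simps)
qed (use assms in \<open>auto simp: badly_approximable_def\<close>)

lemma badly_approximable_uminus: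
  assumes "badly_approximable c \<theta>"
  shows "badly_approximable c (- \<theta>)"
  unfolding badly_approximable_def
proof (intro conjI allI impI)
  fix q :: nat and p :: int assume "0 < q"
  then have "c / real q \<le> \<bar>real q * \<theta> - (- p)\<bar>"
    using assms unfolding badly_approximable_def by (metis of_int_minus)
  then show "c / real q \<le> \<bar>real q * - \<theta> - p\<bar>" by (simp add: abs_minus_commute)
qed (use assms in \<open>auto simp: badly_approximable_def\<close>)

lemma badly_approximable_neq:
  "badly_approximable c \<theta> \<Longrightarrow> 0 < q \<Longrightarrow> real q * \<theta> \<noteq> of_int p"
  unfolding badly_approximable_def
  by (metis abs_0 diff_self divide_pos_pos leD of_nat_0_less_iff)

section \<open>Signs along Farey pairs\<close>

definition rot_sign :: "real \<Rightarrow> nat \<Rightarrow> real" where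
  "rot_sign \<theta> j = (if even \<lfloor>real j * \<theta>\<rfloor> then 1 else - 1)"

definition rot_sum :: "real \<Rightarrow> nat \<Rightarrow> real" where
  "rot_sum \<theta> N = (\<Sum>j=1..N. rot_sign \<theta> j)"

definition farey_pair :: "real \<Rightarrow> int \<Rightarrow> nat \<Rightarrow> int \<Rightarrow> nat \<Rightarrow> bool" where
  "farey_pair \<theta> p q p' q' \<longleftrightarrow>
     0 < q \<and> 0 < q' \<and> p' * int q - p * int q' = 1 \<and> p < real q * \<theta> \<and> real q' * \<theta> < p'"

text \<open>Unimodularity writes \<open>(i, r)\<close> as \<open>u * (q, p) + v * (q', p')\<close>
  with integers \<open>u\<close> and \<open>v\<close>, and then
  \<open>i * \<theta> - r = u * \<delta> - v * \<delta>'\<close>. Both coefficients positive force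
  \<open>q + q' \<le> i\<close>, opposite signs force a distance of at least
  \<open>\<delta> + \<delta>'\<close>, and a vanishing coefficient leaves a multiple of one
  neighbour.\<close>

lemma farey_pair_approximation:
  assumes fp: "farey_pair \<theta> p q p' q'" and i: "0 < i"
  defines "\<delta> \<equiv> real q * \<theta> - p" and "\<delta>' \<equiv> p' - real q' * \<theta>"
  shows "q + q' \<le> i \<or> q \<le> i \<and> \<delta> \<le> real i * \<theta> - of_int r \<or> \<delta> + \<delta>' \<le> real i * \<theta> - of_int r
    \<or> q' \<le> i \<and> real i * \<theta> - of_int r \<le> - \<delta>' \<or> real i * \<theta> - of_int r \<le> - \<delta> - \<delta>'"
proof -
  have q: "0 < q" "0 < q'" and det: "p' * int q - p * int q' = 1" and \<delta>: "0 < \<delta>" "0 < \<delta>'"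
    using fp by (auto simp: farey_pair_def \<delta>_def \<delta>'_def)
  define u where "u = int i * p' - r * int q'"
  define v where "v = r * int q - int i * p"
  have det': "real_of_int p' * q - p * q' = 1" using arg_cong[OF det, of real_of_int] by simp
  have "u * int q + v * int q' = int i * (p' * int q - p * int q')"
    by (simp add: u_def v_def algebra_simps)
  then have iuv: "int i = u * int q + v * int q'" using det by simp
  have "u * \<delta> - v * \<delta>' = (real i * \<theta> - r) * (real_of_int p' * q - p * q')"
    by (simp add: u_def v_def \<delta>_def \<delta>'_def algebra_simps)
  then have D: "real i * \<theta> - r = u * \<delta> - v * \<delta>'" using det' by simp
  have mono: "a \<le> w \<Longrightarrow> of_int a * \<epsilon> \<le> of_int w * \<epsilon>" if "0 < \<epsilon>" for a w :: int and \<epsilon> :: real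
    using that by (intro mult_right_mono) auto
  have imono: "a \<le> w \<Longrightarrow> a * int k \<le> w * int k" for a w :: int and k :: nat
    by (intro mult_right_mono) auto
  consider "u \<le> 0" "v \<le> 0" | "1 \<le> u" "1 \<le> v" | "1 \<le> u" "v = 0" | "1 \<le> u" "v \<le> -1"
    | "u = 0" "1 \<le> v" | "u \<le> -1" "1 \<le> v" by linarith
  then show ?thesis
  proof cases
    case 1
    then have "int i \<le> 0" using imono[of u 0 q] imono[of v 0 q'] iuv by simp
    then show ?thesis using i by simp
  next
    case 2
    then show ?thesis using imono[of 1 u q] imono[of 1 v q'] iuv by simp
  next
    case 3
    then show ?thesis using imono[of 1 u q] mono[of \<delta> 1 u] \<delta> iuv D by simp
  next
    case 4
    then have "\<delta> \<le> u * \<delta>" "v * \<delta>' \<le> - \<delta>'" using mono[of \<delta> 1 u] mono[of \<delta>' v "-1"] \<delta> by auto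
    then show ?thesis using D by linarith
  next
    case 5
    then show ?thesis using imono[of 1 v q'] mono[of \<delta>' 1 v] \<delta> iuv D by simp
  next
    case 6
    then have "u * \<delta> \<le> - \<delta>" "\<delta>' \<le> v * \<delta>'" using mono[of \<delta> u "-1"] mono[of \<delta>' 1 v] \<delta> by auto
    then show ?thesis using D by linarith
  qed
qed

lemma farey_pair_pos:
  assumes "farey_pair \<theta> p q p' q'"
  shows "0 < real q * \<theta> - p" "0 < p' - real q' * \<theta>"
    "(real q * \<theta> - p) * q' + (p' - real q' * \<theta>) * q = 1"
    "real q * \<theta> - p < 1" "p' - real q' * \<theta> < 1"
proof -
  show *: "0 < real q * \<theta> - p" "0 < p' - real q' * \<theta>" using assms by (auto simp: farey_pair_def)
  have q: "real q \<ge> 1" "real q' \<ge> 1" and det: "p' * int q - p * int q' = 1"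
    using assms by (auto simp: farey_pair_def)
  have "real_of_int p' * q - p * q' = 1" using arg_cong[OF det, of real_of_int] by simp
  then show e: "(real q * \<theta> - p) * q' + (p' - real q' * \<theta>) * q = 1" by (simp add: algebra_simps)
  have "real q * \<theta> - p \<le> (real q * \<theta> - p) * q'" "p' - real q' * \<theta> \<le> (p' - real q' * \<theta>) * q"
    "0 < (real q * \<theta> - p) * q'" "0 < (p' - real q' * \<theta>) * q"
    using * q by (auto intro: mult_le_cancel_left1[THEN iffD2] mult_pos_pos)
  then show "real q * \<theta> - p < 1" "p' - real q' * \<theta> < 1" using e by linarith+
qed

text \<open>Before time \<open>q'\<close> the next integer above \<open>i * \<theta>\<close>, and
  before time \<open>q\<close> the one below, is at distance at least
  \<open>\<delta> + \<delta>'\<close>. A perturbation by \<open>\<delta>\<close> or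
  \<open>\<delta>'\<close> in that direction therefore crosses no integer; the reflections are such
  perturbations, as \<open>q * \<theta>\<close> and \<open>q' * \<theta>\<close> miss
  \<open>p\<close> and \<open>p'\<close> by these amounts.\<close>

lemma farey_pair_floor:
  assumes fp: "farey_pair \<theta> p q p' q'" and i: "0 < i"
  shows "i < q' \<Longrightarrow> 0 \<le> s \<Longrightarrow> s \<le> real q * \<theta> - p \<Longrightarrow> \<lfloor>real i * \<theta> + s\<rfloor> = \<lfloor>real i * \<theta>\<rfloor>"
    and "i < q \<Longrightarrow> 0 \<le> s \<Longrightarrow> s \<le> p' - real q' * \<theta> \<Longrightarrow> \<lfloor>real i * \<theta> - s\<rfloor> = \<lfloor>real i * \<theta>\<rfloor>"
    and "i < q \<Longrightarrow> \<lfloor>real (q - i) * \<theta>\<rfloor> = p - 1 - \<lfloor>real i * \<theta>\<rfloor>"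
    and "i < q' \<Longrightarrow> \<lfloor>real (q' - i) * \<theta>\<rfloor> = p' - 1 - \<lfloor>real i * \<theta>\<rfloor>"
proof -
  note pos = farey_pair_pos[OF fp]
  note lower = farey_pair_approximation[OF fp i, of "\<lfloor>real i * \<theta>\<rfloor>"]
  note upper = farey_pair_approximation[OF fp i, of "\<lfloor>real i * \<theta>\<rfloor> + 1", unfolded of_int_add of_int_1]
  have fl: "of_int \<lfloor>real i * \<theta>\<rfloor> \<le> real i * \<theta>" "real i * \<theta> < of_int \<lfloor>real i * \<theta>\<rfloor> + 1" by linarith+
  show "\<lfloor>real i * \<theta> + s\<rfloor> = \<lfloor>real i * \<theta>\<rfloor>" if "i < q'" "0 \<le> s" "s \<le> real q * \<theta> - p"
  proof -
    have "of_int \<lfloor>real i * \<theta>\<rfloor> \<le> real i * \<theta> + s" "real i * \<theta> + s < of_int \<lfloor>real i * \<theta>\<rfloor> + 1"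
      using upper fl pos(1,2) that by (elim disjE conjE; linarith)+
    then show ?thesis by (simp add: floor_eq_iff)
  qed
  show "\<lfloor>real i * \<theta> - s\<rfloor> = \<lfloor>real i * \<theta>\<rfloor>" if "i < q" "0 \<le> s" "s \<le> p' - real q' * \<theta>"
  proof -
    have "of_int \<lfloor>real i * \<theta>\<rfloor> \<le> real i * \<theta> - s" "real i * \<theta> - s < of_int \<lfloor>real i * \<theta>\<rfloor> + 1"
      using lower fl pos(1,2) that by (elim disjE conjE; linarith)+
    then show ?thesis by (simp add: floor_eq_iff)
  qed
  show "\<lfloor>real (q - i) * \<theta>\<rfloor> = p - 1 - \<lfloor>real i * \<theta>\<rfloor>" if "i < q"
  proof -
    have "real (q - i) * \<theta> = real q * \<theta> - real i * \<theta>" using that by (simp add: of_nat_diff algebra_simps)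
    moreover have "of_int (p - 1 - \<lfloor>real i * \<theta>\<rfloor>) \<le> real q * \<theta> - real i * \<theta>"
      "real q * \<theta> - real i * \<theta> < of_int (p - 1 - \<lfloor>real i * \<theta>\<rfloor>) + 1"
      using lower fl pos(1,2) that unfolding of_int_diff of_int_1 by (elim disjE conjE; linarith)+
    ultimately show ?thesis by (simp only: floor_eq_iff)
  qed
  show "\<lfloor>real (q' - i) * \<theta>\<rfloor> = p' - 1 - \<lfloor>real i * \<theta>\<rfloor>" if "i < q'"
  proof -
    have "real (q' - i) * \<theta> = real q' * \<theta> - real i * \<theta>" using that by (simp add: of_nat_diff algebra_simps)
    moreover have "of_int (p' - 1 - \<lfloor>real i * \<theta>\<rfloor>) \<le> real q' * \<theta> - real i * \<theta>"
      "real q' * \<theta> - real i * \<theta> < of_int (p' - 1 - \<lfloor>real i * \<theta>\<rfloor>) + 1"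
      using upper fl pos(1,2) that unfolding of_int_diff of_int_1 by (elim disjE conjE; linarith)+
    ultimately show ?thesis by (simp only: floor_eq_iff)
  qed
qed

section \<open>Rotation sums under shifts and reflections\<close>

lemma rot_sum_0 [simp]: "rot_sum \<theta> 0 = 0"
  by (simp add: rot_sum_def)

lemma rot_sum_Suc: "rot_sum \<theta> (Suc N) = rot_sum \<theta> N + rot_sign \<theta> (Suc N)"
  by (simp add: rot_sum_def)

lemma rot_sum_add: "rot_sum \<theta> (M + N) = rot_sum \<theta> M + (\<Sum>i=1..N. rot_sign \<theta> (M + i))"
  by (induction N) (auto simp: rot_sum_Suc)

lemma rot_sum_add_eq:
  assumes "\<And>i. 0 < i \<Longrightarrow> i \<le> N \<Longrightarrow> rot_sign \<theta> (M + i) = \<sigma> * rot_sign \<theta> i"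
  shows "rot_sum \<theta> (M + N) = rot_sum \<theta> M + \<sigma> * rot_sum \<theta> N"
  unfolding rot_sum_add
  by (simp add: rot_sum_def sum_distrib_left assms)

lemma rot_sum_pred: "0 < q \<Longrightarrow> rot_sum \<theta> q = rot_sum \<theta> (q - 1) + rot_sign \<theta> q"
  using rot_sum_Suc[of \<theta> "q - 1"] by simp

text \<open>The signs at \<open>N + 1\<close>, ..., \<open>q - 1\<close>, read backwards, are
  \<open>\<sigma>\<close> times the first \<open>q - 1 - N\<close> signs.\<close>

lemma rot_sum_reflect:
  assumes "\<And>i. 0 < i \<Longrightarrow> i < q \<Longrightarrow> rot_sign \<theta> (q - i) = \<sigma> * rot_sign \<theta> i" and "N < q"
  shows "rot_sum \<theta> (q - 1) - rot_sum \<theta> N = \<sigma> * rot_sum \<theta> (q - 1 - N)"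
proof -
  have "rot_sum \<theta> (N + (q - 1 - N)) = rot_sum \<theta> N + (\<Sum>i=1..q - 1 - N. rot_sign \<theta> (N + i))"
    by (rule rot_sum_add)
  also have "(\<Sum>i=1..q - 1 - N. rot_sign \<theta> (N + i)) = (\<Sum>i=1..q - 1 - N. rot_sign \<theta> (q - i))"
    by (rule sum.reindex_bij_witness[of _ "\<lambda>i. q - N - i" "\<lambda>i. q - N - i"])
       (use assms(2) in \<open>auto simp: algebra_simps\<close>)
  also have "\<dots> = \<sigma> * rot_sum \<theta> (q - 1 - N)"
    unfolding rot_sum_def sum_distrib_left using assms by (intro sum.cong) auto
  finally show ?thesis using assms(2) by simp
qed

lemma rot_sign_reflect:
  assumes "farey_pair \<theta> p q p' q'" and "0 < i"
  shows "i < q \<Longrightarrow> rot_sign \<theta> (q - i) = (if odd p then 1 else - 1) * rot_sign \<theta> i"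
    and "i < q' \<Longrightarrow> rot_sign \<theta> (q' - i) = (if odd p' then 1 else - 1) * rot_sign \<theta> i"
  using farey_pair_floor(3,4)[OF assms] by (auto simp: rot_sign_def)

text \<open>A return close to the integer \<open>r\<close> at time \<open>P\<close> adds
  \<open>r\<close> to all floors and changes nothing else, so signs repeat or flip with the parity
  of \<open>r\<close>. How long this lasts depends on the side from which the return occurs.\<close>

lemma rot_sign_shift:
  assumes "farey_pair \<theta> p q p' q'" and "0 < i"
    and "real P * \<theta> - of_int r = s"
  shows "0 \<le> s \<Longrightarrow> s \<le> real q * \<theta> - p \<Longrightarrow> i < q' \<Longrightarrow> rot_sign \<theta> (P + i) = (if odd r then - 1 else 1) * rot_sign \<theta> i"
    and "s \<le> 0 \<Longrightarrow> - s \<le> p' - real q' * \<theta> \<Longrightarrow> i < q \<Longrightarrow> rot_sign \<theta> (P + i) = (if odd r then - 1 else 1) * rot_sign \<theta> i"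
proof -
  have *: "\<lfloor>real (P + i) * \<theta>\<rfloor> = r + \<lfloor>real i * \<theta> + s\<rfloor>"
  proof -
    have "real (P + i) * \<theta> = of_int r + (real i * \<theta> + s)" using assms(3) by (simp add: algebra_simps)
    then show ?thesis by (simp only: int_add_floor)
  qed
  show "rot_sign \<theta> (P + i) = (if odd r then - 1 else 1) * rot_sign \<theta> i"
    if "0 \<le> s" "s \<le> real q * \<theta> - p" "i < q'"
    using farey_pair_floor(1)[OF assms(1,2) that(3,1,2)] * by (auto simp: rot_sign_def)
  show "rot_sign \<theta> (P + i) = (if odd r then - 1 else 1) * rot_sign \<theta> i"
    if "s \<le> 0" "- s \<le> p' - real q' * \<theta>" "i < q"
    using farey_pair_floor(2)[OF assms(1,2) that(3), of "- s"] that * by (auto simp: rot_sign_def)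
qed

lemma rot_sign_endpoint:
  assumes "farey_pair \<theta> p q p' q'"
  shows "rot_sign \<theta> q = (if odd p then - 1 else 1)" "rot_sign \<theta> q' = (if odd p' then 1 else - 1)"
proof -
  note pos = farey_pair_pos[OF assms]
  have "\<lfloor>real q * \<theta>\<rfloor> = p" "\<lfloor>real q' * \<theta>\<rfloor> = p' - 1"
    using pos by (auto simp: floor_eq_iff)
  then show "rot_sign \<theta> q = (if odd p then - 1 else 1)" "rot_sign \<theta> q' = (if odd p' then 1 else - 1)"
    by (auto simp: rot_sign_def)
qed

definition odd_pair :: "real \<Rightarrow> int \<Rightarrow> nat \<Rightarrow> int \<Rightarrow> nat \<Rightarrow> bool" where
  "odd_pair \<theta> p q p' q' \<longleftrightarrow> farey_pair \<theta> p q p' q' \<and> odd p \<and> odd p'"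

lemma odd_pair_rot_sum_reflect:
  assumes "odd_pair \<theta> p q p' q'"
  shows "N < q \<Longrightarrow> rot_sum \<theta> (q - 1 - N) = rot_sum \<theta> (q - 1) - rot_sum \<theta> N"
    and "N < q' \<Longrightarrow> rot_sum \<theta> (q' - 1 - N) = rot_sum \<theta> (q' - 1) - rot_sum \<theta> N"
  using rot_sum_reflect[of q \<theta> 1 N] rot_sum_reflect[of q' \<theta> 1 N] rot_sign_reflect[of \<theta> p q p' q'] assms
  by (auto simp: odd_pair_def)

lemma farey_pair_mediant:
  assumes "farey_pair \<theta> p q p' q'"
  shows "real (q + q') * \<theta> < of_int (p + p') \<Longrightarrow> farey_pair \<theta> p q (p + p') (q + q')"
    and "of_int (p + p') < real (q + q') * \<theta> \<Longrightarrow> farey_pair \<theta> (p + p') (q + q') p' q'"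
  using assms by (auto simp: farey_pair_def algebra_simps)

text \<open>With an even numerator the reflection is antisymmetric, so the signs before time
  \<open>q'\<close> cancel. Applied to the even mediant, this relates the midpoints of the two odd
  neighbours and gives the drift \<open>- 1\<close> along the ray.\<close>

lemma rot_sum_even_left:
  assumes "farey_pair \<theta> p q p' q'" "even p'"
  shows "rot_sum \<theta> (q' - 1) = 0" "rot_sum \<theta> q' = - 1"
proof -
  have q: "0 < q'" using assms by (simp add: farey_pair_def)
  show *: "rot_sum \<theta> (q' - 1) = 0"
    using rot_sum_reflect[of q' \<theta> "-1" 0] rot_sign_reflect(2)[OF assms(1)] assms(2) q by auto
  show "rot_sum \<theta> q' = - 1"
    using rot_sum_pred[OF q, of \<theta>] * rot_sign_endpoint(2)[OF assms(1)] assms(2) by simp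
qed

section \<open>Exponential sums and the odd continued fraction step\<close>

definition rot_cis :: "real \<Rightarrow> nat \<Rightarrow> real \<Rightarrow> complex" where
  "rot_cis \<theta> q z = (\<Sum>N<q. cis (z * rot_sum \<theta> N))"

definition rot_cos :: "real \<Rightarrow> nat \<Rightarrow> real \<Rightarrow> real" where
  "rot_cos \<theta> q z = (\<Sum>N<q. cos (z * (rot_sum \<theta> N - rot_sum \<theta> (q - 1) / 2)))"

text \<open>The Dirichlet kernel \<open>sin (j * z / 2) / sin (z / 2)\<close>, kept as a cosine sum:
  this form makes sense at \<open>z = 0\<close>, and the Taylor estimate for means of cosines
  applies to it directly.\<close>

definition cos_kernel :: "nat \<Rightarrow> real \<Rightarrow> real" where
  "cos_kernel j z = (\<Sum>l<j. cos (z * ((real j - 1) / 2 - real l)))"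

text \<open>Reversing the index cancels the sines.\<close>

lemma sum_cis_symmetric:
  fixes q :: nat
  assumes "\<And>N. N < q \<Longrightarrow> a (q - 1 - N) = - (a N :: real)"
  shows "(\<Sum>N<q. cis (z * a N)) = of_real (\<Sum>N<q. cos (z * a N))"
proof -
  have "(\<Sum>N<q. sin (z * a N)) = (\<Sum>N<q. sin (z * a (q - Suc N)))"
    by (rule sum.nat_diff_reindex[symmetric])
  also have "\<dots> = - (\<Sum>N<q. sin (z * a N))"
    unfolding sum_negf[symmetric] using assms by (intro sum.cong) auto
  finally show ?thesis by (simp add: complex_eq_iff)
qed

lemma rot_cis_eq_rot_cos:
  assumes "odd_pair \<theta> p q p' q'"
  shows "rot_cis \<theta> q z = cis (z * rot_sum \<theta> (q - 1) / 2) * of_real (rot_cos \<theta> q z)"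
    and "rot_cis \<theta> q' z = cis (z * rot_sum \<theta> (q' - 1) / 2) * of_real (rot_cos \<theta> q' z)"
proof -
  have *: "rot_cis \<theta> r z = cis (z * rot_sum \<theta> (r - 1) / 2) * of_real (rot_cos \<theta> r z)"
    if "\<And>N. N < r \<Longrightarrow> rot_sum \<theta> (r - 1 - N) = rot_sum \<theta> (r - 1) - rot_sum \<theta> N" for r
  proof -
    have "(\<Sum>N<r. cis (z * (rot_sum \<theta> N - rot_sum \<theta> (r - 1) / 2))) = of_real (rot_cos \<theta> r z)"
      unfolding rot_cos_def by (rule sum_cis_symmetric, subst that) simp_all
    moreover have "rot_cis \<theta> r z = cis (z * rot_sum \<theta> (r - 1) / 2) *
        (\<Sum>N<r. cis (z * (rot_sum \<theta> N - rot_sum \<theta> (r - 1) / 2)))"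
      unfolding rot_cis_def sum_distrib_left cis_mult by (simp add: algebra_simps)
    ultimately show ?thesis by simp
  qed
  show "rot_cis \<theta> q z = cis (z * rot_sum \<theta> (q - 1) / 2) * of_real (rot_cos \<theta> q z)"
    and "rot_cis \<theta> q' z = cis (z * rot_sum \<theta> (q' - 1) / 2) * of_real (rot_cos \<theta> q' z)"
    using odd_pair_rot_sum_reflect[OF assms] by (blast intro: *)+
qed

lemma rot_cis_add:
  assumes "\<And>i. 0 < i \<Longrightarrow> i < q' \<Longrightarrow> rot_sign \<theta> (q + i) = \<sigma> * rot_sign \<theta> i"
  shows "rot_cis \<theta> (q + q') z = rot_cis \<theta> q z + cis (z * rot_sum \<theta> q) * rot_cis \<theta> q' (\<sigma> * z)"
proof -
  have "rot_sum \<theta> (q + N) = rot_sum \<theta> q + \<sigma> * rot_sum \<theta> N" if "N < q'" for N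
    using that by (intro rot_sum_add_eq assms) auto
  then have "(\<Sum>N<q'. cis (z * rot_sum \<theta> (q + N))) = cis (z * rot_sum \<theta> q) * rot_cis \<theta> q' (\<sigma> * z)"
    unfolding rot_cis_def sum_distrib_left by (intro sum.cong) (auto simp: cis_mult algebra_simps)
  moreover have "rot_cis \<theta> (q + q') z = rot_cis \<theta> q z + (\<Sum>N<q'. cis (z * rot_sum \<theta> (q + N)))"
    unfolding rot_cis_def
    using sum.atLeastLessThan_concat[of 0 q "q + q'" "\<lambda>N. cis (z * rot_sum \<theta> N)"]
      sum.shift_bounds_nat_ivl[of "\<lambda>N. cis (z * rot_sum \<theta> N)" 0 q q']
    by (simp add: atLeast0LessThan add.commute)
  ultimately show ?thesis by simp
qed

text \<open>The mediant has an even numerator and lies to the right of \<theta>, so the next odd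
  vertices are reached from \<open>p/q\<close> by adding it repeatedly. A mediant to the left of
  \<theta> is reduced to this case by passing to \<open>- \<theta>\<close>.\<close>

locale left_step =
  fixes \<theta> :: real and p p' :: int and q q' :: nat
  assumes odd_pair: "odd_pair \<theta> p q p' q'"
    and left: "real (q + q') * \<theta> < of_int (p + p')"
begin

lemma farey: "farey_pair \<theta> p q p' q'" "odd p" "odd p'"
  using odd_pair by (auto simp: odd_pair_def)

lemma farey_mediant: "farey_pair \<theta> p q (p + p') (q + q')"
  using farey_pair_mediant(1)[OF farey(1) left] .

lemma rot_sum_first: "rot_sum \<theta> q = rot_sum \<theta> (q - 1) - 1"
  using rot_sum_pred[of q \<theta>] rot_sign_endpoint(1)[OF farey(1)] farey by (auto simp: farey_pair_def)

lemma shift_first: "0 < i \<Longrightarrow> i < q' \<Longrightarrow> rot_sign \<theta> (q + i) = - 1 * rot_sign \<theta> i"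
  using rot_sign_shift(1)[OF farey(1), of i q p "real q * \<theta> - p"] farey farey_pair_pos[OF farey(1)] by simp

text \<open>Up to time \<open>q + q'\<close> the orbit is a block of length \<open>q\<close>
  followed by a sign-flipped block of length \<open>q'\<close>; the even mediant makes the sum
  before its end vanish, and the sign \<open>- 1\<close> at time \<open>q\<close> leaves the
  difference \<open>1\<close>.\<close>

lemma rot_sum_mid_diff: "rot_sum \<theta> (q - 1) - rot_sum \<theta> (q' - 1) = 1"
proof -
  have q': "0 < q'" using farey by (simp add: farey_pair_def)
  have "rot_sum \<theta> (q + (q' - 1)) = rot_sum \<theta> q + - 1 * rot_sum \<theta> (q' - 1)"
    by (rule rot_sum_add_eq) (use shift_first in auto)
  moreover have "rot_sum \<theta> (q + (q' - 1)) = 0"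
    using rot_sum_even_left(1)[OF farey_mediant] farey q' by (simp add: add_diff_assoc)
  ultimately show ?thesis by (simp add: rot_sum_first)
qed

text \<open>The flipped second block starts at height
  \<open>rot_sum \<theta> q = rot_sum \<theta> (q' - 1)\<close>, so by reflection it runs through
  the first \<open>q'\<close> sums in reverse order, and no phase remains.\<close>

lemma rot_cis_mediant: "rot_cis \<theta> (q + q') z = rot_cis \<theta> q z + rot_cis \<theta> q' z"
proof -
  have "rot_cis \<theta> q' (- z) = cnj (rot_cis \<theta> q' z)"
    by (simp add: rot_cis_def cis_cnj)
  also have "\<dots> = cis (- z * rot_sum \<theta> (q' - 1)) * rot_cis \<theta> q' z"
    unfolding rot_cis_eq_rot_cos(2)[OF odd_pair] mult.assoc[symmetric] cis_mult
    by (simp add: cis_cnj)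
  finally have flip: "rot_cis \<theta> q' (- z) = cis (- z * rot_sum \<theta> (q' - 1)) * rot_cis \<theta> q' z" .
  have "cis (z * rot_sum \<theta> q) * rot_cis \<theta> q' (- 1 * z) = rot_cis \<theta> q' z"
  proof -
    have "rot_sum \<theta> q = rot_sum \<theta> (q' - 1)" using rot_sum_mid_diff rot_sum_first by simp
    then show ?thesis
      using flip by (simp add: mult.assoc[symmetric] cis_mult)
  qed
  moreover have "rot_cis \<theta> (q + q') z = rot_cis \<theta> q z + cis (z * rot_sum \<theta> q) * rot_cis \<theta> q' (- 1 * z)"
    by (rule rot_cis_add[OF shift_first])
  ultimately show ?thesis by simp
qed

text \<open>The vectors on the ray from the odd vertex towards the even mediant.\<close>

definition num :: "nat \<Rightarrow> int" where "num j = p + int j * (p + p')"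
definition den :: "nat \<Rightarrow> nat" where "den j = q + j * (q + q')"

lemma farey_ray:
  assumes "num j < real (den j) * \<theta>"
  shows "farey_pair \<theta> (num j) (den j) (p + p') (q + q')"
proof -
  have "(p + p') * int (den j) - num j * int (q + q') = p' * int q - p * int q'"
    by (simp add: num_def den_def algebra_simps)
  then show ?thesis
    using assms left farey(1) by (simp add: farey_pair_def den_def)
qed

lemma odd_num: "odd (num j)"
  using farey by (auto simp: num_def)

text \<open>The new block is put in front. Its numerator \<open>p + p'\<close> is even, so it keeps
  the signs of what follows, and \<open>rot_sum \<theta> (q + q') = - 1\<close> lowers all later
  sums by one.\<close>

lemma ray_step:
  assumes "num j < real (den j) * \<theta>"
  shows "rot_sum \<theta> (den (Suc j) - 1) = rot_sum \<theta> (den j - 1) - 1"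
    and "rot_cis \<theta> (den (Suc j)) z = rot_cis \<theta> (q + q') z + cis (- z) * rot_cis \<theta> (den j) z"
proof -
  note fr = farey_ray[OF assms]
  have pos: "0 < den j" using fr by (simp add: farey_pair_def)
  have shift: "rot_sign \<theta> (q + q' + i) = 1 * rot_sign \<theta> i" if "0 < i" "i < den j" for i
    using rot_sign_shift(2)[OF fr that(1), of "q + q'" "p + p'"
        "real (q + q') * \<theta> - of_int (p + p')"] farey_pair_pos[OF fr] farey that by simp
  have full: "rot_sum \<theta> (q + q') = - 1"
    using rot_sum_even_left(2)[OF farey_mediant] farey by simp
  have den: "den (Suc j) = q + q' + den j" by (simp add: den_def)
  show "rot_cis \<theta> (den (Suc j)) z = rot_cis \<theta> (q + q') z + cis (- z) * rot_cis \<theta> (den j) z"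
    using rot_cis_add[OF shift, of "den j" z] by (simp add: den full)
  have "rot_sum \<theta> (q + q' + (den j - 1)) = rot_sum \<theta> (q + q') + 1 * rot_sum \<theta> (den j - 1)"
    by (rule rot_sum_add_eq, rule shift) (use pos in auto)
  moreover have "q + q' + (den j - 1) = den (Suc j) - 1" using pos den by simp
  ultimately show "rot_sum \<theta> (den (Suc j) - 1) = rot_sum \<theta> (den j - 1) - 1"
    using full by simp
qed

text \<open>Iterating the step produces geometric sums in \<open>cis (- z)\<close>. Each step needs
  only its starting vertex to the left of \<theta>; this is why \<open>j = Suc m\<close> is
  included, and with it the first vertex beyond \<theta>.\<close>

lemma ray:
  assumes "num m < real (den m) * \<theta>" "j \<le> Suc m"
  shows "rot_sum \<theta> (den j - 1) = rot_sum \<theta> (q - 1) - j \<and>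
    rot_cis \<theta> (den j) z = rot_cis \<theta> q z * (\<Sum>l<Suc j. cis (- real l * z)) + rot_cis \<theta> q' z * (\<Sum>l<j. cis (- real l * z))"
  using assms(2)
proof (induction j)
  case 0
  then show ?case by (simp add: den_def)
next
  case (Suc j)
  \<comment> \<open>The defect \<open>real (den j) * \<theta> - num j\<close> is linear and
    decreasing in \<open>j\<close>, so it is positive before \<open>m\<close> as well.\<close>
  have "0 < (of_int (p + p') - real (q + q') * \<theta>) * (real m - real j) + (real (den m) * \<theta> - num m)"
    using assms(1) Suc.prems left by (intro add_nonneg_pos mult_nonneg_nonneg) auto
  also have "\<dots> = real (den j) * \<theta> - num j"
    by (simp add: num_def den_def algebra_simps)
  finally have "num j < real (den j) * \<theta>" by simp
  note step = ray_step[OF this]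
  have s: "(\<Sum>l<Suc k. cis (- real l * z)) = 1 + cis (- z) * (\<Sum>l<k. cis (- real l * z))" for k
    unfolding sum.lessThan_Suc_shift sum_distrib_left by (simp add: cis_mult algebra_simps)
  have IH: "rot_sum \<theta> (den j - 1) = rot_sum \<theta> (q - 1) - j"
    "rot_cis \<theta> (den j) z = rot_cis \<theta> q z * (\<Sum>l<Suc j. cis (- real l * z)) + rot_cis \<theta> q' z * (\<Sum>l<j. cis (- real l * z))"
    using Suc by auto
  have "rot_cis \<theta> (den (Suc j)) z =
      rot_cis \<theta> q z * (1 + cis (- z) * (\<Sum>l<Suc j. cis (- real l * z))) +
      rot_cis \<theta> q' z * (1 + cis (- z) * (\<Sum>l<j. cis (- real l * z)))"
    unfolding step(2) IH(2) rot_cis_mediant by (simp only: algebra_simps mult_1)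
  then show ?case using step(1) IH(1) by (simp only: s[symmetric]) simp
qed

lemma cis_cos_kernel: "cis (z * (real j - 1) / 2) * (\<Sum>l<j. cis (- real l * z)) = of_real (cos_kernel j z)"
proof -
  have "(\<Sum>l<j. cis (z * ((real j - 1) / 2 - real l))) = of_real (cos_kernel j z)"
    unfolding cos_kernel_def
  proof (rule sum_cis_symmetric[where a = "\<lambda>N. (real j - 1) / 2 - real N"])
    fix N assume "N < j"
    then have "real (j - 1 - N) = real j - 1 - real N" by linarith
    moreover have "r = x - 1 - n \<Longrightarrow> (x - 1) / 2 - r = - ((x - 1) / 2 - n)" for r x n :: real
      by (simp add: field_simps)
    ultimately show "(real j - 1) / 2 - real (j - 1 - N) = - ((real j - 1) / 2 - real N)"
      by blast
  qed
  moreover have "cis (z * (real j - 1) / 2) * (\<Sum>l<j. cis (- real l * z)) = (\<Sum>l<j. cis (z * ((real j - 1) / 2 - real l)))"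
    unfolding sum_distrib_left cis_mult
    by (intro sum.cong arg_cong[where f = cis] refl) (simp add: algebra_simps add_divide_distrib)
  ultimately show ?thesis by simp
qed

text \<open>The number of mediants that fit before \<theta> is crossed: each lowers the defect
  \<open>q * \<theta> - p\<close> by the defect of the mediant.\<close>

definition ray_index :: nat where
  "ray_index = nat \<lfloor>(real q * \<theta> - p) / (of_int (p + p') - real (q + q') * \<theta>)\<rfloor>"

lemma ray_index:
  assumes "badly_approximable c \<theta>"
  shows "odd_pair \<theta> (num ray_index) (den ray_index) (num (Suc ray_index)) (den (Suc ray_index))"
    and "real ray_index \<le> 1 / c"
proof -
  define \<delta> where "\<delta> = real q * \<theta> - p"
  define \<epsilon> where "\<epsilon> = of_int (p + p') - real (q + q') * \<theta>"
  have pos: "0 < \<delta>" "0 < \<epsilon>" "\<delta> * (q + q') + \<epsilon> * q = 1"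
    using farey_pair_pos[OF farey_mediant] by (auto simp: \<delta>_def \<epsilon>_def)
  have c: "0 < c" "c / real (q + q') \<le> \<epsilon>"
    using assms farey_pair_pos(2)[OF farey_mediant] farey(1) unfolding badly_approximable_def \<epsilon>_def farey_pair_def
    by (auto dest!: spec[of _ "q + q'"] spec[of _ "p + p'"])
  have m: "real ray_index \<le> \<delta> / \<epsilon>" "\<delta> / \<epsilon> < real ray_index + 1"
    using pos unfolding ray_index_def \<delta>_def[symmetric] \<epsilon>_def[symmetric] by auto
  have qq: "0 < real (q + q')" using farey(1) by (simp add: farey_pair_def)
  have ray: "real (den j) * \<theta> - num j = \<delta> - j * \<epsilon>" for j
    by (simp add: den_def num_def \<delta>_def \<epsilon>_def algebra_simps)
  have "real ray_index * \<epsilon> \<le> \<delta>" "\<delta> < (real ray_index + 1) * \<epsilon>"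
    using m pos by (auto simp: field_simps)
  then have "0 \<le> real (den ray_index) * \<theta> - num ray_index"
    and 2: "real (den (Suc ray_index)) * \<theta> - num (Suc ray_index) < 0"
    unfolding ray by (auto simp: algebra_simps)
  moreover have dp: "0 < den j" for j using farey(1) by (simp add: den_def farey_pair_def)
  ultimately have 1: "num ray_index < real (den ray_index) * \<theta>"
    using badly_approximable_neq[OF assms dp, of ray_index "num ray_index"] by linarith
  have "num (Suc j) * int (den j) - num j * int (den (Suc j)) = p' * int q - p * int q'" for j
    by (simp add: num_def den_def algebra_simps)
  then show "odd_pair \<theta> (num ray_index) (den ray_index) (num (Suc ray_index)) (den (Suc ray_index))"
    using 1 2 dp odd_num farey(1) by (auto simp: odd_pair_def farey_pair_def)
  have "0 \<le> \<epsilon> * q" using pos by simp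
  then have "\<delta> * (q + q') \<le> 1" using pos(3) by linarith
  \<comment> \<open>Bounded type limits the length of a step: the defect of the mediant is at least
    \<open>c / (q + q')\<close>, while \<open>\<delta> * (q + q')\<close> is at most 1.\<close>
  have "real ray_index * c \<le> real ray_index * (\<epsilon> * (q + q'))"
    using c qq by (intro mult_left_mono) (auto simp: field_simps)
  also have "\<dots> \<le> \<delta> * (q + q')"
    using \<open>real ray_index * \<epsilon> \<le> \<delta>\<close> qq by (simp only: mult.assoc[symmetric]) (intro mult_right_mono, auto)
  also have "\<dots> \<le> 1" by fact
  finally show "real ray_index \<le> 1 / c" using c by (simp add: field_simps)
qed

text \<open>The midpoint at \<open>den j\<close> is lower by \<open>j / 2\<close> than that of
  \<open>q\<close> and by \<open>(j - 1) / 2\<close> than that of \<open>q'\<close>. These are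
  exactly the phases that turn the two geometric sums into Dirichlet kernels, so the recursion is
  real after centring.\<close>

lemma rot_cos_ray:
  assumes "badly_approximable c \<theta>" "j = ray_index \<or> j = Suc ray_index"
  shows "rot_cos \<theta> (den j) z = rot_cos \<theta> q z * cos_kernel (Suc j) z + rot_cos \<theta> q' z * cos_kernel j z"
    and "rot_sum \<theta> (den j - 1) = rot_sum \<theta> (q - 1) - j"
proof -
  note op = ray_index(1)[OF assms(1)]
  have "num ray_index < real (den ray_index) * \<theta>" using op by (simp add: odd_pair_def farey_pair_def)
  from ray[OF this, of j] assms(2)
  have u: "rot_sum \<theta> (den j - 1) = rot_sum \<theta> (q - 1) - j"
    and cis: "rot_cis \<theta> (den j) z = rot_cis \<theta> q z * (\<Sum>l<Suc j. cis (- real l * z)) + rot_cis \<theta> q' z * (\<Sum>l<j. cis (- real l * z))"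
    by auto
  show "rot_sum \<theta> (den j - 1) = rot_sum \<theta> (q - 1) - j" by fact
  have u': "rot_sum \<theta> (q' - 1) = rot_sum \<theta> (q - 1) - 1" using rot_sum_mid_diff by simp
  define w where "w = rot_sum \<theta> (q - 1)"
  have "rot_cis \<theta> (den j) z = cis (z * (w - j) / 2) * of_real (rot_cos \<theta> (den j) z)"
    using rot_cis_eq_rot_cos[OF op, of z] assms(2) unfolding w_def u[symmetric] by auto
  then have "of_real (rot_cos \<theta> (den j) z) = cis (- (z * (w - j) / 2)) * rot_cis \<theta> (den j) z"
    by (simp add: mult.assoc[symmetric] cis_mult)
  also have "\<dots> = cis (- (z * (w - j) / 2)) * cis (z * w / 2) * of_real (rot_cos \<theta> q z) * (\<Sum>l<Suc j. cis (- real l * z))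
     + cis (- (z * (w - j) / 2)) * cis (z * (w - 1) / 2) * of_real (rot_cos \<theta> q' z) * (\<Sum>l<j. cis (- real l * z))"
    unfolding cis rot_cis_eq_rot_cos(1)[OF odd_pair] rot_cis_eq_rot_cos(2)[OF odd_pair] u' w_def[symmetric]
    by (simp only: distrib_left mult.assoc)
  also have "cis (- (z * (w - j) / 2)) * cis (z * w / 2) = cis (z * (real (Suc j) - 1) / 2)"
    unfolding cis_mult by (rule arg_cong[where f = cis]) (simp add: field_simps)
  also have "cis (- (z * (w - j) / 2)) * cis (z * (w - 1) / 2) = cis (z * (real j - 1) / 2)"
    unfolding cis_mult by (rule arg_cong[where f = cis]) (simp add: field_simps)
  also have "cis (z * (real (Suc j) - 1) / 2) * of_real (rot_cos \<theta> q z) * (\<Sum>l<Suc j. cis (- real l * z))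
      = of_real (rot_cos \<theta> q z * cos_kernel (Suc j) z)"
    unfolding of_real_mult cis_cos_kernel[symmetric] by (simp only: mult_ac)
  also have "cis (z * (real j - 1) / 2) * of_real (rot_cos \<theta> q' z) * (\<Sum>l<j. cis (- real l * z))
      = of_real (rot_cos \<theta> q' z * cos_kernel j z)"
    unfolding of_real_mult cis_cos_kernel[symmetric] by (simp only: mult_ac)
  finally show "rot_cos \<theta> (den j) z = rot_cos \<theta> q z * cos_kernel (Suc j) z + rot_cos \<theta> q' z * cos_kernel j z"
    unfolding of_real_add[symmetric] of_real_eq_iff .
qed

end

section \<open>The symmetry between \<theta> and its negative\<close>

lemma rot_sign_uminus:
  assumes "badly_approximable c \<theta>" "0 < j"
  shows "rot_sign (- \<theta>) j = - rot_sign \<theta> j"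
proof -
  have "real j * \<theta> \<noteq> of_int \<lfloor>real j * \<theta>\<rfloor>" by (rule badly_approximable_neq[OF assms])
  then have "of_int \<lfloor>real j * \<theta>\<rfloor> < real j * \<theta>" "real j * \<theta> < of_int \<lfloor>real j * \<theta>\<rfloor> + 1" by linarith+
  then have "\<lfloor>real j * - \<theta>\<rfloor> = - \<lfloor>real j * \<theta>\<rfloor> - 1" by linarith
  then show ?thesis by (simp add: rot_sign_def)
qed

lemma rot_sum_uminus:
  assumes "badly_approximable c \<theta>"
  shows "rot_sum (- \<theta>) N = - rot_sum \<theta> N"
  unfolding rot_sum_def sum_negf[symmetric]
  by (rule sum.cong) (use rot_sign_uminus[OF assms] in auto)

lemma rot_cos_uminus:
  assumes "badly_approximable c \<theta>"
  shows "rot_cos (- \<theta>) q z = rot_cos \<theta> q z"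
proof -
  have "cos (z * (- a - - b / 2)) = cos (z * (a - b / 2))" for a b
    by (subst cos_minus[symmetric]) (simp add: algebra_simps)
  then show ?thesis unfolding rot_cos_def rot_sum_uminus[OF assms] by simp
qed

lemma odd_pair_uminus: "odd_pair (- \<theta>) (- p') q' (- p) q \<longleftrightarrow> odd_pair \<theta> p q p' q'"
  by (auto simp: odd_pair_def farey_pair_def)

section \<open>Weighted means of cosine sums\<close>

text \<open>Concavity of \<open>ln\<close> is one side. For the other, put
  \<open>a = b * exp d\<close> and use \<open>ln (1 + x) \<le> x\<close> and
  \<open>exp d - 1 \<le> d + d^2\<close>: the terms linear in \<open>d\<close> cancel.\<close>

lemma ln_weighted_mean:
  fixes a b w :: real
  assumes "0 \<le> w" "w \<le> 1" "0 < a" "0 < b" "\<bar>ln a - ln b\<bar> \<le> 1"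
  shows "\<bar>ln (w * a + (1 - w) * b) - (w * ln a + (1 - w) * ln b)\<bar> \<le> (ln a - ln b)\<^sup>2"
proof -
  have *: "\<bar>ln (w * a + (1 - w) * b) - (w * ln a + (1 - w) * ln b)\<bar> \<le> (ln a - ln b)\<^sup>2"
    if w: "0 \<le> w" "w \<le> 1" and ab: "0 < a" "0 < b" and d: "0 \<le> ln a - ln b" "ln a - ln b \<le> 1" for w a b :: real
  proof -
    define d where "d = ln a - ln b"
    have a: "a = b * exp d" using ab by (simp add: d_def exp_diff)
    have "w * ln a + (1 - w) * ln b \<le> ln (w * a + (1 - w) * b)"
      using concave_onD[OF ln_concave, of w b a] w ab by (simp add: algebra_simps)
    moreover have "ln (w * a + (1 - w) * b) - (w * ln a + (1 - w) * ln b) \<le> d\<^sup>2"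
    proof -
      have "exp d - 1 \<ge> 0" using d by (simp add: d_def)
      then have pos: "0 \<le> w * (exp d - 1)" using w by simp
      have "w * a + (1 - w) * b = b * (1 + w * (exp d - 1))"
        by (simp add: a algebra_simps)
      then have "ln (w * a + (1 - w) * b) = ln b + ln (1 + w * (exp d - 1))"
        using ab pos by (simp add: ln_mult_pos)
      moreover have "ln (1 + w * (exp d - 1)) \<le> w * (exp d - 1)"
        using pos by (intro ln_add_one_self_le_self)
      moreover have "w * (exp d - 1) \<le> w * (d + d\<^sup>2)"
        using exp_bound[of d] d w by (intro mult_left_mono) (auto simp: d_def)
      moreover have "w * d\<^sup>2 \<le> 1 * d\<^sup>2" using w by (intro mult_right_mono) auto
      moreover have "w * ln a + (1 - w) * ln b = ln b + w * d"
        by (simp add: d_def algebra_simps)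
      ultimately show ?thesis by (simp add: algebra_simps)
    qed
    ultimately show ?thesis by (simp add: d_def)
  qed
  show ?thesis
  proof (cases "ln b \<le> ln a")
    case True
    then show ?thesis using *[of w a b] assms by auto
  next
    case False
    then show ?thesis using *[of "1 - w" b a] assms by (auto simp: algebra_simps power2_commute)
  qed
qed

section \<open>Logarithms of means of cosines\<close>

lemma cos_approx: "\<bar>cos x - 1 + x\<^sup>2 / 2\<bar> \<le> x ^ 4 / (24::real)"
proof -
  obtain t where "cos x = (\<Sum>m<4. cos_coeff m * x ^ m) + (cos (t + 1/2 * real 4 * pi) / fact 4) * x ^ 4"
    using Maclaurin_cos_expansion[of x 4] by blast
  then have "cos x - 1 + x\<^sup>2 / 2 = cos (t + 1/2 * real 4 * pi) * (x ^ 4 / 24)"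
    by (simp add: cos_coeff_def lessThan_nat_numeral lessThan_Suc fact_numeral)
  also have "\<bar>\<dots>\<bar> \<le> 1 * (x ^ 4 / 24)"
    unfolding abs_mult by (intro mult_mono) auto
  finally show ?thesis by simp
qed

text \<open>The mean is \<open>1 - \<nu> * z^2\<close> up to \<open>y^2 / 24\<close> with
  \<open>y = A^2 * z^2\<close>, and taking the logarithm costs another \<open>O(y^2)\<close>. The
  estimate serves the Dirichlet kernels as well as the starting pair of the recursion.\<close>

lemma ln_mean_cos:
  fixes a :: "nat \<Rightarrow> real"
  assumes n: "0 < n" and a: "\<And>i. i < n \<Longrightarrow> \<bar>a i\<bar> \<le> A" and z: "\<bar>z\<bar> * A \<le> 1 / 2"
  defines "\<nu> \<equiv> (\<Sum>i<n. (a i)\<^sup>2) / (2 * real n)"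
  shows "0 < (\<Sum>i<n. cos (z * a i))"
    and "\<bar>ln ((\<Sum>i<n. cos (z * a i)) / n) + \<nu> * z\<^sup>2\<bar> \<le> A ^ 4 * z ^ 4"
    and "0 \<le> \<nu>" and "\<nu> \<le> A\<^sup>2 / 2"
proof -
  have A: "0 \<le> A" using a[OF n] by linarith
  show \<nu>0: "0 \<le> \<nu>" by (simp add: \<nu>_def sum_nonneg)
  have a2: "(a i)\<^sup>2 \<le> A\<^sup>2" if "i < n" for i using a[OF that] A by (simp add: abs_le_square_iff[symmetric])
  have "(\<Sum>i<n. (a i)\<^sup>2) \<le> (\<Sum>i<n. A\<^sup>2)" using a2 by (intro sum_mono) auto
  then show \<nu>A: "\<nu> \<le> A\<^sup>2 / 2" using n by (simp add: \<nu>_def field_simps)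
  define y where "y = A\<^sup>2 * z\<^sup>2"
  have y0: "0 \<le> y" by (simp add: y_def)
  have "(\<bar>z\<bar> * A)\<^sup>2 \<le> (1 / 2)\<^sup>2" using z A by (intro power_mono) auto
  then have y: "y \<le> 1 / 4" by (simp add: y_def power_mult_distrib power2_eq_square algebra_simps)
  have y2: "A ^ 4 * z ^ 4 = y\<^sup>2" by (simp add: y_def power_mult_distrib)
  define r where "r = (\<Sum>i<n. cos (z * a i)) / n - 1 + \<nu> * z\<^sup>2"
  have "(\<Sum>i<n. cos (z * a i) - 1 + (z * a i)\<^sup>2 / 2) = (\<Sum>i<n. cos (z * a i)) - n + (\<Sum>i<n. (a i)\<^sup>2) * z\<^sup>2 / 2"
    by (simp add: sum.distrib sum_subtractf power_mult_distrib sum_divide_distrib sum_distrib_left mult.commute)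
  then have r: "r = (\<Sum>i<n. cos (z * a i) - 1 + (z * a i)\<^sup>2 / 2) / n"
    unfolding r_def \<nu>_def using n by (simp add: add_divide_distrib diff_divide_distrib)
  have "\<bar>cos (z * a i) - 1 + (z * a i)\<^sup>2 / 2\<bar> \<le> y\<^sup>2 / 24" if "i < n" for i
  proof -
    have "(a i)\<^sup>2 * z\<^sup>2 \<le> y" unfolding y_def using a2[OF that] by (intro mult_right_mono) auto
    then have "((a i)\<^sup>2 * z\<^sup>2)\<^sup>2 \<le> y\<^sup>2" by (intro power_mono) auto
    then have "(z * a i) ^ 4 \<le> y\<^sup>2" by (simp add: power_mult_distrib mult.commute)
    then show ?thesis using cos_approx[of "z * a i"] by linarith
  qed
  then have "\<bar>\<Sum>i<n. cos (z * a i) - 1 + (z * a i)\<^sup>2 / 2\<bar> \<le> (\<Sum>i<n. y\<^sup>2 / 24)"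
    by (intro order_trans[OF sum_abs] sum_mono) auto
  then have rb: "\<bar>r\<bar> \<le> y\<^sup>2 / 24" unfolding r using n by (simp add: field_simps)
  have "\<nu> * z\<^sup>2 \<le> A\<^sup>2 / 2 * z\<^sup>2" using \<nu>A by (intro mult_right_mono) auto
  then have \<nu>y: "\<nu> * z\<^sup>2 \<le> y / 2" by (simp add: y_def)
  have \<nu>z0: "0 \<le> \<nu> * z\<^sup>2" using \<nu>0 by simp
  have yy: "y\<^sup>2 \<le> y / 4" using mult_left_mono[OF y y0] by (simp add: power2_eq_square)
  define x where "x = r - \<nu> * z\<^sup>2"
  \<comment> \<open>As \<open>y \<le> 1 / 4\<close>, the exact bound is
    \<open>y / 2 + y / 96\<close>, rounded up here.\<close>
  have xb: "\<bar>x\<bar> \<le> 52 / 100 * y" unfolding x_def using rb \<nu>y \<nu>z0 yy y0 by linarith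
  then have xh: "\<bar>x\<bar> \<le> 1 / 2" using y by linarith
  have mean: "(\<Sum>i<n. cos (z * a i)) / n = 1 + x" by (simp add: x_def r_def)
  have "0 < (\<Sum>i<n. cos (z * a i)) / n" unfolding mean using xh by linarith
  then show "0 < (\<Sum>i<n. cos (z * a i))" using n by (simp add: zero_less_divide_iff)
  have "\<bar>ln (1 + x) - x\<bar> \<le> 2 * x\<^sup>2" using xh by (rule abs_ln_one_plus_x_minus_x_bound)
  moreover have "x\<^sup>2 \<le> (52 / 100 * y)\<^sup>2" using xb y0 by (simp add: abs_le_square_iff[symmetric])
  then have "x\<^sup>2 \<le> 2704 / 10000 * y\<^sup>2" by (simp add: power_mult_distrib power_divide)
  ultimately have "\<bar>ln (1 + x) - x\<bar> \<le> 55 / 100 * y\<^sup>2"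
    using zero_le_power2[of y] by linarith
  then have "\<bar>ln (1 + x) + \<nu> * z\<^sup>2\<bar> \<le> y\<^sup>2" using rb zero_le_power2[of y] x_def by linarith
  then show "\<bar>ln ((\<Sum>i<n. cos (z * a i)) / n) + \<nu> * z\<^sup>2\<bar> \<le> A ^ 4 * z ^ 4"
    unfolding mean y2 .
qed

lemma power4_le_power2: "\<bar>z\<bar> \<le> 1 \<Longrightarrow> (z::real) ^ 4 \<le> z\<^sup>2"
  using power_decreasing[of 2 4 "\<bar>z\<bar>"] by simp

text \<open>For \<open>j = 1\<close> the kernel is constant and adds no variance; from
  \<open>j = 2\<close> on the extreme term \<open>l = 0\<close> alone gives the lower bound, which
  is the source of the growth of \<open>s\<close>.\<close>

lemma ln_cos_kernel:
  fixes J :: nat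
  defines "A \<equiv> real J + 1"
  assumes j: "1 \<le> j" "j \<le> J + 1"
  shows "\<exists>\<nu>\<ge>0. (2 \<le> j \<longrightarrow> 1 / (8 * A) \<le> \<nu>) \<and> \<nu> \<le> A ^ 4 \<and>
    (\<forall>z. \<bar>z\<bar> * A \<le> 1 / 2 \<longrightarrow> 0 < cos_kernel j z \<and> \<bar>ln (cos_kernel j z / j) + \<nu> * z\<^sup>2\<bar> \<le> A ^ 4 * z ^ 4)"
proof -
  define a where "a l = (real j - 1) / 2 - real l" for l :: nat
  define \<nu> where "\<nu> = (\<Sum>l<j. (a l)\<^sup>2) / (2 * real j)"
  have a: "\<bar>a l\<bar> \<le> A" if "l < j" for l
  proof -
    have "real l + 1 \<le> real j" using that by linarith
    then show ?thesis using j unfolding a_def A_def by (simp add: field_simps)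
  qed
  have A: "1 \<le> A" by (simp add: A_def)
  note L = ln_mean_cos[of j a A, OF _ a, folded \<nu>_def]
  have lower: "1 / (8 * A) \<le> \<nu>" if "2 \<le> j"
  proof -
    have "1 / 2 \<le> a 0" using that by (simp add: a_def)
    then have "(1 / 2)\<^sup>2 \<le> (a 0)\<^sup>2" by (intro power_mono) auto
    also have "\<dots> \<le> (\<Sum>l<j. (a l)\<^sup>2)" using that by (intro member_le_sum) auto
    finally have s: "1 / 4 \<le> (\<Sum>l<j. (a l)\<^sup>2)" by (simp add: power2_eq_square)
    have "1 / (8 * A) \<le> 1 / (8 * real j)" using j by (simp add: A_def field_simps)
    also have "\<dots> = (1 / 4) / (2 * real j)" by simp
    also have "\<dots> \<le> \<nu>" unfolding \<nu>_def using s by (intro divide_right_mono) auto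
    finally show ?thesis .
  qed
  have zA: "\<bar>0::real\<bar> * A \<le> 1 / 2" by simp
  have "A ^ 2 \<le> A ^ 4" using A by (intro power_increasing) auto
  then have up: "\<nu> \<le> A ^ 4" "0 \<le> \<nu>" using L(3,4)[OF _ _ zA] j A by auto
  have "cos_kernel j z = (\<Sum>l<j. cos (z * a l))" for z by (simp add: cos_kernel_def a_def)
  then have "0 < cos_kernel j z \<and> \<bar>ln (cos_kernel j z / j) + \<nu> * z\<^sup>2\<bar> \<le> A ^ 4 * z ^ 4"
    if "\<bar>z\<bar> * A \<le> 1 / 2" for z using L(1,2)[OF _ _ that] j by simp
  then show ?thesis using up lower by blast
qed

text \<open>\<open>J\<close> bounds the index along the ray, \<open>\<kappa>\<close> the ratio of
  denominators, \<open>C\<close> the kernels. Each inequality closes one induction: \<open>D\<close>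
  absorbs the errors of a step by means of the contraction factor
  \<open>1 - 1 / (1 + \<kappa>)\<close>; \<open>z0\<close> keeps the two averaged logarithms within
  1 of each other; \<open>\<eta>\<close> lets the variance gained pay for the largest growth of
  \<open>ln q\<close>; \<open>E\<close> lets the smallest growth of \<open>ln q\<close> at a new
  vertex pay for the additive errors.\<close>

locale constants =
  fixes J :: nat and \<kappa> C D E \<eta> z0 :: real
  assumes \<kappa>: "1 \<le> \<kappa>" and C: "1 \<le> C" and D: "2 * C + 2 \<le> D / (1 + \<kappa>)"
    and z0: "0 < z0" "z0 \<le> 1" "(D + 2 * C) * z0 \<le> 1"
    and \<eta>: "0 < \<eta>" "\<eta> * ln ((2 * J + 1) * \<kappa>) \<le> 1 / (1 + \<kappa>) * (1 / (8 * (J + 1)))"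
    and E: "C + J + (D + 2 * C)\<^sup>2 \<le> E * ln (1 + 1 / \<kappa>)"
    and cos_kernel_bounds: "\<And>j. 1 \<le> j \<Longrightarrow> j \<le> J + 1 \<Longrightarrow>
      \<exists>\<nu>\<ge>0. (2 \<le> j \<longrightarrow> 1 / (8 * (J + 1)) \<le> \<nu>) \<and> \<nu> \<le> C \<and>
        (\<forall>z. \<bar>z\<bar> \<le> z0 \<longrightarrow> 0 < cos_kernel j z \<and> \<bar>ln (cos_kernel j z / j) + \<nu> * z\<^sup>2\<bar> \<le> C * z ^ 4
          \<and> \<bar>ln (cos_kernel j z / j)\<bar> \<le> C * z\<^sup>2)"
begin

text \<open>The lower bound on \<open>s\<close> is linear in \<open>ln q\<close> rather than in the number of steps: then a vertex
  that survives a step needs no improvement, and a new vertex gains a fixed amount against a bounded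
  growth of \<open>ln q\<close>. Likewise the upper bounds grow with \<open>ln q\<close>, which increases by a fixed amount
  whenever a new vertex is created.\<close>

definition vertex :: "nat \<Rightarrow> (real \<Rightarrow> real) \<Rightarrow> real \<Rightarrow> bool" where
  "vertex q R u \<longleftrightarrow> 0 < q \<and> \<bar>u\<bar> \<le> E * (ln q + 1) \<and> (\<exists>s. \<eta> * ln q - E \<le> s \<and> s \<le> E * (ln q + 1) \<and>
     (\<forall>z. \<bar>z\<bar> \<le> z0 \<longrightarrow> 0 < R z \<and> \<bar>ln (R z / q) + s * z\<^sup>2\<bar> \<le> E * z ^ 4 * (ln q + 1)))"

text \<open>The logarithms themselves may be of size \<open>z^2 * ln q\<close>; their difference has
  to stay \<open>O(z^2)\<close> with a constant independent of the scale.\<close>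

definition close :: "nat \<Rightarrow> (real \<Rightarrow> real) \<Rightarrow> nat \<Rightarrow> (real \<Rightarrow> real) \<Rightarrow> bool" where
  "close q R q' R' \<longleftrightarrow> (\<forall>z. \<bar>z\<bar> \<le> z0 \<longrightarrow> \<bar>ln (R z / q) - ln (R' z / q')\<bar> \<le> D * z\<^sup>2)"

lemma close_commute: "close q R q' R' \<longleftrightarrow> close q' R' q R"
  by (auto simp: close_def abs_minus_commute)

lemma E_pos: "0 < E"
proof -
  have "0 < C + J + (D + 2 * C)\<^sup>2" using C by (intro add_pos_nonneg) auto
  then have "0 < E * ln (1 + 1 / \<kappa>)" using E by linarith
  moreover have "0 < ln (1 + 1 / \<kappa>)" using \<kappa> by (intro ln_gt_zero) simp
  ultimately show ?thesis by (simp add: zero_less_mult_iff)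
qed

lemma D_pos: "0 < D"
proof -
  have "0 < D / (1 + \<kappa>)" using D C by linarith
  then show ?thesis using \<kappa> by (simp add: zero_less_divide_iff)
qed

context
  fixes q q' :: nat and R R' :: "real \<Rightarrow> real" and u u' :: real
  assumes v: "vertex q R u" and v': "vertex q' R' u'" and cl: "close q R q' R'"
    and ratio: "real q \<le> \<kappa> * q'" "real q' \<le> \<kappa> * q"
begin

definition cden :: "nat \<Rightarrow> nat" where "cden j = Suc j * q + j * q'"
definition child :: "nat \<Rightarrow> real \<Rightarrow> real" where "child j z = R z * cos_kernel (Suc j) z + R' z * cos_kernel j z"
definition weight :: "nat \<Rightarrow> real" where "weight j = real (Suc j) * q / cden j"

lemma q_pos: "0 < q" "0 < q'" using v v' by (auto simp: vertex_def)

lemma cden_pos: "0 < cden j" using q_pos by (simp add: cden_def)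

text \<open>A child contains \<open>Suc j\<close> blocks of length \<open>q\<close> but only
  \<open>j\<close> of length \<open>q'\<close>, so \<open>q' \<le> \<kappa> * q\<close> secures the
  former a fixed share.\<close>

lemma weight_bounds: "1 / (1 + \<kappa>) \<le> weight j" "weight j \<le> 1"
proof -
  have "real (cden j) = real (Suc j) * real q + real j * real q'" by (simp add: cden_def algebra_simps)
  also have "\<dots> \<le> real (Suc j) * q + real (Suc j) * (\<kappa> * q)"
    using ratio(2) by (intro add_left_mono mult_mono) auto
  finally have "real (cden j) \<le> (1 + \<kappa>) * (real (Suc j) * q)" by (simp add: algebra_simps)
  then show "1 / (1 + \<kappa>) \<le> weight j" unfolding weight_def using cden_pos[of j] \<kappa>
    by (simp add: divide_simps mult_ac)
  have "real (cden j) \<ge> real (Suc j) * q" by (simp add: cden_def algebra_simps)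
  then show "weight j \<le> 1" unfolding weight_def using cden_pos[of j] by (simp add: divide_simps)
qed

lemma weight_nonneg: "0 \<le> weight j"
  by (simp add: weight_def)

lemma child_0: "cden 0 = q" "weight 0 = 1" "child 0 = R"
  using q_pos by (auto simp: cden_def weight_def child_def cos_kernel_def)

lemma close_bound:
  assumes "\<bar>z\<bar> \<le> z0"
  shows "\<bar>z\<bar> \<le> 1" "(D + 2 * C) * z\<^sup>2 \<le> 1" "(D + 2 * C)\<^sup>2 * z ^ 4 \<le> z\<^sup>2" "z ^ 4 \<le> z\<^sup>2"
proof -
  show z1: "\<bar>z\<bar> \<le> 1" using assms z0 by linarith
  then show "z ^ 4 \<le> z\<^sup>2" by (rule power4_le_power2)
  have "(D + 2 * C) * \<bar>z\<bar> \<le> (D + 2 * C) * z0" using assms D_pos C by (intro mult_left_mono) auto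
  then have b: "(D + 2 * C) * \<bar>z\<bar> \<le> 1" using z0 by linarith
  have b0: "0 \<le> (D + 2 * C) * \<bar>z\<bar>" using D_pos C by simp
  have "((D + 2 * C) * \<bar>z\<bar>) * \<bar>z\<bar> \<le> 1 * 1" using b b0 z1 by (intro mult_mono) auto
  then show "(D + 2 * C) * z\<^sup>2 \<le> 1" by (simp add: power2_eq_square mult.assoc)
  have "((D + 2 * C) * \<bar>z\<bar>)\<^sup>2 \<le> 1\<^sup>2" using b b0 by (intro power_mono) auto
  then have "((D + 2 * C) * \<bar>z\<bar>)\<^sup>2 * z\<^sup>2 \<le> 1 * z\<^sup>2" by (intro mult_right_mono) auto
  then show "(D + 2 * C)\<^sup>2 * z ^ 4 \<le> z\<^sup>2" by (simp add: power_mult_distrib power2_eq_square power4_eq_xxxx mult_ac)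
qed

lemma child_pos:
  assumes "\<bar>z\<bar> \<le> z0" "j \<le> J"
  shows "0 < child j z"
proof -
  have "0 < R z" "0 < R' z" using v v' assms by (auto simp: vertex_def)
  moreover have "0 < cos_kernel (Suc j) z" using cos_kernel_bounds[of "Suc j"] assms by auto
  \<comment> \<open>For \<open>j = 0\<close> the kernel is an empty sum, so only nonnegativity holds
    in general.\<close>
  moreover have "0 \<le> cos_kernel j z"
  proof (cases j)
    case (Suc k)
    then have "0 < cos_kernel j z" using cos_kernel_bounds[of j] assms by auto
    then show ?thesis by simp
  qed (simp add: cos_kernel_def)
  ultimately show ?thesis unfolding child_def by (intro add_pos_nonneg) auto
qed

text \<open>Normalising the parents by their denominators and the kernels by their number of terms
  makes the child a weighted mean of two terms whose logarithms differ by at most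
  \<open>(D + 2 * C) * z^2\<close>. The coarser second form drops the kernels and suffices for
  closeness.\<close>

lemma child_log:
  assumes j: "1 \<le> j" "j \<le> J" and z: "\<bar>z\<bar> \<le> z0"
  defines "L \<equiv> ln (R z / q)" and "L' \<equiv> ln (R' z / q')"
    and "k \<equiv> ln (cos_kernel (Suc j) z / Suc j)" and "k' \<equiv> ln (cos_kernel j z / j)"
  shows "\<bar>ln (child j z / cden j) - (weight j * (L + k) + (1 - weight j) * (L' + k'))\<bar> \<le> (D + 2 * C)\<^sup>2 * z ^ 4"
    and "\<bar>ln (child j z / cden j) - (weight j * L + (1 - weight j) * L')\<bar> \<le> (C + 1) * z\<^sup>2"
proof -
  define w where "w = weight j"
  have w: "0 \<le> w" "w \<le> 1" using weight_nonneg weight_bounds by (auto simp: w_def)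
  have pos: "0 < R z / q" "0 < R' z / q'" "0 < cos_kernel (Suc j) z / Suc j" "0 < cos_kernel j z / j"
    using v v' q_pos j z cos_kernel_bounds[of "Suc j"] cos_kernel_bounds[of j] by (auto simp: vertex_def)
  have kb: "\<bar>k\<bar> \<le> C * z\<^sup>2" "\<bar>k'\<bar> \<le> C * z\<^sup>2"
    using j z cos_kernel_bounds[of "Suc j"] cos_kernel_bounds[of j] unfolding k_def k'_def by auto
  define a where "a = R z / q * (cos_kernel (Suc j) z / Suc j)"
  define b where "b = R' z / q' * (cos_kernel j z / j)"
  have ab: "0 < a" "0 < b" unfolding a_def b_def using pos by (intro mult_pos_pos; simp)+
  have ln: "ln a = L + k" "ln b = L' + k'"
    unfolding a_def b_def L_def L'_def k_def k'_def using ln_mult_pos[OF pos(1,3)] ln_mult_pos[OF pos(2,4)] by simp_all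
  have w': "1 - w = real j * q' / cden j"
  proof -
    have "real (cden j) = real (Suc j) * real q + real j * real q'" by (simp add: cden_def algebra_simps)
    then show ?thesis using cden_pos[of j] by (simp add: w_def weight_def divide_simps)
  qed
  have c: "child j z / cden j = w * a + (1 - w) * b"
    unfolding w' using q_pos j cden_pos[of j]
    by (simp add: w_def weight_def a_def b_def child_def add_divide_distrib)
  have LL: "\<bar>L - L'\<bar> \<le> D * z\<^sup>2" using cl z unfolding close_def L_def L'_def by blast
  have diff: "\<bar>ln a - ln b\<bar> \<le> (D + 2 * C) * z\<^sup>2"
    unfolding ln using LL kb by (simp add: algebra_simps)
  also have "\<dots> \<le> 1" by (rule close_bound(2)[OF z])
  finally have "\<bar>ln (w * a + (1 - w) * b) - (w * ln a + (1 - w) * ln b)\<bar> \<le> (ln a - ln b)\<^sup>2"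
    using ln_weighted_mean[OF w ab] by blast
  also have "\<dots> \<le> ((D + 2 * C) * z\<^sup>2)\<^sup>2"
    using diff by (simp add: abs_le_square_iff[symmetric])
  also have "\<dots> = (D + 2 * C)\<^sup>2 * z ^ 4" by (simp add: power_mult_distrib)
  finally show 1: "\<bar>ln (child j z / cden j) - (weight j * (L + k) + (1 - weight j) * (L' + k'))\<bar> \<le> (D + 2 * C)\<^sup>2 * z ^ 4"
    unfolding c ln w_def[symmetric] .
  have "\<bar>w * k + (1 - w) * k'\<bar> \<le> w * \<bar>k\<bar> + (1 - w) * \<bar>k'\<bar>"
    using w abs_triangle_ineq[of "w * k" "(1 - w) * k'"] by (simp add: abs_mult)
  also have "\<dots> \<le> w * (C * z\<^sup>2) + (1 - w) * (C * z\<^sup>2)"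
    using w kb by (intro add_mono mult_left_mono) auto
  finally have "\<bar>w * k + (1 - w) * k'\<bar> \<le> C * z\<^sup>2" by (simp add: algebra_simps)
  then show "\<bar>ln (child j z / cden j) - (weight j * L + (1 - weight j) * L')\<bar> \<le> (C + 1) * z\<^sup>2"
    using 1 close_bound(3)[OF z] unfolding w_def[symmetric] by (simp add: algebra_simps)
qed

text \<open>Up to \<open>(C + 1) * z^2\<close> both children are means of the same two logarithms,
  so these means differ by the difference of the parents times that of the weights. Both weights lie
  between \<open>1 / (1 + \<kappa>)\<close> and 1; the resulting contraction absorbs both
  errors.\<close>

lemma child_close:
  assumes "Suc m \<le> J"
  shows "close (cden m) (child m) (cden (Suc m)) (child (Suc m))"
  unfolding close_def
proof (intro allI impI)
  fix z assume z: "\<bar>z\<bar> \<le> z0"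
  define L where "L = ln (R z / q)"
  define L' where "L' = ln (R' z / q')"
  define X where "X j = ln (child j z / cden j)" for j
  have X: "\<bar>X j - (weight j * L + (1 - weight j) * L')\<bar> \<le> (C + 1) * z\<^sup>2" if "j \<le> J" for j
  proof (cases "j = 0")
    case True
    then show ?thesis using C by (simp add: X_def child_0 L_def)
  next
    case False
    then show ?thesis using child_log(2)[of j z] that z unfolding X_def L_def L'_def by simp
  qed
  have "\<bar>weight m - weight (Suc m)\<bar> \<le> 1 - 1 / (1 + \<kappa>)"
    using weight_bounds[of m] weight_bounds[of "Suc m"] by linarith
  moreover have "\<bar>L - L'\<bar> \<le> D * z\<^sup>2" using cl z unfolding close_def L_def L'_def by blast
  ultimately have "\<bar>weight m - weight (Suc m)\<bar> * \<bar>L - L'\<bar> \<le> (1 - 1 / (1 + \<kappa>)) * (D * z\<^sup>2)"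
    by (intro mult_mono) auto
  then have "\<bar>(weight m - weight (Suc m)) * (L - L')\<bar> \<le> D * z\<^sup>2 - D / (1 + \<kappa>) * z\<^sup>2"
    unfolding abs_mult by (simp add: left_diff_distrib)
  moreover have "(weight m * L + (1 - weight m) * L') - (weight (Suc m) * L + (1 - weight (Suc m)) * L')
      = (weight m - weight (Suc m)) * (L - L')"
    by (simp add: algebra_simps)
  ultimately have "\<bar>X m - X (Suc m)\<bar> \<le> D * z\<^sup>2 - D / (1 + \<kappa>) * z\<^sup>2 + (2 * C + 2) * z\<^sup>2"
    using X[of m] X[of "Suc m"] assms by (simp add: algebra_simps)
  moreover have "(2 * C + 2) * z\<^sup>2 \<le> D / (1 + \<kappa>) * z\<^sup>2" using D by (intro mult_right_mono) auto
  ultimately show "\<bar>ln (child m z / cden m) - ln (child (Suc m) z / cden (Suc m))\<bar> \<le> D * z\<^sup>2"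
    unfolding X_def by linarith
qed

lemma cden_upper:
  assumes "j \<le> J"
  shows "ln (cden j) \<le> ln q + ln ((2 * J + 1) * \<kappa>)" "ln (cden j) \<le> ln q' + ln ((2 * J + 1) * \<kappa>)"
proof -
  have u: "real (cden j) \<le> (2 * J + 1) * \<kappa> * r" if "real q \<le> \<kappa> * r" "real q' \<le> \<kappa> * r" for r
  proof -
    have "real (cden j) = real (Suc j) * q + real j * q'" by (simp add: cden_def algebra_simps)
    also have "\<dots> \<le> real (Suc J) * (\<kappa> * r) + real J * (\<kappa> * r)"
      using that assms by (intro add_mono mult_mono) auto
    finally show ?thesis by (simp add: algebra_simps)
  qed
  have "1 * real q \<le> \<kappa> * q" "1 * real q' \<le> \<kappa> * q'" using \<kappa> by (intro mult_right_mono; simp)+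
  then have *: "real (cden j) \<le> (2 * J + 1) * \<kappa> * q" "real (cden j) \<le> (2 * J + 1) * \<kappa> * q'"
    using u[of q] u[of q'] ratio by auto
  have **: "ln (cden j) \<le> ln r + ln ((2 * J + 1) * \<kappa>)" if "real (cden j) \<le> (2 * J + 1) * \<kappa> * r" "0 < r" for r
  proof -
    have "0 < (2 * J + 1) * \<kappa>" using \<kappa> by simp
    have "ln (cden j) \<le> ln ((2 * J + 1) * \<kappa> * r)"
      using that cden_pos[of j] by (intro ln_mono) auto
    also have "\<dots> = ln r + ln ((2 * J + 1) * \<kappa>)" using that \<open>0 < (2 * J + 1) * \<kappa>\<close> by (simp add: ln_mult_pos)
    finally show ?thesis .
  qed
  show "ln (cden j) \<le> ln q + ln ((2 * J + 1) * \<kappa>)" "ln (cden j) \<le> ln q' + ln ((2 * J + 1) * \<kappa>)"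
    using ** * q_pos by auto
qed

text \<open>A new denominator is at least \<open>2 * q + q'\<close>, hence at least
  \<open>1 + 1 / \<kappa>\<close> times either parent. This is the fixed gain in
  \<open>ln q\<close>.\<close>

lemma cden_lower:
  assumes "1 \<le> j"
  shows "ln q + ln (1 + 1 / \<kappa>) \<le> ln (cden j)" "ln q' + ln (1 + 1 / \<kappa>) \<le> ln (cden j)"
proof -
  have "2 * q + 1 * q' \<le> Suc j * q + j * q'" using assms by (intro add_mono mult_right_mono) auto
  then have d: "2 * real q + q' \<le> cden j" unfolding cden_def by linarith
  have k: "1 / \<kappa> \<le> 1" "0 < 1 + 1 / \<kappa>" using \<kappa> by (auto simp: add_pos_nonneg)
  have "real q * (1 + 1 / \<kappa>) \<le> real q * 2" using k by (intro mult_left_mono) auto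
  then have 1: "real q * (1 + 1 / \<kappa>) \<le> cden j" using d by linarith
  have "q' / \<kappa> \<le> q" using ratio \<kappa> by (simp add: field_simps)
  then have 2: "real q' * (1 + 1 / \<kappa>) \<le> cden j" using d by (simp add: algebra_simps)
  have *: "ln r + ln (1 + 1 / \<kappa>) \<le> ln (cden j)" if "r * (1 + 1 / \<kappa>) \<le> cden j" "0 < r" for r
  proof -
    have "ln r + ln (1 + 1 / \<kappa>) = ln (r * (1 + 1 / \<kappa>))" using that k by (simp add: ln_mult_pos)
    also have "\<dots> \<le> ln (cden j)" using that k by (intro ln_mono) auto
    finally show ?thesis .
  qed
  show "ln q + ln (1 + 1 / \<kappa>) \<le> ln (cden j)" "ln q' + ln (1 + 1 / \<kappa>) \<le> ln (cden j)"
    using * 1 2 q_pos by auto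
qed

text \<open>The upper bounds of the parents can be averaged because \<open>ln (cden j)\<close>
  exceeds both of their logarithms by at least \<open>gap\<close>, and \<open>E * gap\<close> covers
  the new errors. The lower bound survives because the first kernel contributes at least
  \<open>\<nu> / (1 + \<kappa>)\<close>, which covers \<open>\<eta>\<close> times the growth of the
  logarithm.\<close>

lemma child_vertex:
  assumes j: "j \<le> J" and w: "\<bar>w\<bar> \<le> \<bar>u\<bar> + real j" and w0: "j = 0 \<Longrightarrow> w = u"
  shows "vertex (cden j) (child j) w"
proof (cases "j = 0")
  case True
  then show ?thesis using v w0 by (simp add: child_0)
next
  case False
  then have j1: "1 \<le> j" by simp
  obtain s where s: "\<eta> * ln q - E \<le> s" "s \<le> E * (ln q + 1)"
    "\<And>z. \<bar>z\<bar> \<le> z0 \<Longrightarrow> 0 < R z \<and> \<bar>ln (R z / q) + s * z\<^sup>2\<bar> \<le> E * z ^ 4 * (ln q + 1)"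
    using v unfolding vertex_def by blast
  obtain s' where s': "\<eta> * ln q' - E \<le> s'" "s' \<le> E * (ln q' + 1)"
    "\<And>z. \<bar>z\<bar> \<le> z0 \<Longrightarrow> 0 < R' z \<and> \<bar>ln (R' z / q') + s' * z\<^sup>2\<bar> \<le> E * z ^ 4 * (ln q' + 1)"
    using v' unfolding vertex_def by blast
  obtain \<nu> where \<nu>: "0 \<le> \<nu>" "1 / (8 * (J + 1)) \<le> \<nu>" "\<nu> \<le> C"
    "\<And>z. \<bar>z\<bar> \<le> z0 \<Longrightarrow> \<bar>ln (cos_kernel (Suc j) z / Suc j) + \<nu> * z\<^sup>2\<bar> \<le> C * z ^ 4"
    using cos_kernel_bounds[of "Suc j"] j j1 by auto
  obtain \<nu>' where \<nu>': "0 \<le> \<nu>'" "\<nu>' \<le> C"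
    "\<And>z. \<bar>z\<bar> \<le> z0 \<Longrightarrow> \<bar>ln (cos_kernel j z / j) + \<nu>' * z\<^sup>2\<bar> \<le> C * z ^ 4"
    using cos_kernel_bounds[of j] j j1 by auto
  define a where "a = weight j"
  have a: "1 / (1 + \<kappa>) \<le> a" "0 \<le> a" "0 \<le> 1 - a" using weight_bounds weight_nonneg by (auto simp: a_def)
  define gap where "gap = ln (1 + 1 / \<kappa>)"
  have gap: "0 < gap" unfolding gap_def using \<kappa> by (intro ln_gt_zero) simp
  define Q where "Q = ln (real (cden j))"
  have Q: "ln q + gap \<le> Q" "ln q' + gap \<le> Q" using cden_lower[OF j1] by (auto simp: Q_def gap_def)
  have avg: "a * x + (1 - a) * y \<le> m" if "x \<le> m" "y \<le> m" for x y m
    using mult_left_mono[OF that(1) a(2)] mult_left_mono[OF that(2) a(3)] by (simp add: algebra_simps)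
  have avg': "m \<le> a * x + (1 - a) * y" if "m \<le> x" "m \<le> y" for x y m
    using mult_left_mono[OF that(1) a(2)] mult_left_mono[OF that(2) a(3)] by (simp add: algebra_simps)
  have E_gap: "C + J + (D + 2 * C)\<^sup>2 \<le> E * gap" using E by (simp add: gap_def)
  have EQ: "E * (ln q + 1) \<le> E * (Q + 1) - E * gap" "E * (ln q' + 1) \<le> E * (Q + 1) - E * gap"
    using mult_left_mono[OF Q(1), of E] mult_left_mono[OF Q(2), of E] E_pos by (auto simp: algebra_simps)
  \<comment> \<open>The coefficient of the child: the mean of the parents' coefficients, each
    increased by that of its kernel.\<close>
  define t where "t = a * (s + \<nu>) + (1 - a) * (s' + \<nu>')"
  have "t \<le> E * (Q + 1) - E * gap + C"
    unfolding t_def using s(2) s'(2) \<nu> \<nu>' EQ by (intro avg) linarith+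
  then have t_up: "t \<le> E * (Q + 1)" using E_gap zero_le_power2[of "D + 2 * C"] by linarith
  have t_low: "\<eta> * Q - E \<le> t"
  proof -
    define \<Lambda> where "\<Lambda> = ln ((2 * J + 1) * \<kappa>)"
    have "Q \<le> ln q + \<Lambda>" "Q \<le> ln q' + \<Lambda>" using cden_upper[OF j] by (auto simp: Q_def \<Lambda>_def)
    then have "\<eta> * Q \<le> \<eta> * ln q + \<eta> * \<Lambda>" "\<eta> * Q \<le> \<eta> * ln q' + \<eta> * \<Lambda>"
      using mult_left_mono[of Q "ln q + \<Lambda>" \<eta>] mult_left_mono[of Q "ln q' + \<Lambda>" \<eta>] \<eta>
      by (auto simp: algebra_simps)
    then have "\<eta> * Q - \<eta> * \<Lambda> - E \<le> a * s + (1 - a) * s'"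
      using s(1) s'(1) by (intro avg') linarith+
    moreover have "\<eta> * \<Lambda> \<le> a * \<nu>"
    proof -
      have "\<eta> * \<Lambda> \<le> 1 / (1 + \<kappa>) * (1 / (8 * (J + 1)))" using \<eta>(2) by (simp add: \<Lambda>_def)
      also have "\<dots> \<le> a * \<nu>" using a(1) \<nu>(2) a(2) by (intro mult_mono) auto
      finally show ?thesis .
    qed
    moreover have "0 \<le> (1 - a) * \<nu>'" using a \<nu>' by simp
    ultimately show ?thesis by (simp add: t_def algebra_simps)
  qed
  have err: "0 < child j z \<and> \<bar>ln (child j z / cden j) + t * z\<^sup>2\<bar> \<le> E * z ^ 4 * (Q + 1)" if z: "\<bar>z\<bar> \<le> z0" for z
  proof
    show "0 < child j z" using child_pos[OF z j] .
    define L where "L = ln (R z / q)"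
    define L' where "L' = ln (R' z / q')"
    define k where "k = ln (cos_kernel (Suc j) z / Suc j)"
    define k' where "k' = ln (cos_kernel j z / j)"
    have 1: "\<bar>ln (child j z / cden j) - (a * (L + k) + (1 - a) * (L' + k'))\<bar> \<le> (D + 2 * C)\<^sup>2 * z ^ 4"
      using child_log(1)[OF j1 j z] by (simp add: a_def L_def L'_def k_def k'_def)
    have z4: "0 \<le> z ^ 4" by simp
    have EQz: "E * z ^ 4 * (ln q + 1) \<le> (E * (Q + 1) - E * gap) * z ^ 4"
        "E * z ^ 4 * (ln q' + 1) \<le> (E * (Q + 1) - E * gap) * z ^ 4"
      using mult_right_mono[OF EQ(1) z4] mult_right_mono[OF EQ(2) z4] by (simp_all add: mult_ac)
    have b: "\<bar>(L + k) + (s + \<nu>) * z\<^sup>2\<bar> \<le> (E * (Q + 1) - E * gap) * z ^ 4 + C * z ^ 4"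
      "\<bar>(L' + k') + (s' + \<nu>') * z\<^sup>2\<bar> \<le> (E * (Q + 1) - E * gap) * z ^ 4 + C * z ^ 4"
      using s(3)[OF z] s'(3)[OF z] \<nu>(4)[OF z] \<nu>'(3)[OF z] EQz
      unfolding L_def L'_def k_def k'_def distrib_right by linarith+
    define B where "B = (E * (Q + 1) - E * gap) * z ^ 4 + C * z ^ 4"
    have "a * ((L + k) + (s + \<nu>) * z\<^sup>2) + (1 - a) * ((L' + k') + (s' + \<nu>') * z\<^sup>2) \<le> B"
      "- B \<le> a * ((L + k) + (s + \<nu>) * z\<^sup>2) + (1 - a) * ((L' + k') + (s' + \<nu>') * z\<^sup>2)"
      using b unfolding B_def[symmetric] by (intro avg avg'; linarith)+
    moreover have "a * ((L + k) + (s + \<nu>) * z\<^sup>2) + (1 - a) * ((L' + k') + (s' + \<nu>') * z\<^sup>2)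
        = a * (L + k) + (1 - a) * (L' + k') + t * z\<^sup>2"
      by (simp add: t_def algebra_simps)
    ultimately have "\<bar>ln (child j z / cden j) + t * z\<^sup>2\<bar> \<le> B + (D + 2 * C)\<^sup>2 * z ^ 4"
      using 1 by linarith
    also have "\<dots> = E * z ^ 4 * (Q + 1) - (E * gap - C - (D + 2 * C)\<^sup>2) * z ^ 4"
      by (simp add: B_def algebra_simps)
    also have "\<dots> \<le> E * z ^ 4 * (Q + 1)" using E_gap by simp
    finally show "\<bar>ln (child j z / cden j) + t * z\<^sup>2\<bar> \<le> E * z ^ 4 * (Q + 1)" .
  qed
  have "\<bar>u\<bar> \<le> E * (ln q + 1)" using v by (simp add: vertex_def)
  then have "\<bar>w\<bar> \<le> E * (Q + 1) - E * gap + J" using w j EQ(1) by linarith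
  then have "\<bar>w\<bar> \<le> E * (Q + 1)" using E_gap C zero_le_power2[of "D + 2 * C"] by linarith
  then show ?thesis unfolding vertex_def Q_def[symmetric]
    using cden_pos t_up t_low err by blast
qed

end

end

section \<open>Pairs at every scale\<close>

text \<open>Both terms of \<open>\<delta> * q' + \<delta>' * q = 1\<close> are positive, while
  \<open>\<delta> \<ge> c / q\<close> and \<open>\<delta>' \<ge> c / q'\<close>.\<close>

lemma farey_pair_ratio:
  assumes "badly_approximable c \<theta>" "farey_pair \<theta> p q p' q'"
  shows "c * real q \<le> q'" "c * real q' \<le> q"
proof -
  note pos = farey_pair_pos[OF assms(2)]
  have q: "0 < q" "0 < q'" using assms(2) by (auto simp: farey_pair_def)
  have "c / real q \<le> real q * \<theta> - p" "c / real q' \<le> p' - real q' * \<theta>"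
    using assms(1) q pos unfolding badly_approximable_def
    by (metis abs_of_pos, metis abs_minus_commute abs_of_pos)
  then have "c / real q * q' \<le> (real q * \<theta> - p) * q'" "c / real q' * q \<le> (p' - real q' * \<theta>) * q"
    by (intro mult_right_mono; simp)+
  moreover have "0 \<le> (real q * \<theta> - p) * q'" "0 \<le> (p' - real q' * \<theta>) * q" using pos by auto
  ultimately have "c / real q * q' \<le> 1" "c / real q' * q \<le> 1" using pos(3) by linarith+
  then show "c * real q \<le> q'" "c * real q' \<le> q" using q by (auto simp: field_simps)
qed

context constants
begin

lemma vertex_uminus: "vertex q R (- u) \<longleftrightarrow> vertex q R u"
  by (simp add: vertex_def)

definition good :: "real \<Rightarrow> int \<times> nat \<times> int \<times> nat \<Rightarrow> bool" where
  "good \<theta> = (\<lambda>(p, q, p', q'). odd_pair \<theta> p q p' q' \<and>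
     vertex q (rot_cos \<theta> q) (rot_sum \<theta> (q - 1)) \<and> vertex q' (rot_cos \<theta> q') (rot_sum \<theta> (q' - 1)) \<and>
     close q (rot_cos \<theta> q) q' (rot_cos \<theta> q'))"

lemma good_uminus:
  assumes "badly_approximable c \<theta>"
  shows "good (- \<theta>) (- p', q', - p, q) \<longleftrightarrow> good \<theta> (p, q, p', q')"
  unfolding good_def prod.case odd_pair_uminus rot_cos_uminus[OF assms, abs_def] rot_sum_uminus[OF assms] vertex_uminus
  using close_commute by auto

lemma good_step_left:
  assumes ba: "badly_approximable c \<theta>" and c: "1 / c \<le> \<kappa>" "1 / c + 1 \<le> J"
    and good: "good \<theta> (p, q, p', q')" and left: "real (q + q') * \<theta> < of_int (p + p')"
  shows "\<exists>a b a' b'. good \<theta> (a, b, a', b') \<and> q + q' < b + b' \<and> b + b' \<le> (2 * J + 1) * (q + q')"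
proof -
  interpret left_step \<theta> p p' q q'
    using good left by unfold_locales (auto simp: good_def)
  have c0: "0 < c" using ba by (simp add: badly_approximable_def)
  note r = farey_pair_ratio[OF ba farey(1)]
  have r: "real q \<le> \<kappa> * q'" "real q' \<le> \<kappa> * q"
  proof -
    have "real q \<le> 1 / c * q'" "real q' \<le> 1 / c * q" using r c0 by (auto simp: field_simps)
    moreover have "1 / c * q' \<le> \<kappa> * q'" "1 / c * q \<le> \<kappa> * q" using c(1) by (intro mult_right_mono; simp)+
    ultimately show "real q \<le> \<kappa> * q'" "real q' \<le> \<kappa> * q" by linarith+
  qed
  define m where "m = ray_index"
  have "real m + 1 \<le> J" using ray_index(2)[OF ba] c unfolding m_def by linarith
  then have m: "Suc m \<le> J" by linarith
  note v = good[unfolded good_def prod.case, THEN conjunct2]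
  have v: "vertex q (rot_cos \<theta> q) (rot_sum \<theta> (q - 1))" "vertex q' (rot_cos \<theta> q') (rot_sum \<theta> (q' - 1))"
    "close q (rot_cos \<theta> q) q' (rot_cos \<theta> q')" using v by auto
  have den: "cden q q' j = den j" for j
    unfolding cden_def[OF v r] den_def by (simp add: algebra_simps)
  have child: "child (rot_cos \<theta> q) (rot_cos \<theta> q') j = rot_cos \<theta> (den j)" if "j = m \<or> j = Suc m" for j
    using rot_cos_ray(1)[OF ba that[unfolded m_def]] unfolding child_def[OF v r] by auto
  have u: "rot_sum \<theta> (den j - 1) = rot_sum \<theta> (q - 1) - j" if "j = m \<or> j = Suc m" for j
    using rot_cos_ray(2)[OF ba that[unfolded m_def]] .
  have "vertex (den j) (rot_cos \<theta> (den j)) (rot_sum \<theta> (den j - 1))" if "j = m \<or> j = Suc m" for j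
  proof -
    have "vertex (cden q q' j) (child (rot_cos \<theta> q) (rot_cos \<theta> q') j) (rot_sum \<theta> (den j - 1))"
      by (rule child_vertex[OF v r]) (use that m u[OF that] in linarith)+
    then show ?thesis unfolding den child[OF that] .
  qed
  moreover have "close (den m) (rot_cos \<theta> (den m)) (den (Suc m)) (rot_cos \<theta> (den (Suc m)))"
    using child_close[OF v r m] child unfolding den by auto
  ultimately have "good \<theta> (num m, den m, num (Suc m), den (Suc m))"
    using ray_index(1)[OF ba] unfolding good_def m_def by auto
  moreover have "den m + den (Suc m) = 2 * q + (2 * m + 1) * (q + q')" by (simp add: den_def algebra_simps)
  moreover have "2 * q + (2 * m + 1) * (q + q') \<le> (2 * m + 3) * (q + q')" by (simp add: algebra_simps)
  moreover have "(2 * m + 3) * (q + q') \<le> (2 * J + 1) * (q + q')" using m by (intro mult_right_mono) auto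
  moreover have "q + q' < 2 * q + (2 * m + 1) * (q + q')" using farey(1) by (simp add: farey_pair_def)
  ultimately have "good \<theta> (num m, den m, num (Suc m), den (Suc m)) \<and> q + q' < den m + den (Suc m) \<and>
      den m + den (Suc m) \<le> (2 * J + 1) * (q + q')"
    by (simp only: simp_thms)
  then show ?thesis by blast
qed

text \<open>A mediant to the left of \<theta> is treated at \<open>- \<theta>\<close>, where the
  pair is swapped; only the midpoints change sign, and \<open>vertex\<close> sees their absolute
  values.\<close>

lemma good_step:
  assumes ba: "badly_approximable c \<theta>" and c: "1 / c \<le> \<kappa>" "1 / c + 1 \<le> J"
    and good: "good \<theta> (p, q, p', q')"
  shows "\<exists>a b a' b'. good \<theta> (a, b, a', b') \<and> q + q' < b + b' \<and> b + b' \<le> (2 * J + 1) * (q + q')"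
proof (cases "real (q + q') * \<theta> < of_int (p + p')")
  case True
  then show ?thesis by (rule good_step_left[OF assms])
next
  case False
  have "0 < q + q'" using good by (auto simp: good_def odd_pair_def farey_pair_def)
  then have "of_int (p + p') < real (q + q') * \<theta>"
    using False badly_approximable_neq[OF ba, of "q + q'" "p + p'"] by linarith
  then have right: "real (q' + q) * - \<theta> < of_int (- p' + - p)" by (simp add: algebra_simps)
  have "good (- \<theta>) (- p', q', - p, q)" using good good_uminus[OF ba] by simp
  from good_step_left[OF badly_approximable_uminus[OF ba] c this right]
  obtain a b a' b' where *: "good (- \<theta>) (a, b, a', b')" "q + q' < b + b'" "b + b' \<le> (2 * J + 1) * (q + q')"
    by (auto simp: add.commute)
  have "good \<theta> (- a', b', - a, b)"
    using *(1) good_uminus[OF ba, of "- a" b "- a'" b'] by simp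
  then show ?thesis using *(2,3) by (metis add.commute)
qed

end

text \<open>Modulo 2 and up to sign \<theta> becomes some \<open>t\<close> between 0 and 1, and
  \<open>1 / (m + 1) < t < 1 / m\<close> for \<open>m = \<lfloor>1 / t\<rfloor>\<close>. Undoing the
  translation by \<open>2 * k\<close> keeps the numerators odd.\<close>

lemma odd_pair_exists:
  assumes ba: "badly_approximable c \<theta>"
  shows "\<exists>p q p' q'. odd_pair \<theta> p q p' q'"
proof -
  have *: "\<exists>p q p' q'. odd_pair \<theta> p q p' q'"
    if ba: "badly_approximable c \<theta>" and t: "0 < \<theta> - 2 * of_int k" "\<theta> - 2 * of_int k < 1" for \<theta> k
  proof -
    define t where "t = \<theta> - 2 * of_int k"
    define m where "m = nat \<lfloor>1 / t\<rfloor>"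
    have t: "0 < t" "t < 1" using t by (auto simp: t_def)
    then have "1 \<le> 1 / t" by simp
    then have m1: "1 \<le> m" and m: "real m \<le> 1 / t" "1 / t < real m + 1" unfolding m_def by linarith+
    have "real m * t \<le> 1" "1 < (real m + 1) * t" using m t by (auto simp: field_simps)
    moreover have "real m * \<theta> \<noteq> of_int (1 + 2 * k * int m)"
      using m1 by (intro badly_approximable_neq[OF ba]) auto
    ultimately have "odd_pair \<theta> (1 + 2 * k * int (m + 1)) (m + 1) (1 + 2 * k * int m) m"
      using m1 by (auto simp: odd_pair_def farey_pair_def t_def algebra_simps)
    then show ?thesis by blast
  qed
  define k where "k = \<lfloor>\<theta> / 2\<rfloor>"
  have k: "0 \<le> \<theta> - 2 * of_int k" "\<theta> - 2 * of_int k < 2" unfolding k_def by linarith+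
  have "real 1 * \<theta> \<noteq> of_int (2 * k)" "real 1 * \<theta> \<noteq> of_int (2 * k + 1)"
    by (intro badly_approximable_neq[OF ba]; simp)+
  then consider "0 < \<theta> - 2 * of_int k \<and> \<theta> - 2 * of_int k < 1"
    | "0 < - \<theta> - 2 * of_int (- k - 1) \<and> - \<theta> - 2 * of_int (- k - 1) < 1"
    using k by fastforce
  then show ?thesis
  proof cases
    case 1
    then show ?thesis using *[OF ba] by blast
  next
    case 2
    then obtain p q p' q' where "odd_pair (- \<theta>) p q p' q'"
      using *[OF badly_approximable_uminus[OF ba]] by blast
    then have "odd_pair \<theta> (- p') q' (- p) q" using odd_pair_uminus[of \<theta> "- p" q "- p'" q'] by simp
    then show ?thesis by blast
  qed
qed

lemma abs_rot_sum_le: "\<bar>rot_sum \<theta> N\<bar> \<le> N"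
proof -
  have "\<bar>rot_sum \<theta> N\<bar> \<le> (\<Sum>j=1..N. \<bar>rot_sign \<theta> j\<bar>)" unfolding rot_sum_def by (rule sum_abs)
  also have "\<dots> = (\<Sum>j=1..N. 1)" by (intro sum.cong) (auto simp: rot_sign_def)
  finally show ?thesis by simp
qed

text \<open>The constants have to fit the step and also admit the given starting pair. The summands
  containing \<open>B\<close> or \<open>q + q'\<close> are for the start, the others for the step;
  each constant depends on earlier ones only.\<close>

lemma constants_exist:
  fixes \<kappa> \<theta> :: real and q q' :: nat
  assumes "1 \<le> \<kappa>" "0 < q" "0 < q'"
  shows "\<exists>C D E \<eta> z0. constants J \<kappa> C D E \<eta> z0 \<and>
    constants.vertex E \<eta> z0 q (rot_cos \<theta> q) (rot_sum \<theta> (q - 1)) \<and>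
    constants.vertex E \<eta> z0 q' (rot_cos \<theta> q') (rot_sum \<theta> (q' - 1)) \<and>
    constants.close D z0 q (rot_cos \<theta> q) q' (rot_cos \<theta> q')"
proof -
  define A where "A = real J + 1"
  define B where "B = 2 * (real q + real q')"
  define C where "C = 2 * A ^ 4"
  define D where "D = (1 + \<kappa>) * (2 * C + 2) + 3 * B ^ 4"
  define z0 where "z0 = 1 / (D + 2 * C + 2 * A + 2 * B)"
  define \<eta> where "\<eta> = 1 / (1 + \<kappa>) * (1 / (8 * (J + 1))) / (ln ((2 * J + 1) * \<kappa>) + 1)"
  define E where "E = (C + J + (D + 2 * C)\<^sup>2) / ln (1 + 1 / \<kappa>) + B ^ 4 + \<eta> * (real q + real q')"
  have A: "1 \<le> A" by (simp add: A_def)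
  then have A4: "1 \<le> A ^ 4" by (rule one_le_power)
  have B: "1 \<le> B" using assms by (simp add: B_def)
  have B4: "B \<le> B ^ 4" "B\<^sup>2 \<le> B ^ 4" using B power_increasing[of 1 4 B] power_increasing[of 2 4 B] by auto
  have C: "1 \<le> C" using A4 by (simp add: C_def)
  have B40: "0 \<le> B ^ 4" by simp
  have "(1 + \<kappa>) * (2 * C + 2) \<ge> 0" using assms C by simp
  then have D_ge: "0 \<le> D" "3 * B ^ 4 \<le> D" using B40 by (auto simp: D_def)
  have DC: "2 * C + 2 \<le> D / (1 + \<kappa>)"
    using assms by (simp add: D_def pos_le_divide_eq mult.commute)
  have den: "1 \<le> D + 2 * C + 2 * A + 2 * B" using A B C D_ge by linarith
  have z0: "0 < z0" "z0 \<le> 1" using den by (auto simp: z0_def)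
  have small: "w * z0 \<le> 1" if "w \<le> D + 2 * C + 2 * A + 2 * B" for w
    using that den by (simp add: z0_def divide_le_eq)
  have z0': "(D + 2 * C) * z0 \<le> 1" "z0 * A \<le> 1 / 2" "z0 * B \<le> 1 / 2"
    using small[of "D + 2 * C"] small[of "2 * A"] small[of "2 * B"] A B C D_ge by (simp_all add: mult_ac)
  have J\<kappa>: "1 \<le> (2 * J + 1) * \<kappa>" using mult_mono[of 1 "real (2 * J + 1)" 1 \<kappa>] assms by simp
  then have ln0: "0 \<le> ln ((2 * J + 1) * \<kappa>)" by simp
  have \<eta>: "0 < \<eta>" unfolding \<eta>_def using assms(1) ln0 by (intro divide_pos_pos mult_pos_pos add_nonneg_pos) auto
  have "\<eta> * ln ((2 * J + 1) * \<kappa>) \<le> \<eta> * (ln ((2 * J + 1) * \<kappa>) + 1)" using \<eta> by (intro mult_left_mono) auto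
  also have "\<dots> = 1 / (1 + \<kappa>) * (1 / (8 * (J + 1)))" using ln0 by (simp add: \<eta>_def)
  finally have \<eta>': "\<eta> * ln ((2 * J + 1) * \<kappa>) \<le> 1 / (1 + \<kappa>) * (1 / (8 * (J + 1)))" .
  have gap: "0 < ln (1 + 1 / \<kappa>)" using assms by (intro ln_gt_zero) simp
  have num: "0 \<le> (C + J + (D + 2 * C)\<^sup>2)" using C by simp
  then have "0 \<le> (C + J + (D + 2 * C)\<^sup>2) / ln (1 + 1 / \<kappa>)" using gap by simp
  then have E_ge: "B ^ 4 + \<eta> * (real q + real q') \<le> E" by (simp add: E_def)
  have \<eta>q: "0 \<le> \<eta> * (real q + real q')" using \<eta> by simp
  have "C + J + (D + 2 * C)\<^sup>2 = (C + J + (D + 2 * C)\<^sup>2) / ln (1 + 1 / \<kappa>) * ln (1 + 1 / \<kappa>)" using gap by simp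
  also have "\<dots> \<le> E * ln (1 + 1 / \<kappa>)" using gap B40 \<eta>q by (intro mult_right_mono) (auto simp: E_def)
  finally have E': "C + J + (D + 2 * C)\<^sup>2 \<le> E * ln (1 + 1 / \<kappa>)" .
  have cos_kernel: "\<exists>\<nu>\<ge>0. (2 \<le> j \<longrightarrow> 1 / (8 * (J + 1)) \<le> \<nu>) \<and> \<nu> \<le> C \<and>
        (\<forall>z. \<bar>z\<bar> \<le> z0 \<longrightarrow> 0 < cos_kernel j z \<and> \<bar>ln (cos_kernel j z / j) + \<nu> * z\<^sup>2\<bar> \<le> C * z ^ 4
          \<and> \<bar>ln (cos_kernel j z / j)\<bar> \<le> C * z\<^sup>2)" if j: "1 \<le> j" "j \<le> J + 1" for j
  proof -
    obtain \<nu> where \<nu>: "0 \<le> \<nu>" "2 \<le> j \<longrightarrow> 1 / (8 * A) \<le> \<nu>" "\<nu> \<le> A ^ 4"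
      "\<And>z. \<bar>z\<bar> * A \<le> 1 / 2 \<Longrightarrow> 0 < cos_kernel j z \<and> \<bar>ln (cos_kernel j z / j) + \<nu> * z\<^sup>2\<bar> \<le> A ^ 4 * z ^ 4"
      using ln_cos_kernel[OF j] unfolding A_def by blast
    have "0 < cos_kernel j z \<and> \<bar>ln (cos_kernel j z / j) + \<nu> * z\<^sup>2\<bar> \<le> C * z ^ 4
          \<and> \<bar>ln (cos_kernel j z / j)\<bar> \<le> C * z\<^sup>2" if z: "\<bar>z\<bar> \<le> z0" for z
    proof -
      have "\<bar>z\<bar> * A \<le> z0 * A" using z A by (intro mult_right_mono) auto
      then have "\<bar>z\<bar> * A \<le> 1 / 2" using z0' by linarith
      note k = \<nu>(4)[OF this]
      have z4: "z ^ 4 \<le> z\<^sup>2" using z z0 by (intro power4_le_power2) auto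
      have "A ^ 4 * z ^ 4 \<le> A ^ 4 * z\<^sup>2" using z4 by (intro mult_left_mono) auto
      moreover have "\<nu> * z\<^sup>2 \<le> A ^ 4 * z\<^sup>2" using \<nu> by (intro mult_right_mono) auto
      moreover have "0 \<le> \<nu> * z\<^sup>2" "0 \<le> A ^ 4 * z ^ 4" using \<nu> by auto
      ultimately show ?thesis using k unfolding C_def by linarith
    qed
    moreover have "\<nu> \<le> C" using \<nu>(3) A4 by (simp add: C_def)
    moreover have "8 * A = real (8 * (J + 1))" by (simp add: A_def)
    ultimately show ?thesis using \<nu>(1,2) by metis
  qed
  interpret constants J \<kappa> C D E \<eta> z0
    by unfold_locales (fact assms(1) C DC z0 z0'(1) \<eta> \<eta>' E' cos_kernel)+
  define a where "a r N = rot_sum \<theta> N - rot_sum \<theta> (r - 1) / 2" for r N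
  define \<nu> where "\<nu> r = (\<Sum>N<r. (a r N)\<^sup>2) / (2 * real r)" for r
  have a: "\<bar>a r N\<bar> \<le> B" if "N < r" "r \<le> q + q'" for r N
  proof -
    have "real N \<le> real q + real q'" "real (r - 1) \<le> real q + real q'" using that by linarith+
    then have "\<bar>rot_sum \<theta> N\<bar> \<le> real q + real q'" "\<bar>rot_sum \<theta> (r - 1)\<bar> \<le> real q + real q'"
      using abs_rot_sum_le order_trans by blast+
    moreover have "\<bar>x - y / 2\<bar> \<le> 2 * t" if "\<bar>x\<bar> \<le> t" "\<bar>y\<bar> \<le> t" for x y t :: real
      using that by linarith
    ultimately show ?thesis unfolding a_def B_def by blast
  qed
  have L: "0 < rot_cos \<theta> r z" "\<bar>ln (rot_cos \<theta> r z / r) + \<nu> r * z\<^sup>2\<bar> \<le> B ^ 4 * z ^ 4"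
    "0 \<le> \<nu> r" "\<nu> r \<le> B\<^sup>2 / 2" if r: "0 < r" "r \<le> q + q'" and z: "\<bar>z\<bar> \<le> z0" for r z
  proof -
    have "\<bar>z\<bar> * B \<le> z0 * B" using z B by (intro mult_right_mono) auto
    then have zB: "\<bar>z\<bar> * B \<le> 1 / 2" using z0' by linarith
    have R: "rot_cos \<theta> r z = (\<Sum>N<r. cos (z * a r N))" by (simp add: rot_cos_def a_def)
    show "0 < rot_cos \<theta> r z" "\<bar>ln (rot_cos \<theta> r z / r) + \<nu> r * z\<^sup>2\<bar> \<le> B ^ 4 * z ^ 4"
      "0 \<le> \<nu> r" "\<nu> r \<le> B\<^sup>2 / 2"
      using ln_mean_cos[of r "a r" B z, OF r(1) a[OF _ r(2)] zB] unfolding R \<nu>_def by auto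
  qed
  have vertex: "vertex r (rot_cos \<theta> r) (rot_sum \<theta> (r - 1))" if r: "0 < r" "r \<le> q + q'" for r
  proof -
    have lnr: "0 \<le> ln r" "ln r \<le> r" using r ln_le_minus_one[of "real r"] by auto
    have rq: "real r \<le> real q + real q'" using r by linarith
    have B4E: "B ^ 4 \<le> E" using E_ge \<eta>q by linarith
    have EE: "E \<le> E * (ln r + 1)" using lnr mult_left_mono[of 1 "ln r + 1" E] B4E B40 by simp
    have "r - 1 \<le> 2 * (q + q')" by (rule le_trans[OF diff_le_self]) (use r in simp)
    then have "real (r - 1) \<le> B" unfolding B_def using of_nat_mono[of "r - 1" "2 * (q + q')"] by simp
    also have "B \<le> E * (ln r + 1)" using B4 B4E EE by linarith
    finally have u: "\<bar>rot_sum \<theta> (r - 1)\<bar> \<le> E * (ln r + 1)" using abs_rot_sum_le order_trans by blast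
    have "\<eta> * ln r \<le> \<eta> * (real q + real q')" using lnr rq \<eta> by (intro mult_left_mono) auto
    moreover have \<nu>r: "0 \<le> \<nu> r" "\<nu> r \<le> B\<^sup>2 / 2" using L(3,4)[OF r, of 0] z0 by simp_all
    ultimately have low: "\<eta> * ln r - E \<le> \<nu> r" using E_ge B40 by linarith
    have up: "\<nu> r \<le> E * (ln r + 1)" using \<nu>r(2) B4 B4E EE B40 zero_le_power2[of B] by linarith
    have "\<bar>ln (rot_cos \<theta> r z / r) + \<nu> r * z\<^sup>2\<bar> \<le> E * z ^ 4 * (ln r + 1)" if "\<bar>z\<bar> \<le> z0" for z
    proof -
      have "B ^ 4 * z ^ 4 \<le> (E * (ln r + 1)) * z ^ 4" using B4E EE by (intro mult_right_mono) auto
      then show ?thesis using L(2)[OF r that] by (simp add: mult_ac)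
    qed
    then show ?thesis unfolding vertex_def using r u low up L(1)[OF r] by blast
  qed
  have "close q (rot_cos \<theta> q) q' (rot_cos \<theta> q')"
    unfolding close_def
  proof (intro allI impI)
    fix z assume z: "\<bar>z\<bar> \<le> z0"
    have z4: "z ^ 4 \<le> z\<^sup>2" using z z0 by (intro power4_le_power2) auto
    have l: "\<bar>ln (rot_cos \<theta> r z / r)\<bar> \<le> 3 / 2 * B ^ 4 * z\<^sup>2" if r: "0 < r" "r \<le> q + q'" for r
    proof -
      have "B ^ 4 * z ^ 4 \<le> B ^ 4 * z\<^sup>2" using z4 by (intro mult_left_mono) auto
      moreover have "\<nu> r * z\<^sup>2 \<le> B ^ 4 / 2 * z\<^sup>2"
        using L(4)[OF r z] B4 by (intro mult_right_mono) auto
      moreover have "0 \<le> \<nu> r * z\<^sup>2" using L(3)[OF r z] by simp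
      ultimately show ?thesis using L(2)[OF r z] by (simp add: algebra_simps)
    qed
    have "\<bar>ln (rot_cos \<theta> q z / q) - ln (rot_cos \<theta> q' z / q')\<bar> \<le> 3 * B ^ 4 * z\<^sup>2"
      using l[of q] l[of q'] assms by simp
    also have "\<dots> \<le> D * z\<^sup>2" using D_ge by (intro mult_right_mono) auto
    finally show "\<bar>ln (rot_cos \<theta> q z / q) - ln (rot_cos \<theta> q' z / q')\<bar> \<le> D * z\<^sup>2" .
  qed
  then show ?thesis
    using vertex[of q] vertex[of q'] assms constants_axioms by fastforce
qed

lemma log_cos_asymptotics:
  assumes ba: "badly_approximable c \<theta>"
  shows "\<exists>K \<eta> z0 \<kappa> M n0. 0 < K \<and> 0 < \<eta> \<and> 0 < z0 \<and> 1 \<le> \<kappa> \<and> (\<forall>n\<ge>n0. \<exists>p q p' q'. odd_pair \<theta> p q p' q' \<and>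
     real q \<le> \<kappa> * q' \<and> real q' \<le> \<kappa> * q \<and> q + q' \<le> n \<and> n < M * (q + q') \<and>
     \<bar>rot_sum \<theta> (q - 1)\<bar> \<le> K * (ln q + 1) \<and>
     (\<exists>s. \<eta> * ln q - K \<le> s \<and> s \<le> K * (ln q + 1) \<and>
       (\<forall>z. \<bar>z\<bar> \<le> z0 \<longrightarrow> 0 < rot_cos \<theta> q z \<and> 0 < rot_cos \<theta> q' z \<and>
          \<bar>ln (rot_cos \<theta> q z / q) + s * z\<^sup>2\<bar> \<le> K * z ^ 4 * (ln q + 1) \<and>
          \<bar>ln (rot_cos \<theta> q z / q) - ln (rot_cos \<theta> q' z / q')\<bar> \<le> K * z\<^sup>2)))"
proof -
  have c: "0 < c" using ba by (simp add: badly_approximable_def)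
  define J where "J = nat \<lceil>1 / c + 1\<rceil>"
  define \<kappa> where "\<kappa> = 1 / c + 1"
  have J: "1 / c + 1 \<le> J" unfolding J_def by linarith
  have k1: "1 \<le> \<kappa>" and c_le: "1 / c \<le> \<kappa>" using c by (auto simp: \<kappa>_def)
  obtain p q p' q' where pair: "odd_pair \<theta> p q p' q'" using odd_pair_exists[OF ba] by blast
  then have "0 < q" "0 < q'" by (auto simp: odd_pair_def farey_pair_def)
  from constants_exist[OF k1 this] obtain C D E \<eta> z0 where
    const: "constants J \<kappa> C D E \<eta> z0" "constants.vertex E \<eta> z0 q (rot_cos \<theta> q) (rot_sum \<theta> (q - 1))"
    "constants.vertex E \<eta> z0 q' (rot_cos \<theta> q') (rot_sum \<theta> (q' - 1))"
    "constants.close D z0 q (rot_cos \<theta> q) q' (rot_cos \<theta> q')" by blast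
  interpret constants J \<kappa> C D E \<eta> z0 by fact
  have start: "good \<theta> (p, q, p', q')" using pair const by (simp add: good_def)
  define g where "g = (\<lambda>(p::int, q::nat, p'::int, q'::nat). q + q')"
  have step: "\<exists>b. good \<theta> b \<and> g a < g b \<and> g b \<le> (2 * J + 1) * g a" if "good \<theta> a" for a
  proof -
    obtain p q p' q' where a: "a = (p, q, p', q')" by (cases a)
    from good_step[OF ba c_le J that[unfolded a]] show ?thesis
      unfolding a g_def by fastforce
  qed
  have main: "\<exists>p q p' q'. odd_pair \<theta> p q p' q' \<and>
     real q \<le> \<kappa> * q' \<and> real q' \<le> \<kappa> * q \<and> q + q' \<le> n \<and> n < (2 * J + 1) * (q + q') \<and>
     \<bar>rot_sum \<theta> (q - 1)\<bar> \<le> (D + E) * (ln q + 1) \<and>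
     (\<exists>s. \<eta> * ln q - (D + E) \<le> s \<and> s \<le> (D + E) * (ln q + 1) \<and>
       (\<forall>z. \<bar>z\<bar> \<le> z0 \<longrightarrow> 0 < rot_cos \<theta> q z \<and> 0 < rot_cos \<theta> q' z \<and>
          \<bar>ln (rot_cos \<theta> q z / q) + s * z\<^sup>2\<bar> \<le> (D + E) * z ^ 4 * (ln q + 1) \<and>
          \<bar>ln (rot_cos \<theta> q z / q) - ln (rot_cos \<theta> q' z / q')\<bar> \<le> (D + E) * z\<^sup>2))"
    if n: "g (p, q, p', q') \<le> n" for n
  proof -
    from geometric_window[of "good \<theta>", OF start n step]
    obtain a where a0: "good \<theta> a" "g a \<le> n" "n < (2 * J + 1) * g a" by blast
    obtain p q p' q' where a: "a = (p, q, p', q')" by (cases a)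
    have good: "odd_pair \<theta> p q p' q'" "vertex q (rot_cos \<theta> q) (rot_sum \<theta> (q - 1))"
      "vertex q' (rot_cos \<theta> q') (rot_sum \<theta> (q' - 1))" "close q (rot_cos \<theta> q) q' (rot_cos \<theta> q')"
      using a0(1) unfolding a good_def by auto
    have fp: "farey_pair \<theta> p q p' q'" "0 < q" using good by (auto simp: odd_pair_def farey_pair_def)
    have lnq: "0 \<le> ln q + 1" using fp(2) by (simp add: add_nonneg_nonneg)
    have "real q \<le> 1 / c * q'" "real q' \<le> 1 / c * q"
      using farey_pair_ratio[OF ba fp(1)] c by (auto simp: field_simps)
    moreover have "1 / c * q' \<le> \<kappa> * q'" "1 / c * q \<le> \<kappa> * q" using c_le by (intro mult_right_mono; simp)+
    ultimately have ratio: "real q \<le> \<kappa> * q'" "real q' \<le> \<kappa> * q" by linarith+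
    have K: "E * (ln q + 1) \<le> (D + E) * (ln q + 1)" using D_pos lnq by (intro mult_right_mono) auto
    have Kz: "E * z ^ 4 * (ln q + 1) \<le> (D + E) * z ^ 4 * (ln q + 1)" for z :: real
      using D_pos lnq by (intro mult_right_mono) auto
    have Dz: "D * z\<^sup>2 \<le> (D + E) * z\<^sup>2" for z :: real
      using E_pos by (intro mult_right_mono) auto
    obtain s where s: "\<eta> * ln q - E \<le> s" "s \<le> E * (ln q + 1)"
      "\<And>z. \<bar>z\<bar> \<le> z0 \<Longrightarrow> 0 < rot_cos \<theta> q z \<and> \<bar>ln (rot_cos \<theta> q z / q) + s * z\<^sup>2\<bar> \<le> E * z ^ 4 * (ln q + 1)"
      and u: "\<bar>rot_sum \<theta> (q - 1)\<bar> \<le> E * (ln q + 1)"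
      using good(2) unfolding vertex_def by blast
    have s': "\<eta> * ln q - (D + E) \<le> s" "s \<le> (D + E) * (ln q + 1)" "\<bar>rot_sum \<theta> (q - 1)\<bar> \<le> (D + E) * (ln q + 1)"
      using s(1,2) u K D_pos by linarith+
    have "0 < rot_cos \<theta> q z \<and> 0 < rot_cos \<theta> q' z \<and>
          \<bar>ln (rot_cos \<theta> q z / q) + s * z\<^sup>2\<bar> \<le> (D + E) * z ^ 4 * (ln q + 1) \<and>
          \<bar>ln (rot_cos \<theta> q z / q) - ln (rot_cos \<theta> q' z / q')\<bar> \<le> (D + E) * z\<^sup>2" if z: "\<bar>z\<bar> \<le> z0" for z
      using s(3)[OF z] good(3,4) z Kz[of z] Dz[of z] unfolding vertex_def close_def
      by (meson order_trans)
    then show ?thesis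
      using good(1) ratio s' a0(2,3) unfolding a g_def prod.case by blast
  qed
  have "0 < D + E" using D_pos E_pos by simp
  show ?thesis
    by (rule exI[of _ "D + E"], rule exI[of _ \<eta>], rule exI[of _ z0], rule exI[of _ \<kappa>],
        rule exI[of _ "2 * J + 1"], rule exI[of _ "g (p, q, p', q')"])
       (intro conjI allI impI main \<open>0 < D + E\<close> \<eta>(1) z0(1) k1)
qed

section \<open>Cutting the orbit into blocks\<close>

lemma odd_pair_mid_diff:
  assumes ba: "badly_approximable c \<theta>" and op: "odd_pair \<theta> p q p' q'"
  shows "rot_sum \<theta> (q - 1) - rot_sum \<theta> (q' - 1) = 1"
proof (cases "real (q + q') * \<theta> < of_int (p + p')")
  case True
  then interpret left_step \<theta> p p' q q' using op by unfold_locales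
  show ?thesis by (rule rot_sum_mid_diff)
next
  case False
  have "0 < q + q'" using op by (auto simp: odd_pair_def farey_pair_def)
  then have "of_int (p + p') < real (q + q') * \<theta>"
    using False badly_approximable_neq[OF ba, of "q + q'" "p + p'"] by linarith
  then have right: "real (q' + q) * - \<theta> < of_int (- p' + - p)" by (simp add: algebra_simps)
  interpret left_step "- \<theta>" "- p'" "- p" q' q
    using op right by unfold_locales (auto simp: odd_pair_uminus)
  show ?thesis using rot_sum_mid_diff rot_sum_uminus[OF ba] by simp
qed

lemma norm_cis_minus_1_le: "norm (cis x - 1) \<le> \<bar>x\<bar>"
  using iexp_approx1[of x 0] by (simp add: cis_conv_exp)

lemma abs_rot_sign: "\<bar>rot_sign \<theta> j\<bar> = 1"
  by (simp add: rot_sign_def)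

lemma abs_rot_cos_le: "\<bar>rot_cos \<theta> q z\<bar> \<le> q"
proof -
  have "\<bar>rot_cos \<theta> q z\<bar> \<le> (\<Sum>N<q. 1)"
    unfolding rot_cos_def by (intro order_trans[OF sum_abs] sum_mono) auto
  then show ?thesis by simp
qed

text \<open>One frequency \<open>z\<close> is fixed. Blocks of both lengths are treated as having
  the same normalised sum \<open>\<rho>\<close>, at the cost \<open>\<epsilon>\<close>, which
  closeness later supplies as \<open>K * z^2\<close>.\<close>

locale blocks =
  fixes c \<theta> :: real and p p' :: int and q q' :: nat and z \<epsilon> :: real
  assumes ba: "badly_approximable c \<theta>" and op: "odd_pair \<theta> p q p' q'"
    and \<epsilon>: "\<bar>rot_cos \<theta> q' z / q' - rot_cos \<theta> q z / q\<bar> \<le> \<epsilon>"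
begin

definition mid :: real where "mid = rot_sum \<theta> (q - 1)"
definition \<rho> :: real where "\<rho> = rot_cos \<theta> q z / q"

text \<open>The cut times are the visits of the orbit of \<open>\<theta>\<close> to the interval from \<open>q' * \<theta> - p'\<close> to
  \<open>q * \<theta> - p\<close> modulo 1; the return time is \<open>q\<close> or \<open>q'\<close>. Since \<open>p\<close> and \<open>p'\<close> are odd,
  consecutive blocks carry opposite signs, so the sums at the cuts alternate between \<open>0\<close> and
  \<open>mid\<close> up to an error of two per block.\<close>

definition cut :: "nat \<Rightarrow> nat \<Rightarrow> bool" where
  "cut k P \<longleftrightarrow> (\<exists>r::int. q' * \<theta> - p' \<le> P * \<theta> - r \<and> P * \<theta> - r < q * \<theta> - p \<and> (odd r \<longleftrightarrow> odd k)) \<and>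
     \<bar>rot_sum \<theta> P - (if odd k then mid else 0)\<bar> \<le> 2 * real k \<and> k * min q q' \<le> P \<and>
     norm ((\<Sum>N<P. cis (z * (rot_sum \<theta> N - mid / 2))) - of_real (P * \<rho>)) \<le> P * (\<bar>z\<bar> * (2 * real k + 1) + \<epsilon>)"

lemma farey: "farey_pair \<theta> p q p' q'" "odd p" "odd p'" "0 < q" "0 < q'"
  using op by (auto simp: odd_pair_def farey_pair_def)

lemma cut_0: "cut 0 0"
  using farey_pair_pos[OF farey(1)] by (auto simp: cut_def intro!: exI[of _ 0])

text \<open>A block read with sign \<open>\<sigma>\<close> is still symmetric, now about
  \<open>rot_sum \<theta> P + \<sigma> * rot_sum \<theta> (l - 1) / 2\<close>, and cosine does not
  see \<open>\<sigma>\<close>. What remains is a phase, controlled by the distance \<open>d\<close>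
  of this centre from \<open>mid / 2\<close>.\<close>

lemma block_sum:
  assumes l: "l = q \<or> l = q'" and \<sigma>: "\<sigma> = 1 \<or> \<sigma> = - 1"
    and shift: "\<And>i. 0 < i \<Longrightarrow> i < l \<Longrightarrow> rot_sign \<theta> (P + i) = \<sigma> * rot_sign \<theta> i"
    and d: "\<bar>rot_sum \<theta> P + \<sigma> * rot_sum \<theta> (l - 1) / 2 - mid / 2\<bar> \<le> d"
  shows "norm ((\<Sum>i<l. cis (z * (rot_sum \<theta> (P + i) - mid / 2))) - of_real (l * \<rho>)) \<le> l * (\<bar>z\<bar> * d + \<epsilon>)"
proof -
  define w where "w = rot_sum \<theta> P + \<sigma> * rot_sum \<theta> (l - 1) / 2 - mid / 2"
  have l0: "0 < l" using l farey by auto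
  have "(\<Sum>i<l. cis (z * (rot_sum \<theta> (P + i) - mid / 2)))
      = cis (z * w) * (\<Sum>i<l. cis ((z * \<sigma>) * (rot_sum \<theta> i - rot_sum \<theta> (l - 1) / 2)))"
    unfolding sum_distrib_left cis_mult
  proof (intro sum.cong arg_cong[where f = cis] refl)
    fix i assume "i \<in> {..<l}"
    then have "rot_sum \<theta> (P + i) = rot_sum \<theta> P + \<sigma> * rot_sum \<theta> i"
      by (intro rot_sum_add_eq shift) auto
    then show "z * (rot_sum \<theta> (P + i) - mid / 2) = z * w + z * \<sigma> * (rot_sum \<theta> i - rot_sum \<theta> (l - 1) / 2)"
      by (simp add: w_def algebra_simps)
  qed
  also have "(\<Sum>i<l. cis ((z * \<sigma>) * (rot_sum \<theta> i - rot_sum \<theta> (l - 1) / 2)))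
      = of_real (\<Sum>i<l. cos ((z * \<sigma>) * (rot_sum \<theta> i - rot_sum \<theta> (l - 1) / 2)))"
    using odd_pair_rot_sum_reflect[OF op] l by (intro sum_cis_symmetric) auto
  also have "(\<Sum>i<l. cos ((z * \<sigma>) * (rot_sum \<theta> i - rot_sum \<theta> (l - 1) / 2))) = rot_cos \<theta> l z"
    using \<sigma> by (auto simp: rot_cos_def)
  finally have s: "(\<Sum>i<l. cis (z * (rot_sum \<theta> (P + i) - mid / 2))) = cis (z * w) * of_real (rot_cos \<theta> l z)" .
  have "0 \<le> \<epsilon>" using \<epsilon> by linarith
  then have e: "\<bar>rot_cos \<theta> l z / l - \<rho>\<bar> \<le> \<epsilon>" using l \<epsilon> by (auto simp: \<rho>_def)
  have "rot_cos \<theta> l z - l * \<rho> = l * (rot_cos \<theta> l z / l - \<rho>)"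
    using l0 by (simp add: right_diff_distrib)
  then have "\<bar>rot_cos \<theta> l z - l * \<rho>\<bar> = l * \<bar>rot_cos \<theta> l z / l - \<rho>\<bar>"
    by (simp only: abs_mult abs_of_nat)
  also have "\<dots> \<le> l * \<epsilon>" using e by (intro mult_left_mono) auto
  finally have e': "\<bar>rot_cos \<theta> l z - l * \<rho>\<bar> \<le> l * \<epsilon>" .
  have "norm ((cis (z * w) - 1) * of_real (rot_cos \<theta> l z)) \<le> \<bar>z * w\<bar> * l"
    unfolding norm_mult using norm_cis_minus_1_le abs_rot_cos_le by (intro mult_mono) auto
  also have "\<dots> \<le> (\<bar>z\<bar> * d) * l"
    unfolding abs_mult using d by (intro mult_right_mono mult_left_mono) (auto simp: w_def)
  finally have c: "norm ((cis (z * w) - 1) * of_real (rot_cos \<theta> l z)) \<le> (\<bar>z\<bar> * d) * l" .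
  have "cis (z * w) * of_real (rot_cos \<theta> l z) - of_real (l * \<rho>)
      = (cis (z * w) - 1) * of_real (rot_cos \<theta> l z) + of_real (rot_cos \<theta> l z - l * \<rho>)"
    by (simp add: algebra_simps)
  also have "norm \<dots> \<le> (\<bar>z\<bar> * d) * l + l * \<epsilon>"
    using c e' by (intro order_trans[OF norm_triangle_ineq] add_mono) (simp_all only: norm_of_real)
  finally show ?thesis unfolding s by (simp add: algebra_simps)
qed

text \<open>A block with sign \<open>1\<close> leads from near \<open>0\<close> to near
  \<open>mid\<close>, the next one, with sign \<open>- 1\<close>, leads back, so both are centred
  near \<open>mid / 2\<close>. The possible gap \<open>1\<close> between
  \<open>rot_sum \<theta> (l - 1)\<close> and \<open>mid\<close> and the sign at the end of the
  block make up the loss of two.\<close>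

lemma cut_Suc:
  assumes "cut k P"
  shows "\<exists>P'. cut (Suc k) P' \<and> P < P' \<and> P' \<le> P + (q + q')"
proof -
  obtain r :: int where r: "q' * \<theta> - p' \<le> P * \<theta> - r" "P * \<theta> - r < q * \<theta> - p" "odd r \<longleftrightarrow> odd k"
    using assms unfolding cut_def by blast
  have T: "\<bar>rot_sum \<theta> P - (if odd k then mid else 0)\<bar> \<le> 2 * real k" and kP: "k * min q q' \<le> P"
    and S: "norm ((\<Sum>N<P. cis (z * (rot_sum \<theta> N - mid / 2))) - of_real (P * \<rho>)) \<le> P * (\<bar>z\<bar> * (2 * real k + 1) + \<epsilon>)"
    using assms unfolding cut_def by blast+
  define \<sigma> :: real where "\<sigma> = (if odd k then - 1 else 1)"
  \<comment> \<open>The exchange of two intervals: a point left of 0 moves right by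
    \<open>q * \<theta> - p\<close>, any other moves left by \<open>p' - q' * \<theta>\<close>, and
    both stay inside.\<close>
  define l where "l = (if P * \<theta> - r < 0 then q else q')"
  define a where "a = (if P * \<theta> - r < 0 then p else p')"
  have l: "l = q \<or> l = q'" "0 < l" "min q q' \<le> l" "l \<le> q + q'" using farey by (auto simp: l_def)
  have shift: "rot_sign \<theta> (P + i) = \<sigma> * rot_sign \<theta> i" if "0 < i" "i < l" for i
    using rot_sign_shift[OF farey(1) that(1), of P r "P * \<theta> - r"] r that
    by (auto simp: \<sigma>_def l_def split: if_splits)
  have u: "rot_sum \<theta> (l - 1) = mid \<or> rot_sum \<theta> (l - 1) = mid - 1"
    using odd_pair_mid_diff[OF ba op] l(1) unfolding mid_def by (auto simp: algebra_simps)
  have ex: "\<exists>r'::int. q' * \<theta> - p' \<le> (P + l) * \<theta> - r' \<and> (P + l) * \<theta> - r' < q * \<theta> - p \<and> (odd r' \<longleftrightarrow> odd (Suc k))"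
    using r farey farey_pair_pos(1,2)[OF farey(1)] by (intro exI[of _ "r + a"]) (auto simp: l_def a_def algebra_simps)
  have "rot_sum \<theta> (P + (l - 1)) = rot_sum \<theta> P + \<sigma> * rot_sum \<theta> (l - 1)"
    by (rule rot_sum_add_eq, rule shift) (use l in auto)
  then have "rot_sum \<theta> (P + l) = rot_sum \<theta> P + \<sigma> * rot_sum \<theta> (l - 1) + rot_sign \<theta> (P + l)"
    using rot_sum_pred[of "P + l" \<theta>] l by simp
  then have T': "\<bar>rot_sum \<theta> (P + l) - (if odd (Suc k) then mid else 0)\<bar> \<le> 2 * real (Suc k)"
    using T u abs_rot_sign[of \<theta> "P + l"] by (auto simp: \<sigma>_def split: if_splits)
  have d: "\<bar>rot_sum \<theta> P + \<sigma> * rot_sum \<theta> (l - 1) / 2 - mid / 2\<bar> \<le> 2 * real k + 1"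
    using T u by (auto simp: \<sigma>_def field_simps split: if_splits)
  have "(\<Sum>N<P + l. cis (z * (rot_sum \<theta> N - mid / 2))) - of_real ((P + l) * \<rho>)
      = ((\<Sum>N<P. cis (z * (rot_sum \<theta> N - mid / 2))) - of_real (P * \<rho>)) +
        ((\<Sum>i<l. cis (z * (rot_sum \<theta> (P + i) - mid / 2))) - of_real (l * \<rho>))"
    using sum.atLeastLessThan_concat[of 0 P "P + l" "\<lambda>N. cis (z * (rot_sum \<theta> N - mid / 2))"]
      sum.shift_bounds_nat_ivl[of "\<lambda>N. cis (z * (rot_sum \<theta> N - mid / 2))" 0 P l]
    by (simp add: atLeast0LessThan add.commute[of l] add.commute[of _ P] distrib_right)
  also have "norm \<dots> \<le> P * (\<bar>z\<bar> * (2 * real k + 1) + \<epsilon>) + l * (\<bar>z\<bar> * (2 * real k + 1) + \<epsilon>)"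
    using S block_sum[OF l(1) _ shift d] by (intro order_trans[OF norm_triangle_ineq] add_mono) (auto simp: \<sigma>_def)
  also have "\<dots> = real (P + l) * (\<bar>z\<bar> * (2 * real k + 1) + \<epsilon>)" by (simp add: algebra_simps)
  also have "\<dots> \<le> real (P + l) * (\<bar>z\<bar> * (2 * real (Suc k) + 1) + \<epsilon>)"
    by (intro mult_left_mono add_right_mono) auto
  finally have S': "norm ((\<Sum>N<P + l. cis (z * (rot_sum \<theta> N - mid / 2))) - of_real ((P + l) * \<rho>))
      \<le> real (P + l) * (\<bar>z\<bar> * (2 * real (Suc k) + 1) + \<epsilon>)" .
  have "Suc k * min q q' \<le> P + l" using kP l(3) by simp
  then have "cut (Suc k) (P + l)" unfolding cut_def using ex T' S' by simp
  then show ?thesis using l by (intro exI[of _ "P + l"]) auto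
qed

text \<open>Stop at the last cut not after \<open>n\<close>. At most \<open>q + q'\<close> terms are
  left, counted once in the sum and once in \<open>n * \<rho>\<close>; and since no block is shorter
  than \<open>min q q'\<close>, there are at most \<open>(1 + \<kappa>) * n / (q + q')\<close>
  blocks.\<close>

lemma mean_cis:
  fixes \<kappa> :: real
  assumes n: "0 < n" and ratio: "real q \<le> \<kappa> * q'" "real q' \<le> \<kappa> * q" "1 \<le> \<kappa>"
  shows "norm ((\<Sum>N<n. cis (z * (rot_sum \<theta> N - mid / 2))) / n - of_real \<rho>)
    \<le> \<bar>z\<bar> * (2 * (1 + \<kappa>) * (n / (q + q')) + 1) + \<epsilon> + 2 * (q + q') / n"
proof -
  define S where "S = {k. \<exists>P\<le>n. cut k P}"
  have min1: "1 \<le> min q q'" using farey by auto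
  have "k \<le> n" if k: "k \<in> S" for k
  proof -
    obtain P where "P \<le> n" "cut k P" using k unfolding S_def by blast
    then have "P \<le> n" "k * min q q' \<le> P" unfolding cut_def by blast+
    moreover have "k * 1 \<le> k * min q q'" using min1 by (rule mult_le_mono2)
    ultimately show ?thesis by linarith
  qed
  then have fin: "finite S" by (meson finite_nat_set_iff_bounded_le)
  have "0 \<in> S" using cut_0 by (auto simp: S_def)
  then have "Max S \<in> S" using fin by (intro Max_in) auto
  then obtain P where P: "P \<le> n" "cut (Max S) P" by (auto simp: S_def)
  define k where "k = Max S"
  obtain P' where P': "cut (Suc k) P'" "P' \<le> P + (q + q')" using cut_Suc[OF P(2)] unfolding k_def by blast
  have "Suc k \<notin> S" using Max_ge[OF fin, of "Suc k"] unfolding k_def by linarith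
  then have "\<not> P' \<le> n" using P'(1) by (auto simp: S_def)
  then have nP: "n \<le> P + (q + q')" using P' by linarith
  have cut: "k * min q q' \<le> P"
    "norm ((\<Sum>N<P. cis (z * (rot_sum \<theta> N - mid / 2))) - of_real (P * \<rho>)) \<le> P * (\<bar>z\<bar> * (2 * real k + 1) + \<epsilon>)"
    using P(2) unfolding cut_def k_def by auto
  have qq: "0 < real (q + q')" using farey by simp
  have kn: "real k \<le> (1 + \<kappa>) * (n / (q + q'))"
  proof -
    have "real (q + q') \<le> (1 + \<kappa>) * real (min q q')" using ratio by (auto simp: min_def algebra_simps)
    then have "real k * (q + q') \<le> real k * ((1 + \<kappa>) * real (min q q'))" by (intro mult_left_mono) auto
    also have "\<dots> = (1 + \<kappa>) * real (k * min q q')" by simp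
    finally have *: "real k * real (q + q') \<le> (1 + \<kappa>) * real (k * min q q')" .
    have "real (k * min q q') \<le> real n" using cut(1) P(1) by (simp only: of_nat_le_iff)
    then have "(1 + \<kappa>) * real (k * min q q') \<le> (1 + \<kappa>) * n" using ratio by (intro mult_left_mono) auto
    with * have "real k * real (q + q') \<le> (1 + \<kappa>) * n" by linarith
    then show ?thesis using qq by (simp add: pos_le_divide_eq)
  qed
  define e where "e = real (n - P)"
  have e: "e = real n - real P" "0 \<le> e" using P by (auto simp: e_def of_nat_diff)
  define f where "f N = cis (z * (rot_sum \<theta> N - mid / 2))" for N
  have \<epsilon>0: "0 \<le> \<epsilon>" using \<epsilon> by linarith
  have "\<bar>\<rho>\<bar> \<le> 1" using abs_rot_cos_le[of \<theta> q z] farey by (simp add: \<rho>_def field_simps)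
  then have \<rho>n: "norm (of_real (e * \<rho>) :: complex) \<le> e * 1"
    unfolding norm_of_real abs_mult using e by (intro mult_mono) auto
  have "(\<Sum>N<n. f N) = (\<Sum>N<P. f N) + (\<Sum>N=P..<n. f N)"
    using sum.atLeastLessThan_concat[of 0 P n f] P by (simp add: atLeast0LessThan)
  moreover have "of_real (n * \<rho>) = of_real (P * \<rho>) + (of_real (e * \<rho>) :: complex)"
    by (simp add: e algebra_simps)
  ultimately have "(\<Sum>N<n. f N) - of_real (n * \<rho>)
      = ((\<Sum>N<P. f N) - of_real (P * \<rho>)) + ((\<Sum>N=P..<n. f N) - of_real (e * \<rho>))"
    by simp
  also have "norm \<dots> \<le> norm ((\<Sum>N<P. f N) - of_real (P * \<rho>)) +
      (norm (\<Sum>N=P..<n. f N) + norm (of_real (e * \<rho>) :: complex))"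
    by (intro order_trans[OF norm_triangle_ineq] add_left_mono norm_triangle_ineq4)
  finally have split: "norm ((\<Sum>N<n. f N) - of_real (n * \<rho>)) \<le> norm ((\<Sum>N<P. f N) - of_real (P * \<rho>)) +
      (norm (\<Sum>N=P..<n. f N) + norm (of_real (e * \<rho>) :: complex))" .
  have "norm (\<Sum>N=P..<n. f N) \<le> (\<Sum>N=P..<n. 1)"
    by (intro order_trans[OF norm_sum] sum_mono) (auto simp: f_def)
  then have tail: "norm (\<Sum>N=P..<n. f N) \<le> e" by (simp add: e_def)
  have eq: "e \<le> real (q + q')" unfolding e_def using nP by simp
  have main: "P * (\<bar>z\<bar> * (2 * real k + 1) + \<epsilon>) \<le> n * (\<bar>z\<bar> * (2 * (1 + \<kappa>) * (n / (q + q')) + 1) + \<epsilon>)"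
  proof (rule mult_mono)
    have "2 * real k \<le> 2 * (1 + \<kappa>) * (n / (q + q'))"
      using mult_left_mono[OF kn, of 2] unfolding mult.assoc by simp
    then show "\<bar>z\<bar> * (2 * real k + 1) + \<epsilon> \<le> \<bar>z\<bar> * (2 * (1 + \<kappa>) * (n / (q + q')) + 1) + \<epsilon>"
      by (intro add_right_mono mult_left_mono) auto
    show "0 \<le> \<bar>z\<bar> * (2 * real k + 1) + \<epsilon>" using \<epsilon>0 by simp
  qed (use P(1) in auto)
  have arith: "N \<le> Y + 2 * r" if "N \<le> A + (B + C)" "A \<le> X" "X \<le> Y" "B \<le> e" "C \<le> e * 1" "e \<le> r"
    for N A B C X Y r :: real using that by linarith
  have b: "norm ((\<Sum>N<n. f N) - of_real (n * \<rho>))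
     \<le> n * (\<bar>z\<bar> * (2 * (1 + \<kappa>) * (n / (q + q')) + 1) + \<epsilon>) + 2 * real (q + q')"
    by (rule arith[OF split cut(2)[folded f_def] main tail \<rho>n eq])
  have "(\<Sum>N<n. f N) / n - of_real \<rho> = ((\<Sum>N<n. f N) - of_real (n * \<rho>)) / n"
    using n by (simp add: field_simps)
  also have "norm \<dots> = norm ((\<Sum>N<n. f N) - of_real (n * \<rho>)) / n"
    by (simp add: norm_divide)
  also have "\<dots> \<le> (n * (\<bar>z\<bar> * (2 * (1 + \<kappa>) * (n / (q + q')) + 1) + \<epsilon>) + 2 * real (q + q')) / n"
    using b n by (intro divide_right_mono) auto
  also have "\<dots> = \<bar>z\<bar> * (2 * (1 + \<kappa>) * (n / (q + q')) + 1) + \<epsilon> + 2 * (q + q') / n"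
    using n by (simp add: add_divide_distrib)
  finally show ?thesis unfolding f_def .
qed

end

section \<open>Passage to the normal law\<close>

lemma measure_std_normal_interval:
  fixes a b :: real
  shows "measure std_normal_distribution {a..b} = 1 / sqrt (2 * pi) * integral {a..b} (\<lambda>t. exp (- t\<^sup>2 / 2))"
proof -
  have int: "set_integrable lborel {a..b} std_normal_density"
    unfolding set_integrable_def
    by (rule integrable_mult_indicator) (auto simp: integrable_normal_density)
  have "measure std_normal_distribution {a..b} = integral\<^sup>L std_normal_distribution (indicator {a..b})"
    by simp
  also have "\<dots> = (LINT x|lborel. std_normal_density x *\<^sub>R indicator {a..b} x)"
    by (rule integral_density) auto
  also have "\<dots> = (LINT x:{a..b}|lborel. std_normal_density x)"
    by (simp add: set_lebesgue_integral_def mult.commute)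
  also have "\<dots> = integral {a..b} std_normal_density"
    by (rule set_borel_integral_eq_integral(2)[OF int])
  also have "\<dots> = integral {a..b} (\<lambda>t. 1 / sqrt (2 * pi) * exp (- t\<^sup>2 / 2))"
    by (simp add: std_normal_density_def[abs_def])
  finally show ?thesis by simp
qed

lemma interval_frequency_tendsto_normal:
  fixes X :: "nat \<Rightarrow> nat \<Rightarrow> real"
  assumes "\<And>t. (\<lambda>n. (\<Sum>N=1..n. cis (t * X n N)) / n) \<longlonglongrightarrow> of_real (exp (- t\<^sup>2 / 2))"
    and "a < b"
  shows "(\<lambda>n. real (card {N. 1 \<le> N \<and> N \<le> n \<and> X n N \<in> {a..b}}) / real n)
    \<longlonglongrightarrow> 1 / sqrt (2 * pi) * integral {a..b} (\<lambda>t. exp (- t\<^sup>2 / 2))"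
proof -
  \<comment> \<open>The index shift makes every set nonempty, so that the uniform distribution on it
    exists.\<close>
  define S where "S n = {1..Suc n}" for n :: nat
  have S: "finite (S n)" "S n \<noteq> {}" "card (S n) = Suc n" for n by (auto simp: S_def)
  define M where "M n = distr (measure_pmf (pmf_of_set (S n))) borel (X (Suc n))" for n
  have dist: "real_distribution (M n)" for n
    unfolding M_def by (rule prob_space.real_distribution_distr[OF prob_space_measure_pmf]) simp
  have char: "char (M n) t = (\<Sum>N=1..Suc n. cis (t * X (Suc n) N)) / of_nat (Suc n)" for n t
  proof -
    have "char (M n) t = (CLINT N|measure_pmf (pmf_of_set (S n)). iexp (t * X (Suc n) N))"
      by (simp add: char_def M_def integral_distr)
    also have "\<dots> = (\<Sum>N\<in>S n. pmf (pmf_of_set (S n)) N *\<^sub>R iexp (t * X (Suc n) N))"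
      using S by (intro integral_measure_pmf[of "S n"]) auto
    also have "\<dots> = (\<Sum>N\<in>S n. cis (t * X (Suc n) N) / of_nat (Suc n))"
      using S by (intro sum.cong) (auto simp: cis_conv_exp scaleR_conv_of_real)
    finally show ?thesis by (simp only: S_def sum_divide_distrib)
  qed
  have "weak_conv_m M std_normal_distribution"
  proof (rule levy_continuity[OF dist real_dist_normal_dist])
    fix t
    show "(\<lambda>n. char (M n) t) \<longlonglongrightarrow> char std_normal_distribution t"
      unfolding char char_std_normal_distribution using LIMSEQ_Suc[OF assms(1)[of t]] by simp
  qed
  \<comment> \<open>The limit law has no atoms at the endpoints, so weak convergence passes to the
    closed interval.\<close>
  moreover have "emeasure std_normal_distribution (frontier {a..b}) = 0"
  proof -
    have "frontier {a..b} = {a, b}" using assms(2) by (auto simp: frontier_def)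
    moreover have "AE x in lborel. x \<notin> {a, b}" by (intro AE_not_in finite_imp_null_set_lborel) simp
    then have "AE x in lborel. x \<in> {a, b} \<longrightarrow> ennreal (std_normal_density x) = 0"
      by eventually_elim simp
    then have "{a, b} \<in> null_sets std_normal_distribution"
      by (subst null_sets_density_iff) auto
    ultimately show ?thesis by auto
  qed
  ultimately have "(\<lambda>n. measure (M n) {a..b}) \<longlonglongrightarrow> measure std_normal_distribution {a..b}"
    using weak_conv_imp_continuity_set_conv[of M std_normal_distribution "{a..b}"] dist real_dist_normal_dist by auto
  moreover have "measure (M n) {a..b} = real (card {N. 1 \<le> N \<and> N \<le> Suc n \<and> X (Suc n) N \<in> {a..b}}) / real (Suc n)" for n
  proof -
    have "measure (M n) {a..b} = measure (measure_pmf (pmf_of_set (S n))) (X (Suc n) -` {a..b})"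
      unfolding M_def by (subst measure_distr) auto
    also have "\<dots> = card (S n \<inter> X (Suc n) -` {a..b}) / card (S n)"
      using S by (intro measure_pmf_of_set) auto
    also have "S n \<inter> X (Suc n) -` {a..b} = {N. 1 \<le> N \<and> N \<le> Suc n \<and> X (Suc n) N \<in> {a..b}}"
      by (auto simp: S_def)
    finally show ?thesis by (simp add: S)
  qed
  ultimately show ?thesis
    unfolding measure_std_normal_interval by (subst filterlim_sequentially_Suc[symmetric]) simp
qed

text \<open>\<open>frac x < 1 / 2\<close> exactly when \<open>\<lfloor>2 * x\<rfloor>\<close> is
  even, so counting minus half the length is half the sum of the signs. The summand 1 is the sign at
  \<open>j = 0\<close>, which \<open>rot_sum\<close> omits.\<close>

lemma discrepancy_eq_rot_sum:
  "discrepancy \<alpha> (Suc N) = (rot_sum (2 * \<alpha>) N + 1) / 2"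
proof -
  define r where "r j = (if frac (real j * \<alpha>) < 1 / 2 then 1 else - 1 :: real)" for j :: nat
  have sign: "rot_sign (2 * \<alpha>) j = r j" for j
  proof -
    define x where "x = real j * \<alpha>"
    have x: "x = of_int \<lfloor>x\<rfloor> + frac x" "0 \<le> frac x" "frac x < 1" by (auto simp: frac_def frac_lt_1) linarith+
    show ?thesis
    proof (cases "frac x < 1 / 2")
      case True
      then have "\<lfloor>2 * x\<rfloor> = 2 * \<lfloor>x\<rfloor>" using x by (intro floor_unique) auto
      then show ?thesis using True by (simp add: rot_sign_def r_def x_def mult.left_commute)
    next
      case False
      then have "\<lfloor>2 * x\<rfloor> = 2 * \<lfloor>x\<rfloor> + 1" using x by (intro floor_unique) auto
      then show ?thesis using False by (simp add: rot_sign_def r_def x_def mult.left_commute)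
    qed
  qed
  have d: "discrepancy \<alpha> n = (\<Sum>j<n. r j) / 2" for n
  proof -
    have "real (card {j. j < n \<and> frac (real j * \<alpha>) \<in> {0..<1/2}}) = (\<Sum>j\<in>{j\<in>{..<n}. frac (real j * \<alpha>) < 1 / 2}. 1)"
      by (auto intro!: arg_cong[where f = card])
    also have "\<dots> = (\<Sum>j<n. if frac (real j * \<alpha>) < 1 / 2 then 1 else 0)"
      by (rule sum.inter_filter) simp
    also have "\<dots> = (\<Sum>j<n. (r j + 1) / 2)" by (intro sum.cong) (auto simp: r_def)
    finally show ?thesis
      by (simp add: discrepancy_def add_divide_distrib sum.distrib sum_divide_distrib)
  qed
  have "(\<Sum>j<Suc N. r j) = 1 + (\<Sum>j=1..N. r j)"
    using sum.lessThan_Suc_shift[of r N] sum.atLeast1_atMost_eq[of r N] by (simp add: r_def[of 0])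
  then show ?thesis unfolding d rot_sum_def sign by simp
qed

text \<open>On the interval from 0 to 1 the slope of \<open>ln\<close> is at least 1.\<close>

lemma abs_diff_le_abs_ln_diff:
  fixes x y :: real
  assumes "0 < x" "x \<le> 1" "0 < y" "y \<le> 1"
  shows "\<bar>x - y\<bar> \<le> \<bar>ln x - ln y\<bar>"
proof -
  have *: "x - y \<le> ln x - ln y" if "0 < y" "y \<le> x" "x \<le> 1" for x y :: real
  proof -
    have "ln (y / x) \<le> y / x - 1" using that by (intro ln_le_minus_one) auto
    then have "1 - y / x \<le> ln x - ln y" using that by (simp add: ln_div)
    moreover have "x * (1 - y / x) \<le> 1 * (1 - y / x)" using that by (intro mult_right_mono) auto
    ultimately show ?thesis using that by (simp add: right_diff_distrib)
  qed
  show ?thesis using *[of x y] *[of y x] assms by linarith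
qed

text \<open>Here \<open>\<omega>\<close> prescribes the number of blocks up to constants: the pair
  is chosen at scale \<open>n / \<omega>\<close>, and only its denominator \<open>Q\<close>, the
  last sum \<open>u\<close> and the coefficient \<open>s\<close> are passed on.\<close>

lemma mean_cis_approximation:
  assumes ba: "badly_approximable c \<theta>"
  shows "\<exists>K \<eta> z0 W n0. 0 < K \<and> 0 < \<eta> \<and> 0 < z0 \<and> 0 < W \<and> (\<forall>n::nat. \<forall>\<omega>::real. 1 \<le> \<omega> \<longrightarrow> real n0 \<le> n / \<omega> \<longrightarrow>
     (\<exists>u s Q. 0 < Q \<and> n / (W * \<omega>) \<le> Q \<and> Q \<le> n \<and> \<bar>u\<bar> \<le> K * (ln Q + 1) \<and>
       \<eta> * ln Q - K \<le> s \<and> s \<le> K * (ln Q + 1) \<and>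
       (\<forall>z. \<bar>z\<bar> \<le> z0 \<longrightarrow> (\<exists>\<rho>>0. \<bar>ln \<rho> + s * z\<^sup>2\<bar> \<le> K * z ^ 4 * (ln Q + 1) \<and>
          norm ((\<Sum>N<n. cis (z * (rot_sum \<theta> N - u / 2))) / n - of_real \<rho>)
            \<le> \<bar>z\<bar> * (W * \<omega> + 1) + K * z\<^sup>2 + 2 / \<omega>))))"
proof -
  obtain K \<eta> z0 \<kappa> :: real and M n0 :: nat where c: "0 < K" "0 < \<eta>" "0 < z0" "1 \<le> \<kappa>"
    and *: "\<And>n. n0 \<le> n \<Longrightarrow> \<exists>p q p' q'. odd_pair \<theta> p q p' q' \<and>
     real q \<le> \<kappa> * q' \<and> real q' \<le> \<kappa> * q \<and> q + q' \<le> n \<and> n < M * (q + q') \<and>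
     \<bar>rot_sum \<theta> (q - 1)\<bar> \<le> K * (ln q + 1) \<and>
     (\<exists>s. \<eta> * ln q - K \<le> s \<and> s \<le> K * (ln q + 1) \<and>
       (\<forall>z. \<bar>z\<bar> \<le> z0 \<longrightarrow> 0 < rot_cos \<theta> q z \<and> 0 < rot_cos \<theta> q' z \<and>
          \<bar>ln (rot_cos \<theta> q z / q) + s * z\<^sup>2\<bar> \<le> K * z ^ 4 * (ln q + 1) \<and>
          \<bar>ln (rot_cos \<theta> q z / q) - ln (rot_cos \<theta> q' z / q')\<bar> \<le> K * z\<^sup>2))"
    using log_cos_asymptotics[OF ba] by blast
  \<comment> \<open>Chosen for both \<open>n / (W * \<omega>) \<le> q\<close> and
    \<open>2 * (1 + \<kappa>) * (n / (q + q')) \<le> W * \<omega>\<close>; a factor 2 is due to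
    rounding \<open>n / \<omega>\<close> down to \<open>m\<close>.\<close>
  define W where "W = 4 * (real M + 1) * (1 + \<kappa>)"
  have W: "0 < W" using c by (simp add: W_def)
  have "\<exists>u s Q. 0 < Q \<and> n / (W * \<omega>) \<le> Q \<and> Q \<le> n \<and> \<bar>u\<bar> \<le> K * (ln Q + 1) \<and>
       \<eta> * ln Q - K \<le> s \<and> s \<le> K * (ln Q + 1) \<and>
       (\<forall>z. \<bar>z\<bar> \<le> z0 \<longrightarrow> (\<exists>\<rho>>0. \<bar>ln \<rho> + s * z\<^sup>2\<bar> \<le> K * z ^ 4 * (ln Q + 1) \<and>
          norm ((\<Sum>N<n. cis (z * (rot_sum \<theta> N - u / 2))) / n - of_real \<rho>)
            \<le> \<bar>z\<bar> * (W * \<omega> + 1) + K * z\<^sup>2 + 2 / \<omega>))"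
    if \<omega>: "1 \<le> \<omega>" and n: "real (n0 + 2) \<le> n / \<omega>" for n :: nat and \<omega> :: real
  proof -
    define m where "m = nat \<lfloor>n / \<omega>\<rfloor>"
    have m: "real m \<le> n / \<omega>" "n / \<omega> < real m + 1" "n0 \<le> m" "1 \<le> m" using n unfolding m_def by linarith+
    have n_pos: "0 < n" using n \<omega> by (cases n) auto
    have m2: "n / \<omega> \<le> 2 * real m" using m by linarith
    obtain p q p' q' where pq: "odd_pair \<theta> p q p' q'"
       "real q \<le> \<kappa> * q'" "real q' \<le> \<kappa> * q" "q + q' \<le> m" "m < M * (q + q')"
       "\<bar>rot_sum \<theta> (q - 1)\<bar> \<le> K * (ln q + 1)"
       and "\<exists>s. \<eta> * ln q - K \<le> s \<and> s \<le> K * (ln q + 1) \<and>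
         (\<forall>z. \<bar>z\<bar> \<le> z0 \<longrightarrow> 0 < rot_cos \<theta> q z \<and> 0 < rot_cos \<theta> q' z \<and>
          \<bar>ln (rot_cos \<theta> q z / q) + s * z\<^sup>2\<bar> \<le> K * z ^ 4 * (ln q + 1) \<and>
          \<bar>ln (rot_cos \<theta> q z / q) - ln (rot_cos \<theta> q' z / q')\<bar> \<le> K * z\<^sup>2)"
      using *[OF m(3)] by blast
    then obtain s where s: "\<eta> * ln q - K \<le> s" "s \<le> K * (ln q + 1)"
      "\<And>z. \<bar>z\<bar> \<le> z0 \<Longrightarrow> 0 < rot_cos \<theta> q z \<and> 0 < rot_cos \<theta> q' z \<and>
          \<bar>ln (rot_cos \<theta> q z / q) + s * z\<^sup>2\<bar> \<le> K * z ^ 4 * (ln q + 1) \<and>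
          \<bar>ln (rot_cos \<theta> q z / q) - ln (rot_cos \<theta> q' z / q')\<bar> \<le> K * z\<^sup>2"
      by blast
    have q: "0 < q" "0 < q'" using pq(1) by (auto simp: odd_pair_def farey_pair_def)
    have qq: "0 < real (q + q')" using q by simp
    have "real m \<le> real M * real (q + q')" using pq(5) by (metis less_imp_le of_nat_le_iff of_nat_mult)
    then have nM: "n / \<omega> \<le> 2 * (real M + 1) * real (q + q')" using m2 qq by (simp add: algebra_simps)
    then have n\<omega>: "real n \<le> 2 * (real M + 1) * real (q + q') * \<omega>" using \<omega> by (simp add: pos_divide_le_eq)
    have lower: "n / (W * \<omega>) \<le> real q"
    proof -
      have "real (q + q') \<le> (1 + \<kappa>) * q" using pq by (simp add: algebra_simps)
      then have "2 * (real M + 1) * real (q + q') * \<omega> \<le> 2 * (real M + 1) * ((1 + \<kappa>) * q) * \<omega>"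
        using \<omega> by (intro mult_right_mono mult_left_mono) auto
      also have "\<dots> \<le> real q * (W * \<omega>)" using \<omega> c by (simp add: W_def algebra_simps)
      finally have "real n \<le> real q * (W * \<omega>)" using n\<omega> by linarith
      moreover have "0 < W * \<omega>" using W \<omega> by simp
      ultimately show ?thesis by (simp only: pos_divide_le_eq)
    qed
    have upper: "real (q + q') \<le> n / \<omega>" using pq(4) m(1) by linarith
    have "n / \<omega> \<le> n" using \<omega> by (simp add: pos_divide_le_eq mult_le_cancel_left1)
    then have qn: "real q \<le> n" using upper by simp
    have "\<exists>\<rho>>0. \<bar>ln \<rho> + s * z\<^sup>2\<bar> \<le> K * z ^ 4 * (ln q + 1) \<and>
          norm ((\<Sum>N<n. cis (z * (rot_sum \<theta> N - rot_sum \<theta> (q - 1) / 2))) / n - of_real \<rho>)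
            \<le> \<bar>z\<bar> * (W * \<omega> + 1) + K * z\<^sup>2 + 2 / \<omega>" if z: "\<bar>z\<bar> \<le> z0" for z
    proof -
      note R = s(3)[OF z]
      define rho where "rho = rot_cos \<theta> q z / q"
      define rho' where "rho' = rot_cos \<theta> q' z / q'"
      have rho: "0 < rho" "rho \<le> 1" "0 < rho'" "rho' \<le> 1"
        using R q abs_rot_cos_le[of \<theta> q z] abs_rot_cos_le[of \<theta> q' z] by (auto simp: rho_def rho'_def)
      have "\<bar>rho' - rho\<bar> \<le> \<bar>ln rho' - ln rho\<bar>" using rho by (intro abs_diff_le_abs_ln_diff)
      also have "\<dots> \<le> K * z\<^sup>2" using R by (simp add: rho_def rho'_def abs_minus_commute)
      finally interpret blocks c \<theta> p p' q q' z "K * z\<^sup>2"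
        using ba pq(1) by unfold_locales (auto simp: rho_def rho'_def)
      have "norm ((\<Sum>N<n. cis (z * (rot_sum \<theta> N - rot_sum \<theta> (q - 1) / 2))) / n - of_real rho)
          \<le> \<bar>z\<bar> * (2 * (1 + \<kappa>) * (n / (q + q')) + 1) + K * z\<^sup>2 + 2 * (q + q') / n"
        using mean_cis[OF n_pos pq(2,3) c(4)] unfolding mid_def \<rho>_def rho_def .
      moreover have "2 * (1 + \<kappa>) * (n / (q + q')) \<le> W * \<omega>"
      proof -
        have "n / (q + q') \<le> 2 * (real M + 1) * \<omega>" using n\<omega> qq by (simp add: pos_divide_le_eq mult_ac)
        then have "2 * (1 + \<kappa>) * (n / (q + q')) \<le> 2 * (1 + \<kappa>) * (2 * (real M + 1) * \<omega>)"
          using c by (intro mult_left_mono) auto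
        also have "\<dots> = W * \<omega>" by (simp add: W_def algebra_simps)
        finally show ?thesis .
      qed
      then have "\<bar>z\<bar> * (2 * (1 + \<kappa>) * (n / (q + q')) + 1) \<le> \<bar>z\<bar> * (W * \<omega> + 1)"
        by (intro mult_left_mono) auto
      moreover have "2 * (q + q') / n \<le> 2 / \<omega>"
        using upper n_pos \<omega> by (simp add: field_simps)
      ultimately have "norm ((\<Sum>N<n. cis (z * (rot_sum \<theta> N - rot_sum \<theta> (q - 1) / 2))) / n - of_real rho)
          \<le> \<bar>z\<bar> * (W * \<omega> + 1) + K * z\<^sup>2 + 2 / \<omega>" by linarith
      then show ?thesis using rho(1) R unfolding rho_def by blast
    qed
    note approx = this
    have qn': "q \<le> n" using qn by simp
    show ?thesis
      by (rule exI[of _ "rot_sum \<theta> (q - 1)"], rule exI[of _ s], rule exI[of _ q])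
         (intro conjI allI impI q(1) lower qn' pq(6) s(1,2) approx)
  qed
  note main = this
  show ?thesis
    by (rule exI[of _ K], rule exI[of _ \<eta>], rule exI[of _ z0], rule exI[of _ W], rule exI[of _ "n0 + 2"])
       (intro conjI allI impI c(1-3) W; rule main; assumption)
qed

lemma abs_exp_minus_1_le: "\<bar>exp x - 1\<bar> \<le> exp \<bar>x\<bar> - (1::real)"
proof (cases "0 \<le> x")
  case False
  have "2 \<le> exp x + exp (- x)" using exp_ge_add_one_self[of x] exp_ge_add_one_self[of "- x"] by linarith
  then show ?thesis using False by simp
qed simp

text \<open>The frequency \<open>z = t / sqrt (2 * s n)\<close> makes
  \<open>s n * z^2 = t^2 / 2\<close>. As \<open>s n\<close> is at least of order
  \<open>ln n\<close>, \<open>z^2\<close> is \<open>O(1 / ln n)\<close>, so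
  \<open>z^4 * ln n\<close> and \<open>\<bar>z\<bar> * \<omega> n\<close> tend to 0.\<close>

lemma mean_cis_tendsto:
  fixes T :: "nat \<Rightarrow> real" and u s \<omega> :: "nat \<Rightarrow> real"
  assumes c: "0 < K" "0 < \<eta>" "0 < z0" "0 < W"
    and \<omega>: "\<And>n. \<omega> n = ln (real n) powr (1 / 4)"
    and ev: "\<forall>\<^sub>F n in sequentially. 1 \<le> ln (real n) \<and> \<eta> / 4 * ln n \<le> s n \<and>
      (\<forall>z. \<bar>z\<bar> \<le> z0 \<longrightarrow> (\<exists>\<rho>>0. \<bar>ln \<rho> + s n * z\<^sup>2\<bar> \<le> K * z ^ 4 * (2 * ln n) \<and>
        norm ((\<Sum>N<n. cis (z * (T N - u n / 2))) / n - of_real \<rho>) \<le> \<bar>z\<bar> * (W * \<omega> n + 1) + K * z\<^sup>2 + 2 / \<omega> n))"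
  shows "(\<lambda>n. (\<Sum>N<n. cis (t / sqrt (2 * s n) * (T N - u n / 2))) / n) \<longlonglongrightarrow> of_real (exp (- t\<^sup>2 / 2))"
proof -
  define b where "b = \<bar>t\<bar> / sqrt (\<eta> / 2)"
  have b: "0 \<le> b" using c by (simp add: b_def)
  \<comment> \<open>The four terms stand for the displacement of the block centres, the mismatch of
    the two block types, the incomplete block, and the distance of \<open>\<rho>\<close> from the
    Gaussian value.\<close>
  define bound where "bound n = b * (W + 1) * (\<omega> n / sqrt (ln (real n))) + K * b\<^sup>2 * (1 / ln (real n)) + 2 * (1 / \<omega> n)
    + (exp (2 * K * b ^ 4 * (1 / ln (real n))) - 1)" for n :: nat
  have lim: "(\<lambda>n::nat. \<omega> n / sqrt (ln (real n))) \<longlonglongrightarrow> 0" "(\<lambda>n::nat. 1 / ln (real n)) \<longlonglongrightarrow> 0"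
    "(\<lambda>n::nat. 1 / \<omega> n) \<longlonglongrightarrow> 0"
    unfolding \<omega> by real_asymp+
  have "bound \<longlonglongrightarrow> b * (W + 1) * 0 + K * b\<^sup>2 * 0 + 2 * 0 + (exp (2 * K * b ^ 4 * 0) - 1)"
    unfolding bound_def by (intro tendsto_intros lim)
  then have bound0: "bound \<longlonglongrightarrow> 0" by simp
  have "(\<lambda>n::nat. b * (1 / sqrt (ln (real n)))) \<longlonglongrightarrow> b * 0"
    by (intro tendsto_intros) real_asymp
  then have small: "\<forall>\<^sub>F n in sequentially. b * (1 / sqrt (ln (real n))) < z0"
    using c(3) by (simp add: order_tendsto_iff)
  have "\<forall>\<^sub>F n in sequentially. norm ((\<Sum>N<n. cis (t / sqrt (2 * s n) * (T N - u n / 2))) / n - of_real (exp (- t\<^sup>2 / 2))) \<le> bound n"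
    using ev small
  proof eventually_elim
    case (elim n)
    define L where "L = ln (real n)"
    define z where "z = t / sqrt (2 * s n)"
    have L: "1 \<le> L" and s: "\<eta> / 4 * L \<le> s n" using elim by (auto simp: L_def)
    have "0 < \<eta> / 4 * L" using c L by simp
    then have s0: "0 < s n" using s by linarith
    have "sqrt (\<eta> / 2) * sqrt L \<le> sqrt (2 * s n)"
      unfolding real_sqrt_mult[symmetric] using s by (intro real_sqrt_le_mono) simp
    then have "\<bar>t\<bar> / sqrt (2 * s n) \<le> \<bar>t\<bar> / (sqrt (\<eta> / 2) * sqrt L)"
      using c L s0 by (intro divide_left_mono) auto
    then have zb: "\<bar>z\<bar> \<le> b * (1 / sqrt L)" using s0 by (simp add: z_def b_def abs_divide)
    then have "\<bar>z\<bar> \<le> z0" using elim by (simp add: L_def)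
    then obtain \<rho> where \<rho>: "0 < \<rho>" "\<bar>ln \<rho> + s n * z\<^sup>2\<bar> \<le> K * z ^ 4 * (2 * L)"
      "norm ((\<Sum>N<n. cis (z * (T N - u n / 2))) / n - of_real \<rho>) \<le> \<bar>z\<bar> * (W * \<omega> n + 1) + K * z\<^sup>2 + 2 / \<omega> n"
      using elim unfolding L_def by blast
    have sz: "s n * z\<^sup>2 = t\<^sup>2 / 2" using s0 by (simp add: z_def power_divide)
    have "\<bar>z\<bar>\<^sup>2 \<le> (b * (1 / sqrt L))\<^sup>2" using zb by (intro power_mono) auto
    then have z2: "z\<^sup>2 \<le> b\<^sup>2 * (1 / L)" using L by (simp add: power_mult_distrib power_divide)
    then have "(z\<^sup>2)\<^sup>2 \<le> (b\<^sup>2 * (1 / L))\<^sup>2" by (intro power_mono) auto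
    then have "z ^ 4 \<le> b ^ 4 / L\<^sup>2" by (simp add: power_mult_distrib power_divide)
    then have "K * z ^ 4 * (2 * L) \<le> K * (b ^ 4 / L\<^sup>2) * (2 * L)"
      using c L by (intro mult_right_mono mult_left_mono) auto
    also have "\<dots> = 2 * K * b ^ 4 * (1 / L)" using L by (simp add: power2_eq_square)
    finally have d: "\<bar>ln \<rho> + t\<^sup>2 / 2\<bar> \<le> 2 * K * b ^ 4 * (1 / L)" using \<rho>(2) sz by simp
    have "\<rho> = exp (- t\<^sup>2 / 2) * exp (ln \<rho> + t\<^sup>2 / 2)"
      using \<rho>(1) by (simp add: exp_add[symmetric])
    then have "\<rho> - exp (- t\<^sup>2 / 2) = exp (- t\<^sup>2 / 2) * (exp (ln \<rho> + t\<^sup>2 / 2) - 1)"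
      by (simp add: right_diff_distrib)
    then have "\<bar>\<rho> - exp (- t\<^sup>2 / 2)\<bar> = exp (- t\<^sup>2 / 2) * \<bar>exp (ln \<rho> + t\<^sup>2 / 2) - 1\<bar>"
      by (simp add: abs_mult)
    also have "\<dots> \<le> 1 * \<bar>exp (ln \<rho> + t\<^sup>2 / 2) - 1\<bar>" by (intro mult_right_mono) auto
    also have "\<dots> \<le> exp \<bar>ln \<rho> + t\<^sup>2 / 2\<bar> - 1" using abs_exp_minus_1_le by simp
    also have "\<dots> \<le> exp (2 * K * b ^ 4 * (1 / L)) - 1" using d by simp
    finally have \<rho>e: "\<bar>\<rho> - exp (- t\<^sup>2 / 2)\<bar> \<le> exp (2 * K * b ^ 4 * (1 / L)) - 1" .
    have \<omega>1: "1 \<le> \<omega> n" unfolding \<omega> using L by (simp add: L_def ge_one_powr_ge_zero)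
    have "\<bar>z\<bar> * (W * \<omega> n + 1) \<le> (b * (1 / sqrt L)) * ((W + 1) * \<omega> n)"
    proof (rule mult_mono[OF zb])
      show "W * \<omega> n + 1 \<le> (W + 1) * \<omega> n" using \<omega>1 by (simp add: algebra_simps)
      show "0 \<le> b * (1 / sqrt L)" using b L by simp
      show "0 \<le> W * \<omega> n + 1" using c \<omega>1 by (simp add: add_nonneg_nonneg)
    qed
    also have "\<dots> = b * (W + 1) * (\<omega> n / sqrt L)" by simp
    finally have 1: "\<bar>z\<bar> * (W * \<omega> n + 1) \<le> b * (W + 1) * (\<omega> n / sqrt L)" .
    have 2: "K * z\<^sup>2 \<le> K * b\<^sup>2 * (1 / L)" using mult_left_mono[OF z2, of K] c by (simp add: mult.assoc)
    have "norm ((\<Sum>N<n. cis (z * (T N - u n / 2))) / n - of_real (exp (- t\<^sup>2 / 2)))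
        \<le> norm ((\<Sum>N<n. cis (z * (T N - u n / 2))) / n - of_real \<rho>) + norm (of_real \<rho> - of_real (exp (- t\<^sup>2 / 2)) :: complex)"
      using norm_triangle_ineq[of "(\<Sum>N<n. cis (z * (T N - u n / 2))) / n - of_real \<rho>"
          "of_real \<rho> - of_real (exp (- t\<^sup>2 / 2))"] by simp
    also have "norm (of_real \<rho> - of_real (exp (- t\<^sup>2 / 2)) :: complex) = \<bar>\<rho> - exp (- t\<^sup>2 / 2)\<bar>"
      by (simp only: of_real_diff[symmetric] norm_of_real)
    finally show ?case using \<rho>(3) 1 2 \<rho>e unfolding bound_def L_def[symmetric] z_def[symmetric] by simp
  qed
  then have "(\<lambda>n. (\<Sum>N<n. cis (t / sqrt (2 * s n) * (T N - u n / 2))) / n - of_real (exp (- t\<^sup>2 / 2))) \<longlonglongrightarrow> 0"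
    by (rule Lim_null_comparison[OF _ bound0])
  then show ?thesis by (rule LIM_zero_cancel)
qed

text \<open>Centre \<open>u / 2\<close> and variance \<open>2 * s\<close> of the rotation sums
  become centre \<open>u / 4 + 1 / 2\<close> and standard deviation \<open>sqrt (s / 2)\<close> of
  the discrepancy; the shift \<open>N\<close> to \<open>Suc N\<close> matches the ranges
  exactly.\<close>

lemma normalized_mean_cis:
  assumes s: "0 < s"
  shows "(\<Sum>N=1..n. cis (t * ((discrepancy \<alpha> N - (u / 4 + 1 / 2)) / sqrt (s / 2))))
    = (\<Sum>N<n. cis (t / sqrt (2 * s) * (rot_sum (2 * \<alpha>) N - u / 2)))"
proof -
  have "sqrt (2 * s) = sqrt (2\<^sup>2 * (s / 2))" by simp
  also have "\<dots> = 2 * sqrt (s / 2)" unfolding real_sqrt_mult by simp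
  finally have r: "sqrt (2 * s) = 2 * sqrt (s / 2)" .
  have "t * ((discrepancy \<alpha> (Suc N) - (u / 4 + 1 / 2)) / sqrt (s / 2)) = t / sqrt (2 * s) * (rot_sum (2 * \<alpha>) N - u / 2)" for N
    unfolding discrepancy_eq_rot_sum r using s by (simp add: field_simps)
  then show ?thesis by (simp only: One_nat_def sum.atLeast1_atMost_eq)
qed

theorem theorem1p9:
  fixes \<alpha> :: real
  assumes "bounded_type \<alpha>"
  shows "\<exists>A B :: nat \<Rightarrow> real.
           A \<in> O(\<lambda>n. ln (real n)) \<and>
           same_order B (\<lambda>n. sqrt (ln (real n))) \<and>
           (\<forall>n\<ge>1. B n > 0) \<and>
           (\<forall>a b :: real. a < b \<longrightarrow>
              (\<lambda>n. real (card {N. 1 \<le> N \<and> N \<le> n \<and>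
                                 (discrepancy \<alpha> N - A n) / B n \<in> {a..b}}) / real n)
              \<longlonglongrightarrow> 1 / sqrt (2 * pi) * integral {a..b} (\<lambda>t. exp (- t\<^sup>2 / 2)))"
proof -
  obtain c where ba: "badly_approximable (c / 2) (2 * \<alpha>)"
    using bounded_type_badly_approximable[OF assms] badly_approximable_double by blast
  obtain K \<eta> z0 W :: real and n0 :: nat where c: "0 < K" "0 < \<eta>" "0 < z0" "0 < W"
    and approx: "\<And>(n::nat) \<omega>. 1 \<le> \<omega> \<Longrightarrow> real n0 \<le> n / \<omega> \<Longrightarrow>
     (\<exists>u s. \<exists>Q::nat. 0 < Q \<and> n / (W * \<omega>) \<le> Q \<and> Q \<le> n \<and> \<bar>u\<bar> \<le> K * (ln Q + 1) \<and>
       \<eta> * ln Q - K \<le> s \<and> s \<le> K * (ln Q + 1) \<and>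
       (\<forall>z. \<bar>z\<bar> \<le> z0 \<longrightarrow> (\<exists>\<rho>>0. \<bar>ln \<rho> + s * z\<^sup>2\<bar> \<le> K * z ^ 4 * (ln Q + 1) \<and>
          norm ((\<Sum>N<n. cis (z * (rot_sum (2 * \<alpha>) N - u / 2))) / n - of_real \<rho>)
            \<le> \<bar>z\<bar> * (W * \<omega> + 1) + K * z\<^sup>2 + 2 / \<omega>)))"
    using mean_cis_approximation[OF ba] by metis
  define \<omega> where "\<omega> n = ln (real n) powr (1 / 4)" for n :: nat
  define good where "good n u s \<longleftrightarrow> \<bar>u\<bar> \<le> 2 * K * ln (real n) \<and> \<eta> / 4 * ln n \<le> s \<and> s \<le> 2 * K * ln n \<and>
     (\<forall>z. \<bar>z\<bar> \<le> z0 \<longrightarrow> (\<exists>\<rho>>0. \<bar>ln \<rho> + s * z\<^sup>2\<bar> \<le> K * z ^ 4 * (2 * ln n) \<and>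
          norm ((\<Sum>N<n. cis (z * (rot_sum (2 * \<alpha>) N - u / 2))) / n - of_real \<rho>)
            \<le> \<bar>z\<bar> * (W * \<omega> n + 1) + K * z\<^sup>2 + 2 / \<omega> n))" for n :: nat and u s :: real
  have "\<forall>\<^sub>F n in sequentially. \<exists>u s. good n u s"
  proof -
    have "filterlim (\<lambda>n. real n / \<omega> n) at_top sequentially" unfolding \<omega>_def by real_asymp
    then have e1: "\<forall>\<^sub>F n in sequentially. real n0 \<le> real n / \<omega> n" by (simp add: filterlim_at_top)
    have e2: "\<forall>\<^sub>F n in sequentially. 1 \<le> \<omega> n" unfolding \<omega>_def by real_asymp
    \<comment> \<open>This gives \<open>W * \<omega> n \<le> sqrt n\<close>, so that
      \<open>ln Q\<close> is at least half of \<open>ln n\<close>.\<close>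
    have "filterlim (\<lambda>n. ln (real n) / 2 - ln (\<omega> n)) at_top sequentially" unfolding \<omega>_def by real_asymp
    then have e3: "\<forall>\<^sub>F n in sequentially. ln W \<le> ln (real n) / 2 - ln (\<omega> n)" by (simp add: filterlim_at_top)
    have "filterlim (\<lambda>n. ln (real n)) at_top sequentially" by real_asymp
    \<comment> \<open>The bound \<open>4 * K / \<eta>\<close> lets
      \<open>\<eta> / 2 * ln n - K\<close> stay above \<open>\<eta> / 4 * ln n\<close>.\<close>
    then have e4: "\<forall>\<^sub>F n in sequentially. max 1 (4 * K / \<eta>) \<le> ln (real n)" by (simp only: filterlim_at_top)
    show ?thesis
      using e1 e2 e3 e4 eventually_gt_at_top[of 0]
    proof eventually_elim
      case (elim n)
      obtain u s Q where Q: "0 < Q" "n / (W * \<omega> n) \<le> Q" "Q \<le> n" "\<bar>u\<bar> \<le> K * (ln Q + 1)"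
        "\<eta> * ln Q - K \<le> s" "s \<le> K * (ln Q + 1)"
        "\<And>z. \<bar>z\<bar> \<le> z0 \<Longrightarrow> \<exists>\<rho>>0. \<bar>ln \<rho> + s * z\<^sup>2\<bar> \<le> K * z ^ 4 * (ln Q + 1) \<and>
          norm ((\<Sum>N<n. cis (z * (rot_sum (2 * \<alpha>) N - u / 2))) / n - of_real \<rho>)
            \<le> \<bar>z\<bar> * (W * \<omega> n + 1) + K * z\<^sup>2 + 2 / \<omega> n"
        using approx[OF elim(2,1)] by blast
      define L where "L = ln (real n)"
      have L: "1 \<le> L" "4 * K / \<eta> \<le> L" using elim(4) by (auto simp: L_def)
      have QL: "ln Q \<le> L" unfolding L_def using Q by simp
      have "ln (n / (W * \<omega> n)) = L - ln W - ln (\<omega> n)"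
        using elim(2,5) c by (simp add: L_def ln_div ln_mult_pos)
      moreover have "ln (n / (W * \<omega> n)) \<le> ln Q" using Q elim(2,5) c by (intro ln_mono) auto
      ultimately have LQ: "L / 2 \<le> ln Q" using elim(3) by (simp add: L_def)
      have "4 * K \<le> \<eta> * L" using L(2) c by (simp add: field_simps)
      moreover have "\<eta> * (L / 2) \<le> \<eta> * ln Q" using LQ c by (intro mult_left_mono) auto
      ultimately have s_low: "\<eta> / 4 * L \<le> s" using Q(5) by simp
      have KL: "K * (ln Q + 1) \<le> 2 * K * L"
        using mult_left_mono[of "ln Q + 1" "2 * L" K] QL L c by simp
      have "\<exists>\<rho>>0. \<bar>ln \<rho> + s * z\<^sup>2\<bar> \<le> K * z ^ 4 * (2 * L) \<and>
          norm ((\<Sum>N<n. cis (z * (rot_sum (2 * \<alpha>) N - u / 2))) / n - of_real \<rho>)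
            \<le> \<bar>z\<bar> * (W * \<omega> n + 1) + K * z\<^sup>2 + 2 / \<omega> n" if z: "\<bar>z\<bar> \<le> z0" for z
      proof -
        have "K * z ^ 4 * (ln Q + 1) \<le> K * z ^ 4 * (2 * L)"
          using QL L c by (intro mult_left_mono) auto
        then show ?thesis using Q(7)[OF z] order_trans by blast
      qed
      then have "good n u s"
        unfolding good_def L_def[symmetric] using Q(4,6) KL s_low by auto
      then show ?case by blast
    qed
  qed
  then obtain N0 where "\<forall>n\<ge>N0. \<exists>u s. good n u s" by (auto simp: eventually_sequentially)
  then obtain u s where us: "\<And>n. N0 \<le> n \<Longrightarrow> good n (u n) (s n)" by metis
  have "\<forall>\<^sub>F n in sequentially. 1 \<le> ln (real n)" by real_asymp
  then have ev: "\<forall>\<^sub>F n in sequentially. 1 \<le> ln (real n) \<and> good n (u n) (s n)"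
    using eventually_ge_at_top[of N0] by eventually_elim (use us in auto)
  define A where "A n = u n / 4 + 1 / 2" for n
  \<comment> \<open>The default 1 concerns only finitely many \<open>n\<close> and keeps
    \<open>B n\<close> positive everywhere.\<close>
  define B where "B n = (if 0 < s n then sqrt (s n / 2) else 1)" for n
  have s_pos: "0 < s n" if "1 \<le> ln (real n) \<and> good n (u n) (s n)" for n
  proof -
    have "0 < \<eta> / 4 * ln n" using that c by simp
    then show ?thesis using that unfolding good_def by linarith
  qed
  have "A \<in> O(\<lambda>n. ln (real n))"
  proof (rule bigoI)
    show "\<forall>\<^sub>F n in sequentially. norm (A n) \<le> (K / 2 + 1 / 2) * norm (ln (real n))"
      using ev
    proof eventually_elim
      case (elim n)
      have "norm (A n) \<le> \<bar>u n\<bar> / 4 + 1 / 2" unfolding A_def by simp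
      also have "\<dots> \<le> (2 * K * ln (real n)) / 4 + ln (real n) / 2"
        using elim unfolding good_def by (intro add_mono divide_right_mono) auto
      also have "\<dots> = (K / 2 + 1 / 2) * norm (ln (real n))" using elim by (simp add: algebra_simps)
      finally show ?case .
    qed
  qed
  moreover have "same_order B (\<lambda>n. sqrt (ln (real n)))"
  proof -
    \<comment> \<open>Dominates both ends of \<open>\<eta> / 8 \<le> s n / 2 / ln n \<le> K\<close>
      after taking roots; the 2 makes \<open>C > 1\<close>.\<close>
    define C where "C = 2 + sqrt K + 1 / sqrt (\<eta> / 8)"
    have C: "1 < C" "sqrt K \<le> C" "1 / sqrt (\<eta> / 8) \<le> C"
      using c by (auto simp: C_def add_nonneg_nonneg add_pos_nonneg)
    have "1 / C \<le> 1 / (1 / sqrt (\<eta> / 8))" using C c by (intro divide_left_mono) auto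
    then have C': "1 / C \<le> sqrt (\<eta> / 8)" by simp
    have "\<forall>\<^sub>F n in sequentially. 1 / C \<le> B n / sqrt (ln (real n)) \<and> B n / sqrt (ln (real n)) \<le> C"
      using ev
    proof eventually_elim
      case (elim n)
      have "B n / sqrt (ln (real n)) = sqrt (s n / 2 / ln (real n))"
        using s_pos[OF elim] by (simp add: B_def real_sqrt_divide real_sqrt_mult)
      moreover have "\<eta> / 8 \<le> s n / 2 / ln (real n)" "s n / 2 / ln (real n) \<le> K"
        using elim by (auto simp: good_def field_simps)
      then have "sqrt (\<eta> / 8) \<le> sqrt (s n / 2 / ln (real n))" "sqrt (s n / 2 / ln (real n)) \<le> sqrt K"
        by (auto intro: real_sqrt_le_mono)
      ultimately show ?case using C C' by linarith
    qed
    then obtain N1 where "\<forall>n\<ge>N1. 1 / C \<le> B n / sqrt (ln (real n)) \<and> B n / sqrt (ln (real n)) \<le> C"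
      by (auto simp: eventually_sequentially)
    then show ?thesis
      unfolding same_order_def using C(1) by (intro exI[of _ C] exI[of _ "max 2 N1"]) auto
  qed
  moreover have "\<forall>n\<ge>1. B n > 0" by (simp add: B_def)
  moreover have "(\<lambda>n. real (card {N. 1 \<le> N \<and> N \<le> n \<and> (discrepancy \<alpha> N - A n) / B n \<in> {a..b}}) / real n)
      \<longlonglongrightarrow> 1 / sqrt (2 * pi) * integral {a..b} (\<lambda>t. exp (- t\<^sup>2 / 2))" if "a < b" for a b
  proof (rule interval_frequency_tendsto_normal[OF _ that])
    fix t
    have "(\<lambda>n. (\<Sum>N<n. cis (t / sqrt (2 * s n) * (rot_sum (2 * \<alpha>) N - u n / 2))) / n) \<longlonglongrightarrow> of_real (exp (- t\<^sup>2 / 2))"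
      by (rule mean_cis_tendsto[OF c \<omega>_def]) (use ev in \<open>eventually_elim, simp add: good_def\<close>)
    moreover have "\<forall>\<^sub>F n in sequentially. (\<Sum>N<n. cis (t / sqrt (2 * s n) * (rot_sum (2 * \<alpha>) N - u n / 2))) / of_nat n
        = (\<Sum>N=1..n. cis (t * ((discrepancy \<alpha> N - A n) / B n))) / of_nat n"
      using ev
    proof eventually_elim
      case (elim n)
      then show ?case using normalized_mean_cis[OF s_pos[OF elim]] s_pos[OF elim] by (simp add: A_def B_def)
    qed
    ultimately show "(\<lambda>n. (\<Sum>N=1..n. cis (t * ((discrepancy \<alpha> N - A n) / B n))) / n) \<longlonglongrightarrow> of_real (exp (- t\<^sup>2 / 2))"
      by (rule Lim_transform_eventually)
  qed
  ultimately show ?thesis by blast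
qed

end
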